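(* Let $n\ge 2$ be an integer and let $X$ be either $\mathbf{R}$ or the circle $S_{n-1}$. Then the normalizer of $A_n(X)$ in $\mathrm{Homeo}(X)$ is contained in the normalizer of $B_n(X)$ in $\mathrm{Homeo}(X)$. Consequently $B_n(X)$ is characteristic in $A_n(X)$.
   Context: Functions are written to the right of their arguments and composed from left to right. For an integer $n\ge 2$: $\mathbf{Z}[\frac1n]=\{an^b : a,b\in\mathbf{Z}\}$ and $\langle n\rangle=\{n^k : k\in\mathbf{Z}\}$. $S_{n-1}=\mathbf{R}/(n-1)\mathbf{Z}$ is the circle of length $n-1$; the image $\mathbf{Z}[\frac1n]/(n-1)\mathbf{Z}$ of $\mathbf{Z}[\frac1n]$ in $S_{n-1}$ is again denoted $\mathbf{Z}[\frac1n]$. A break of a piecewise linear (PL) function is a point where its derivative is discontinuous. For $X=\mathbf{R}$ or $X=S_{n-1}$, $A_n(X)$ is the group of all homeomorphisms $h:X\to X$ such that (1) $h$ preserves orientation, (2) $h$ is PL, (3) all slopes of $h$ are in $\langle n\rangle$, (4) the breaks of $h$ lie in a discrete subset of $\mathbf{Z}[\frac1n]$, (5) $(\mathbf{Z}[\frac1n])h=\mathbf{Z}[\frac1n]$. Let $\phi_n:\mathbf{Z}[\frac1n]\to\mathbf{Z}_{n-1}=\mathbf{Z}/(n-1)\mathbf{Z}$ be the well-defined surjective ring homomorphism $(an^b)\phi_n=a\pmod{n-1}$; since $(n-1)\mathbf{Z}$ is in its kernel, it induces a homomorphism, also denoted $\phi_n$, on $\mathbf{Z}[\frac1n]/(n-1)\mathbf{Z}$.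 There is a well-defined homomorphism $\rho_n:A_n(X)\to\mathbf{Z}_{n-1}$ given by $f\rho_n=(xf)\phi_n-x\phi_n$ for any $x\in\mathbf{Z}[\frac1n]$ in $X$, and $B_n(X)=\ker\rho_n$. *)

theory Defs
  imports "HOL-Analysis.Analysis" "HOL-Algebra.Group_Action" "HOL-Algebra.Elementary_Groups"
    "HOL-Number_Theory.Cong"
begin

text \<open>
  A one-dimensional space is given by its topology together with its covering map from the real
  line.  For the line itself the covering map is the identity; for the circle of length
  \<open>n - 1\<close> it sends a real number to its coset modulo \<open>(n - 1)\<int>\<close>.
\<close>

record 'a covered_space =
  topo :: "'a topology"
  proj :: "real \<Rightarrow> 'a"

definition real_line :: "real covered_space" where
  "real_line = \<lparr>topo = euclideanreal, proj = (\<lambda>x. x)\<rparr>"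

definition circle_proj :: "nat \<Rightarrow> real \<Rightarrow> real set" where
  "circle_proj n x = range (\<lambda>k::int. x + of_int k * (real n - 1))"

definition circle :: "nat \<Rightarrow> real set covered_space" where
  "circle n =
     \<lparr>topo = topology (\<lambda>U. U \<subseteq> range (circle_proj n) \<and> open (circle_proj n -` U)),
      proj = circle_proj n\<rparr>"

lemma openin_circle:
  "openin (topo (circle n)) U \<longleftrightarrow> U \<subseteq> range (circle_proj n) \<and> open (circle_proj n -` U)"
proof -
  have "istopology (\<lambda>U. U \<subseteq> range (circle_proj n) \<and> open (circle_proj n -` U))"
    by (auto simp: istopology_def vimage_Union)
  then show ?thesis
    by (simp add: circle_def topology_inverse')
qed

lemma topspace_circle: "topspace (topo (circle n)) = range (circle_proj n)"
proof
  show "topspace (topo (circle n)) \<subseteq> range (circle_proj n)"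
    using openin_circle openin_topspace by blast
  have "circle_proj n -` range (circle_proj n) = UNIV"
    by auto
  then show "range (circle_proj n) \<subseteq> topspace (topo (circle n))"
    by (intro openin_subset) (simp add: openin_circle)
qed

lemma quotient_map_circle_proj: "quotient_map euclideanreal (topo (circle n)) (circle_proj n)"
  by (simp add: quotient_map_def topspace_circle openin_circle vimage_def)

text \<open>
  Maps act on the right, so \<open>f \<otimes> g\<close> is ``first \<open>f\<close>, then \<open>g\<close>''.  Homeomorphisms of either
  orientation are included.
\<close>

definition Homeo :: "'a covered_space \<Rightarrow> ('a \<Rightarrow> 'a) monoid" where
  "Homeo X =
     \<lparr>carrier = {h \<in> extensional (topspace (topo X)). homeomorphic_map (topo X) (topo X) h},
      mult = (\<lambda>f g. compose (topspace (topo X)) g f),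
      one = (\<lambda>x\<in>topspace (topo X). x)\<rparr>"

lemma group_Homeo: "group (Homeo X)"
proof (rule groupI)
  let ?S = "topspace (topo X)"
  have onto: "h x \<in> ?S" if "homeomorphic_map (topo X) (topo X) h" "x \<in> ?S" for h x
    using homeomorphic_imp_surjective_map[OF that(1)] that(2) by blast
  fix f g h assume f: "f \<in> carrier (Homeo X)" and g: "g \<in> carrier (Homeo X)"
    and h: "h \<in> carrier (Homeo X)"
  have "homeomorphic_map (topo X) (topo X) (g \<circ> f)"
    using f g homeomorphic_map_compose by (auto simp: Homeo_def)
  then have "homeomorphic_map (topo X) (topo X) (compose ?S g f)"
    by (rule homeomorphic_map_eq) (auto simp: compose_def)
  then show "f \<otimes>\<^bsub>Homeo X\<^esub> g \<in> carrier (Homeo X)"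
    by (simp add: Homeo_def compose_def)
  show "f \<otimes>\<^bsub>Homeo X\<^esub> g \<otimes>\<^bsub>Homeo X\<^esub> h = f \<otimes>\<^bsub>Homeo X\<^esub> (g \<otimes>\<^bsub>Homeo X\<^esub> h)"
    using f onto by (auto simp: Homeo_def compose_def fun_eq_iff)
  show "\<one>\<^bsub>Homeo X\<^esub> \<otimes>\<^bsub>Homeo X\<^esub> f = f"
    using f by (auto simp: Homeo_def compose_def fun_eq_iff extensional_def)
  obtain f' where f': "homeomorphic_maps (topo X) (topo X) f f'"
    using f by (auto simp: Homeo_def homeomorphic_map_maps)
  have hf': "homeomorphic_map (topo X) (topo X) (restrict f' ?S)"
    by (rule homeomorphic_map_eq[of _ _ f'])
      (use f' in \<open>auto simp: homeomorphic_maps_map\<close>)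
  have "restrict f' ?S \<otimes>\<^bsub>Homeo X\<^esub> f = \<one>\<^bsub>Homeo X\<^esub>"
    using f' by (auto simp: Homeo_def compose_def fun_eq_iff homeomorphic_maps_def)
  with hf' show "\<exists>y\<in>carrier (Homeo X). y \<otimes>\<^bsub>Homeo X\<^esub> f = \<one>\<^bsub>Homeo X\<^esub>"
    by (intro bexI[of _ "restrict f' ?S"]) (simp_all add: Homeo_def)
next
  have "homeomorphic_map (topo X) (topo X) (\<lambda>x\<in>topspace (topo X). x)"
    by (rule homeomorphic_map_eq[of _ _ id]) auto
  then show "\<one>\<^bsub>Homeo X\<^esub> \<in> carrier (Homeo X)"
    by (simp add: Homeo_def)
qed

definition n_adic :: "nat \<Rightarrow> real set" where
  "n_adic n = {x. \<exists>(a::int) (b::int). x = of_int a * real n powi b}"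

definition slope_group :: "nat \<Rightarrow> real set" where
  "slope_group n = range (\<lambda>k::int. real n powi k)"

definition piecewise_linear :: "(real \<Rightarrow> real) \<Rightarrow> bool" where
  "piecewise_linear H \<longleftrightarrow>
     continuous_on UNIV H \<and>
     (\<exists>D. (\<forall>a b. finite (D \<inter> {a..b})) \<and>
          (\<forall>a b. {a<..<b} \<inter> D = {} \<longrightarrow> (\<exists>m c. \<forall>x\<in>{a<..<b}. H x = m * x + c)))"

definition breaks :: "(real \<Rightarrow> real) \<Rightarrow> real set" where
  "breaks H = {x. \<not> (H field_differentiable (at x) \<and> isCont (deriv H) x)}"

text \<open>
  Orientation, linearity, slopes and breaks of a homeomorphism of \<open>X\<close> are those of a continuous
  lift to the real line.  For \<open>real_line\<close> the only lift of \<open>h\<close> is \<open>h\<close> itself; for the circle,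
  lifts of \<open>h\<close> differ by translations by elements of \<open>(n - 1)\<int>\<close>, so the choice is immaterial.
\<close>

definition is_lift :: "'a covered_space \<Rightarrow> ('a \<Rightarrow> 'a) \<Rightarrow> (real \<Rightarrow> real) \<Rightarrow> bool" where
  "is_lift X h H \<longleftrightarrow> continuous_on UNIV H \<and> (\<forall>t. proj X (H t) = h (proj X t))"

lemma is_lift_real_line: "is_lift real_line h H \<longleftrightarrow> continuous_on UNIV h \<and> H = h"
  by (auto simp: is_lift_def real_line_def fun_eq_iff)

text \<open>
  Since breaks of a \<open>piecewise_linear\<close> map are locally finite, it makes no difference whether the
  set \<open>D\<close> below is required to be closed as well as discrete.
\<close>

definition A_set :: "nat \<Rightarrow> 'a covered_space \<Rightarrow> ('a \<Rightarrow> 'a) set" where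
  "A_set n X =
     {h \<in> carrier (Homeo X).
        (\<exists>H. is_lift X h H \<and>
             strict_mono H \<and>
             piecewise_linear H \<and>
             (\<forall>t. H field_differentiable (at t) \<longrightarrow> deriv H t \<in> slope_group n) \<and>
             (\<exists>D \<subseteq> proj X ` n_adic n.
                subtopology (topo X) D = discrete_topology D \<and> proj X ` breaks H \<subseteq> D)) \<and>
        h ` (proj X ` n_adic n) = proj X ` n_adic n}"

definition A_group :: "nat \<Rightarrow> 'a covered_space \<Rightarrow> ('a \<Rightarrow> 'a) monoid" where
  "A_group n X = (Homeo X)\<lparr>carrier := A_set n X\<rparr>"

definition phi :: "nat \<Rightarrow> real \<Rightarrow> int" where
  "phi n x = (THE r. \<exists>(a::int) (b::int). x = of_int a * real n powi b \<and> r = a mod int (n - 1))"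

lemma phi_eq:
  fixes a b :: int
  assumes n: "n \<ge> 2"
  shows "phi n (of_int a * real n powi b) = a mod int (n - 1)"
proof -
  have pow1: "[int n ^ k = 1] (mod int (n - 1))" for k
  proof -
    have "[int n = 1] (mod int (n - 1))"
      using n by (simp add: cong_iff_dvd_diff of_nat_diff)
    from cong_pow[OF this, of k] show ?thesis
      by simp
  qed
  have aux: "a mod int (n - 1) = a' mod int (n - 1)"
    if eq: "of_int a * real n powi b = of_int a' * real n powi b'" and le: "b \<le> b'"
    for a a' b b' :: int
  proof -
    obtain k where k: "b' = b + int k"
      using le zle_iff_zadd by auto
    have "real n powi b' = real n powi b * real n ^ k"
      using n by (simp add: k power_int_add)
    with eq n have "of_int a = of_int a' * real n ^ k"
      by simp
    then have "real_of_int a = of_int (a' * int n ^ k)"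
      by simp
    then have "a = a' * int n ^ k"
      by (simp only: of_int_eq_iff)
    moreover have "[a' * int n ^ k = a' * 1] (mod int (n - 1))"
      using pow1 by (rule cong_scalar_left)
    ultimately show ?thesis
      by (simp add: cong_def)
  qed
  show ?thesis
    unfolding phi_def
  proof (rule the_equality)
    show "\<exists>a' b'. of_int a * real n powi b = of_int a' * real n powi b' \<and>
            a mod int (n - 1) = a' mod int (n - 1)"
      by blast
  next
    fix r
    assume "\<exists>a' b'. of_int a * real n powi b = of_int a' * real n powi b' \<and> r = a' mod int (n - 1)"
    then obtain a' b' where "of_int a * real n powi b = of_int a' * real n powi b'"
      "r = a' mod int (n - 1)"
      by blast
    then show "r = a mod int (n - 1)"
      using aux[of a b a' b'] aux[of a' b' a b] by (cases "b \<le> b'") auto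
  qed
qed

definition phi_on :: "nat \<Rightarrow> 'a covered_space \<Rightarrow> 'a \<Rightarrow> int" where
  "phi_on n X y = (THE r. \<exists>x\<in>n_adic n. y = proj X x \<and> r = phi n x)"

lemma phi_on_real_line: "x \<in> n_adic n \<Longrightarrow> phi_on n real_line x = phi n x"
  by (auto simp: phi_on_def real_line_def)

lemma phi_on_circle:
  assumes n: "n \<ge> 2" and x: "x \<in> n_adic n"
  shows "phi_on n (circle n) (circle_proj n x) = phi n x"
  unfolding phi_on_def
proof (rule the_equality)
  show "\<exists>z\<in>n_adic n. circle_proj n x = proj (circle n) z \<and> phi n x = phi n z"
    using x by (auto simp: circle_def)
next
  fix r
  assume "\<exists>z\<in>n_adic n. circle_proj n x = proj (circle n) z \<and> r = phi n z"
  then obtain z where z: "z \<in> n_adic n" "circle_proj n x = circle_proj n z" "r = phi n z"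
    by (auto simp: circle_def)
  have "z = z + of_int 0 * (real n - 1)"
    by simp
  then have "z \<in> circle_proj n z"
    unfolding circle_proj_def by (rule range_eqI)
  then have "z \<in> circle_proj n x"
    by (simp only: z(2))
  then obtain k :: int where k: "z = x + of_int k * (real n - 1)"
    by (auto simp: circle_proj_def)
  obtain a b :: int where ab: "x = of_int a * real n powi b"
    using x by (auto simp: n_adic_def)
  define c d where "c = nat \<bar>b\<bar>" and "d = nat (b + \<bar>b\<bar>)"
  have "b = int d + (- int c)"
    by (auto simp: c_def d_def)
  then have "real n powi b = real n ^ d * real n powi (- int c)"
    using n power_int_add[of "real n" "int d" "- int c"] by simp
  then have x': "x = of_int (a * int n ^ d) * real n powi (- int c)"
    by (simp add: ab)
  moreover have "of_int k * (real n - 1) =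
      of_int (k * int n ^ c * int (n - 1)) * real n powi (- int c)"
    using n by (simp add: power_int_minus of_nat_diff)
  ultimately have "z = of_int (a * int n ^ d + k * int n ^ c * int (n - 1)) * real n powi (- int c)"
    unfolding k by (simp only: of_int_add distrib_right)
  then have "phi n z = (a * int n ^ d + k * int n ^ c * int (n - 1)) mod int (n - 1)"
    using phi_eq[OF n] by blast
  also have "\<dots> = phi n x"
    unfolding x' phi_eq[OF n] by simp
  finally show "r = phi n x"
    using z(3) by simp
qed

definition rho :: "nat \<Rightarrow> 'a covered_space \<Rightarrow> ('a \<Rightarrow> 'a) \<Rightarrow> int" where
  "rho n X f =
     (THE r. \<forall>y\<in>proj X ` n_adic n. r = (phi_on n X (f y) - phi_on n X y) mod int (n - 1))"

definition B_set :: "nat \<Rightarrow> 'a covered_space \<Rightarrow> ('a \<Rightarrow> 'a) set" where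
  "B_set n X = kernel (A_group n X) (integer_mod_group (n - 1)) (rho n X)"

definition characteristic :: "'a set \<Rightarrow> ('a, 'b) monoid_scheme \<Rightarrow> bool" where
  "characteristic H G \<longleftrightarrow> subgroup H G \<and> (\<forall>\<alpha>\<in>auto G. \<alpha> ` H = H)"

end

theory Submission
  imports Defs
begin

text \<open>Both claims follow once the kernel \<open>B\<close> of \<open>\<rho>\<^sub>n\<close> is described inside \<open>A\<close> by group theory alone: then
every automorphism of \<open>A\<close> preserves \<open>B\<close>, and a homeomorphism that normalizes \<open>A\<close> acts on \<open>A\<close> by an
automorphism (\<open>normalizer_subset_if_characteristic\<close>).  Homeomorphisms are replaced throughout by
their lifts, which are maps of the real line commuting with the translation by \<open>p\<close>, where \<open>p = 0\<close>
for the line and \<open>p = n - 1\<close> for the circle.  For a lift \<open>F\<close> the displacement \<open>F x - x\<close> at \<open>n\<close>-adic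
points \<open>x\<close> is constant modulo \<open>(n - 1)\<int>[1/n]\<close>, because all slopes are congruent to \<open>1\<close>; the group
\<open>B\<close> consists of the maps for which it vanishes.  The basic construction is that an \<open>n\<close>-adic interval
can be mapped onto any other one of congruent length (\<open>pl_map_between_intervals\<close>).  Hence there are
maps of trivial displacement that take prescribed values at the \<open>n\<close>-adic points of a subdivision of
the line, as long as these values form a subdivision, too, and are congruent to the points.

On the line, \<open>B\<close> is the derived subgroup of \<open>A\<close>.  Given \<open>f\<close> in \<open>B\<close>, there is \<open>u\<close> in \<open>B\<close> lying above
both the identity and the inverse of \<open>f\<close>.  Then \<open>u\<close> and \<open>f u\<close> (first \<open>f\<close>, then \<open>u\<close>) both move all
points to the right.  Two such maps in \<open>B\<close> are conjugate in \<open>A\<close>: match a fundamental domain of the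
one with a fundamental domain of the other and extend equivariantly.  If
\<open>f u = c\<inverse> u c\<close>, then \<open>f\<close> is the commutator of \<open>c\<inverse>\<close> and \<open>u\<close>.

On the circle, \<open>B\<close> is the set of all \<open>f\<close> in \<open>A\<close> that centralize \<open>A'/A''\<close>, that is, \<open>[f, a] \<in> A''\<close> for
all \<open>a \<in> A'\<close>.  Elements of \<open>B\<close> have this property because \<open>A' \<subseteq> B\<close> and \<open>[B, B] \<subseteq> A''\<close>.  For the latter,
let \<open>f\<close> and \<open>g\<close> be supported in one proper arc.  Multiplying each by the inverse of a conjugate with
support in another place gives two elements of \<open>A'\<close> whose commutator is still \<open>[f, g]\<close>.  Hence
conjugation inside a proper arc does not change classes modulo \<open>A''\<close>, and two elements with support
in arcs can be shrunk to elements with disjoint supports: all such elements commute modulo \<open>A''\<close>.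
Up to deck translations, every element of \<open>B\<close> is a product of two of them.

Conversely, let \<open>f\<close> be outside \<open>B\<close>, which is possible for \<open>n \<ge> 3\<close> only.  For a residue
class \<open>c\<close> of \<open>n\<close>-adic points, add up the jumps of the logarithmic slope of a map over the points of \<open>c\<close>.  On \<open>B\<close>, whose elements preserve the classes,
this is a homomorphism to an abelian group, so it vanishes on \<open>A'' \<subseteq> [B, B]\<close>; but \<open>f\<close>
moves every class to a different one.  There is \<open>g\<close> in \<open>B\<close> whose jump sum is negative for
exactly one class \<open>w\<close>.  The jump sum of \<open>[f, [f, g]]\<close> for the class that \<open>f\<close> moves to \<open>w\<close> is
\<open>d(w f) - 2 d(w) + d(w f\<inverse>) > 0\<close>, where \<open>d\<close> is the jump sum of \<open>g\<close>.  So \<open>a = [f, g] \<in> A'\<close> satisfies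
\<open>[f, a] \<notin> A''\<close>.\<close>

section \<open>Commutators, characteristic subgroups and normalizers\<close>

abbreviation commutator :: "('a, 'b) monoid_scheme \<Rightarrow> 'a \<Rightarrow> 'a \<Rightarrow> 'a" where
  "commutator G x y \<equiv> x \<otimes>\<^bsub>G\<^esub> y \<otimes>\<^bsub>G\<^esub> inv\<^bsub>G\<^esub> x \<otimes>\<^bsub>G\<^esub> inv\<^bsub>G\<^esub> y"

lemma (in group) commutator_eq:
  "x \<in> carrier G \<Longrightarrow> y \<in> carrier G \<Longrightarrow> commutator G x y = (x \<otimes> y) \<otimes> inv (y \<otimes> x)"
  by (simp add: inv_mult_group m_assoc)

text \<open>Since \<open>f'\<close> commutes with \<open>g\<close> and \<open>g'\<close> with \<open>f\<close>, the factors \<open>f'\<close> and \<open>g'\<close> can be collected on the right of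
both products \<open>(f f') (g g')\<close> and \<open>(g g') (f f')\<close>, where they cancel.  It will be applied with \<open>f f'\<close> and
\<open>g g'\<close> commutators, which turns \<open>[f, g]\<close> into a commutator of commutators.\<close>

lemma (in group) commutator_mult_commuting:
  assumes carr: "f \<in> carrier G" "g \<in> carrier G" "f' \<in> carrier G" "g' \<in> carrier G"
    and comm: "f' \<otimes> g = g \<otimes> f'" "f \<otimes> g' = g' \<otimes> f" "f' \<otimes> g' = g' \<otimes> f'"
  shows "commutator G (f \<otimes> f') (g \<otimes> g') = commutator G f g"
proof -
  define w where "w = f' \<otimes> g'"
  have w: "w \<in> carrier G"
    using carr by (simp add: w_def)
  have "(f \<otimes> f') \<otimes> (g \<otimes> g') = f \<otimes> (f' \<otimes> g) \<otimes> g'"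
    using carr by (simp add: m_assoc)
  then have 1: "(f \<otimes> f') \<otimes> (g \<otimes> g') = (f \<otimes> g) \<otimes> w"
    using carr by (simp add: comm(1) m_assoc w_def)
  have "(g \<otimes> g') \<otimes> (f \<otimes> f') = g \<otimes> (f \<otimes> g') \<otimes> f'"
    using carr by (simp add: comm(2) m_assoc)
  then have 2: "(g \<otimes> g') \<otimes> (f \<otimes> f') = (g \<otimes> f) \<otimes> w"
    using carr comm(3) by (simp add: m_assoc w_def)
  have "(f \<otimes> g) \<otimes> w \<otimes> inv ((g \<otimes> f) \<otimes> w) = (f \<otimes> g) \<otimes> (w \<otimes> inv w) \<otimes> inv (g \<otimes> f)"
    using carr w by (simp only: inv_mult_group m_assoc m_closed inv_closed)
  then have "(f \<otimes> g) \<otimes> w \<otimes> inv ((g \<otimes> f) \<otimes> w) = (f \<otimes> g) \<otimes> inv (g \<otimes> f)"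
    using carr w by simp
  then show ?thesis
    using carr commutator_eq[of "f \<otimes> f'" "g \<otimes> g'"] commutator_eq[of f g] by (simp only: 1 2 m_closed)
qed

lemma (in group_hom) commutator_kernel_iff:
  assumes "x \<in> carrier G" "y \<in> carrier G"
  shows "commutator G x y \<in> kernel G H h \<longleftrightarrow> h x \<otimes>\<^bsub>H\<^esub> h y = h y \<otimes>\<^bsub>H\<^esub> h x"
proof -
  have "h (commutator G x y) = (h x \<otimes>\<^bsub>H\<^esub> h y) \<otimes>\<^bsub>H\<^esub> inv\<^bsub>H\<^esub> (h y \<otimes>\<^bsub>H\<^esub> h x)"
    using assms by (simp add: G.commutator_eq)
  then show ?thesis
    using assms H.inv_solve_right'[of "\<one>\<^bsub>H\<^esub>" "h x \<otimes>\<^bsub>H\<^esub> h y" "h y \<otimes>\<^bsub>H\<^esub> h x"]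
    by (simp add: kernel_def)
qed

lemma (in normal) group_hom_quotient: "group_hom G (G Mod H) (\<lambda>x. H #> x)"
  using r_coset_hom_Mod factorgroup_is_group is_group
  by (simp add: group_hom_def group_hom_axioms_def)

lemma (in normal) kernel_quotient: "kernel G (G Mod H) (\<lambda>x. H #> x) = H"
  using coset_join1[OF _ _ subgroup_axioms] coset_join2[OF _ subgroup_axioms] subset
  by (auto simp: kernel_def FactGroup_def)

abbreviation second_derived :: "('a, 'b) monoid_scheme \<Rightarrow> 'a set" where
  "second_derived G \<equiv> derived G (derived G (carrier G))"

lemma (in group) commutator_in_derived:
  "H \<subseteq> carrier G \<Longrightarrow> x \<in> H \<Longrightarrow> y \<in> H \<Longrightarrow> commutator G x y \<in> derived G H"
  unfolding derived_def by (intro generate.incl) blast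

lemma (in group) commute_mult:
  assumes "x \<in> carrier G" "y \<in> carrier G" "z \<in> carrier G"
    and "x \<otimes> z = z \<otimes> x" "y \<otimes> z = z \<otimes> y"
  shows "(x \<otimes> y) \<otimes> z = z \<otimes> (x \<otimes> y)"
  using m_assoc[of x y z] m_assoc[of x z y] m_assoc[of z x y] assms by simp

lemma auto_image_derived:
  assumes "group G" "\<alpha> \<in> auto G" "H \<subseteq> carrier G"
  shows "\<alpha> ` derived G H = derived G (\<alpha> ` H)"
proof -
  interpret group_hom G G \<alpha>
    using assms by (simp add: group_hom_def group_hom_axioms_def auto_def)
  show ?thesis
    using derived_img[OF assms(3)] by simp
qed

lemma auto_image_carrier: "\<alpha> \<in> auto G \<Longrightarrow> \<alpha> ` carrier G = carrier G"
  by (simp add: auto_def Bij_def bij_betw_def)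

lemma characteristic_derived:
  assumes "group G"
  shows "characteristic (derived G (carrier G)) G"
  unfolding characteristic_def
  using group.derived_is_subgroup[OF assms] auto_image_derived[OF assms] auto_image_carrier
  by (metis order_refl)

text \<open>The kernel of the action of \<open>G\<close> by conjugation on the abelian group \<open>G'/G''\<close>.\<close>

definition derived_quotient_centralizer :: "('a, 'b) monoid_scheme \<Rightarrow> 'a set" where
  "derived_quotient_centralizer G = {x \<in> carrier G. \<forall>y\<in>derived G (carrier G).
     commutator G x y \<in> second_derived G}"

lemma auto_image_derived_quotient_centralizer:
  fixes G (structure)
  assumes G: "group G" and \<alpha>: "\<alpha> \<in> auto G"
  shows "\<alpha> ` derived_quotient_centralizer G = derived_quotient_centralizer G"
proof -
  interpret group_hom G G \<alpha>
    using assms by (simp add: group_hom_def group_hom_axioms_def auto_def)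
  have carr: "\<alpha> ` carrier G = carrier G" and inj: "inj_on \<alpha> (carrier G)"
    using \<alpha> by (simp_all add: auto_def Bij_def bij_betw_def)
  let ?D = "derived G (carrier G)" and ?D2 = "second_derived G"
  have D: "\<alpha> ` ?D = ?D" "?D \<subseteq> carrier G"
    using auto_image_derived[OF G \<alpha> order_refl] carr G.derived_in_carrier[OF order_refl] by simp_all
  then have D2: "\<alpha> ` ?D2 = ?D2" "?D2 \<subseteq> carrier G"
    using auto_image_derived[OF G \<alpha> D(2)] G.derived_in_carrier[OF D(2)] by simp_all
  have mem_iff: "\<alpha> x \<in> derived_quotient_centralizer G \<longleftrightarrow> x \<in> derived_quotient_centralizer G"
    if x: "x \<in> carrier G" for x
  proof -
    have "commutator G (\<alpha> x) (\<alpha> y) \<in> ?D2 \<longleftrightarrow> commutator G x y \<in> ?D2"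
      if y: "y \<in> ?D" for y
    proof -
      have y': "y \<in> carrier G"
        using y D(2) by blast
      have "commutator G (\<alpha> x) (\<alpha> y) = \<alpha> (commutator G x y)"
        using x y' by simp
      then show ?thesis
        using inj_on_image_mem_iff[OF inj _ D2(2), of "commutator G x y"] x y' D2(1) by simp
    qed
    then have "(\<forall>y\<in>\<alpha> ` ?D. commutator G (\<alpha> x) y \<in> ?D2)
        \<longleftrightarrow> (\<forall>y\<in>?D. commutator G x y \<in> ?D2)"
      by simp
    then show ?thesis
      using x D(1) by (simp add: derived_quotient_centralizer_def)
  qed
  have sub: "derived_quotient_centralizer G \<subseteq> carrier G"
    by (auto simp: derived_quotient_centralizer_def)
  show ?thesis
  proof (intro equalityI subsetI)
    fix x assume x: "x \<in> derived_quotient_centralizer G"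
    then obtain z where "z \<in> carrier G" "x = \<alpha> z"
      using sub carr by blast
    then show "x \<in> \<alpha> ` derived_quotient_centralizer G"
      using x mem_iff by blast
  qed (use mem_iff sub in blast)
qed

text \<open>Conjugation by an element of the normalizer of \<open>A\<close> restricts to an automorphism of \<open>A\<close>.\<close>

lemma normalizer_subset_if_characteristic:
  fixes G (structure)
  assumes G: "group G" and A: "subgroup A G" and B: "characteristic B (G\<lparr>carrier := A\<rparr>)"
  shows "normalizer G A \<subseteq> normalizer G B"
proof
  interpret group G
    using G .
  interpret A: subgroup A G
    using A .
  have "B \<subseteq> A"
    using B subgroup.subset by (fastforce simp: characteristic_def)
  then have B_carr: "B \<subseteq> carrier G"
    using A.subset by blast
  have conj: "r_coset G (l_coset G g S) (inv g) = (\<lambda>x. g \<otimes> x \<otimes> inv g) ` S" for g S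
    by (auto simp: l_coset_def r_coset_def)
  fix g assume "g \<in> normalizer G A"
  then have g: "g \<in> carrier G" "(\<lambda>x. g \<otimes> x \<otimes> inv g) ` A = A"
    using A.subset by (simp_all add: normalizer_def stabilizer_def conj)
  define \<alpha> where "\<alpha> = (\<lambda>x\<in>A. g \<otimes> x \<otimes> inv g)"
  have "\<alpha> \<in> auto (G\<lparr>carrier := A\<rparr>)"
  proof -
    have "\<alpha> (x \<otimes> y) = \<alpha> x \<otimes> \<alpha> y" if "x \<in> A" "y \<in> A" for x y
    proof -
      have "(g \<otimes> x \<otimes> inv g) \<otimes> (g \<otimes> y \<otimes> inv g) = g \<otimes> x \<otimes> (inv g \<otimes> g) \<otimes> y \<otimes> inv g"
        using g(1) that A.subset by (simp only: m_assoc m_closed inv_closed subsetD)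
      also have "\<dots> = g \<otimes> (x \<otimes> y) \<otimes> inv g"
        using g(1) that A.subset by (simp add: m_assoc subsetD)
      finally show ?thesis
        using that by (simp add: \<alpha>_def)
    qed
    moreover have "inj_on \<alpha> A"
    proof (rule inj_onI)
      fix x y assume xy: "x \<in> A" "y \<in> A" "\<alpha> x = \<alpha> y"
      then have "g \<otimes> x = g \<otimes> y"
        using g(1) A.subset by (simp add: \<alpha>_def subsetD)
      then show "x = y"
        using g(1) xy A.subset by (simp add: subsetD)
    qed
    moreover have "\<alpha> ` A = A"
      using g(2) by (simp add: \<alpha>_def)
    ultimately show ?thesis
      by (auto simp: auto_def hom_def Bij_def bij_betw_def \<alpha>_def)
  qed
  then have "\<alpha> ` B = B"
    using B by (simp add: characteristic_def)
  moreover have "\<alpha> ` B = (\<lambda>x. g \<otimes> x \<otimes> inv g) ` B"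
    using \<open>B \<subseteq> A\<close> by (intro image_cong) (auto simp: \<alpha>_def)
  ultimately show "g \<in> normalizer G B"
    using g(1) B_carr by (simp add: normalizer_def stabilizer_def conj)
qed

section \<open>The ring of n-adic numbers and its quotient modulo n - 1\<close>

lemma n_adic_eq_fractions:
  assumes "n \<ge> 2"
  shows "n_adic n = {of_int a / real n ^ k | a k. True}"
proof (intro equalityI subsetI)
  fix x assume "x \<in> n_adic n"
  then obtain a b :: int where x: "x = of_int a * real n powi b"
    by (auto simp: n_adic_def)
  show "x \<in> {of_int a / real n ^ k | a k. True}"
  proof (cases "b \<ge> 0")
    case True
    then have "x = of_int (a * int n ^ nat b) / real n ^ 0"
      using x by (simp add: power_int_def)
    then show ?thesis by blast
  next
    case False
    then have "x = of_int a / real n ^ nat (- b)"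
      using x by (simp add: power_int_def field_simps)
    then show ?thesis by blast
  qed
next
  fix x assume "x \<in> {of_int a / real n ^ k | a k. True}"
  then obtain a k where "x = of_int a / real n ^ k"
    by blast
  then have "x = of_int a * real n powi (- int k)"
    by (simp add: power_int_minus field_simps)
  then show "x \<in> n_adic n"
    by (auto simp: n_adic_def)
qed

lemma n_adic_fraction: "n \<ge> 2 \<Longrightarrow> of_int a / real n ^ k \<in> n_adic n"
  by (auto simp: n_adic_eq_fractions)

lemma n_adic_common_denominator:
  assumes "n \<ge> 2" "x \<in> n_adic n" "y \<in> n_adic n"
  obtains a b :: int and k where "x = of_int a / real n ^ k" "y = of_int b / real n ^ k"
proof -
  obtain a b :: int and k l where "x = of_int a / real n ^ k" "y = of_int b / real n ^ l"
    using assms by (auto simp: n_adic_eq_fractions)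
  then have "x = of_int (a * int n ^ l) / real n ^ (k + l)"
    "y = of_int (b * int n ^ k) / real n ^ (k + l)"
    using assms by (simp_all add: field_simps power_add)
  then show thesis
    using that by blast
qed

lemma n_adic_add:
  assumes "n \<ge> 2" "x \<in> n_adic n" "y \<in> n_adic n"
  shows "x + y \<in> n_adic n"
proof -
  obtain a b :: int and k where "x = of_int a / real n ^ k" "y = of_int b / real n ^ k"
    using n_adic_common_denominator[OF assms] .
  then have "x + y = of_int (a + b) / real n ^ k"
    by (simp add: add_divide_distrib)
  then show ?thesis
    using n_adic_fraction[OF assms(1)] by metis
qed

lemma n_adic_mult:
  assumes "n \<ge> 2" "x \<in> n_adic n" "y \<in> n_adic n"
  shows "x * y \<in> n_adic n"
proof -
  obtain a b :: int and k where "x = of_int a / real n ^ k" "y = of_int b / real n ^ k"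
    using n_adic_common_denominator[OF assms] .
  then have "x * y = of_int (a * b) / real n ^ (k + k)"
    by (simp add: power_add)
  then show ?thesis
    using n_adic_fraction[OF assms(1)] by metis
qed

lemma n_adic_of_int: "of_int a \<in> n_adic n"
proof -
  have "of_int a = of_int a * real n powi 0"
    by simp
  then show ?thesis
    unfolding n_adic_def by blast
qed

lemma n_adic_0: "0 \<in> n_adic n" and n_adic_1: "1 \<in> n_adic n"
  using n_adic_of_int[of 0 n] n_adic_of_int[of 1 n] by auto

lemma n_adic_minus: "n \<ge> 2 \<Longrightarrow> x \<in> n_adic n \<Longrightarrow> - x \<in> n_adic n"
  using n_adic_mult[of n "of_int (- 1)" x] n_adic_of_int[of "- 1" n] by simp

lemma n_adic_diff: "n \<ge> 2 \<Longrightarrow> x \<in> n_adic n \<Longrightarrow> y \<in> n_adic n \<Longrightarrow> x - y \<in> n_adic n"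
  using n_adic_add[of n x "- y"] n_adic_minus[of n y] by simp

lemma n_adic_power_int: "real n powi k \<in> n_adic n"
proof -
  have "real n powi k = of_int 1 * real n powi k"
    by simp
  then show ?thesis
    unfolding n_adic_def by blast
qed

lemma slope_group_n_adic: "s \<in> slope_group n \<Longrightarrow> s \<in> n_adic n"
  using n_adic_power_int by (auto simp: slope_group_def)

lemma slope_group_pos: "n \<ge> 2 \<Longrightarrow> s \<in> slope_group n \<Longrightarrow> s > 0"
  by (auto simp: slope_group_def)

lemma slope_group_1: "1 \<in> slope_group n"
  unfolding slope_group_def by (rule range_eqI[of _ _ 0]) simp

lemma slope_group_mult: "n \<ge> 2 \<Longrightarrow> s \<in> slope_group n \<Longrightarrow> t \<in> slope_group n \<Longrightarrow> s * t \<in> slope_group n"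
  unfolding slope_group_def by (auto simp flip: power_int_add)

lemma slope_group_inverse: "s \<in> slope_group n \<Longrightarrow> 1 / s \<in> slope_group n"
  unfolding slope_group_def by (auto simp: divide_inverse simp flip: power_int_minus)

lemma slope_group_power_int: "real n powi k \<in> slope_group n"
  by (auto simp: slope_group_def)

lemma slope_mult_n_adic_iff:
  assumes "n \<ge> 2" "s \<in> slope_group n"
  shows "s * x \<in> n_adic n \<longleftrightarrow> x \<in> n_adic n"
proof
  assume "s * x \<in> n_adic n"
  then have "(1 / s) * (s * x) \<in> n_adic n"
    using assms slope_group_inverse slope_group_n_adic n_adic_mult by blast
  then show "x \<in> n_adic n"
    using slope_group_pos[OF assms] by simp
qed (use assms slope_group_n_adic n_adic_mult in blast)

text \<open>Congruence modulo this ideal \<open>(n - 1)\<int>[1/n]\<close> of \<open>\<int>[1/n]\<close> replaces equality of values of \<open>\<phi>\<^sub>n\<close>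
(see \<open>phi_kernel_iff\<close>); it is stable under multiplication by slopes.\<close>

definition phi_kernel :: "nat \<Rightarrow> real set" where
  "phi_kernel n = (\<lambda>z. (real n - 1) * z) ` n_adic n"

lemma phi_kernel_n_adic:
  assumes "n \<ge> 2" "x \<in> phi_kernel n"
  shows "x \<in> n_adic n"
proof -
  have "of_int (int n - 1) * z \<in> n_adic n" if "z \<in> n_adic n" for z
    using that assms(1) n_adic_mult n_adic_of_int by blast
  then show ?thesis
    using assms(2) by (auto simp: phi_kernel_def)
qed

lemma phi_kernel_0: "0 \<in> phi_kernel n"
  using n_adic_0 by (force simp: phi_kernel_def)

lemma phi_kernel_add:
  assumes "n \<ge> 2" "x \<in> phi_kernel n" "y \<in> phi_kernel n"
  shows "x + y \<in> phi_kernel n"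
proof -
  obtain z w where "z \<in> n_adic n" "w \<in> n_adic n" "x = (real n - 1) * z" "y = (real n - 1) * w"
    using assms by (auto simp: phi_kernel_def)
  then show ?thesis
    using n_adic_add[OF assms(1)] unfolding phi_kernel_def
    by (intro image_eqI[of _ _ "z + w"]) (auto simp: distrib_left)
qed

lemma phi_kernel_mult:
  assumes "n \<ge> 2" "x \<in> phi_kernel n" "y \<in> n_adic n"
  shows "x * y \<in> phi_kernel n"
proof -
  obtain z where "z \<in> n_adic n" "x = (real n - 1) * z"
    using assms by (auto simp: phi_kernel_def)
  then show ?thesis
    using n_adic_mult[OF assms(1) _ assms(3)] unfolding phi_kernel_def
    by (intro image_eqI[of _ _ "z * y"]) auto
qed

lemma phi_kernel_minus: "n \<ge> 2 \<Longrightarrow> x \<in> phi_kernel n \<Longrightarrow> - x \<in> phi_kernel n"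
  using phi_kernel_mult[of n x "- 1"] n_adic_of_int[of "- 1" n] by simp

lemma phi_kernel_diff: "n \<ge> 2 \<Longrightarrow> x \<in> phi_kernel n \<Longrightarrow> y \<in> phi_kernel n \<Longrightarrow> x - y \<in> phi_kernel n"
  using phi_kernel_add[of n x "- y"] phi_kernel_minus[of n y] by simp

lemma phi_kernel_period: "real n - 1 \<in> phi_kernel n"
  using n_adic_1[of n] by (force simp: phi_kernel_def)

lemma phi_kernel_int_period: "n \<ge> 2 \<Longrightarrow> of_int k * (real n - 1) \<in> phi_kernel n"
  using phi_kernel_mult[OF _ phi_kernel_period, of n "of_int k"] n_adic_of_int[of k n]
  by (simp add: mult.commute)

text \<open>This is the arithmetic behind the displacement homomorphism: \<open>n \<equiv> 1\<close>, hence every power of \<open>n\<close>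
is \<open>1\<close> modulo \<open>n - 1\<close>.\<close>

lemma slope_minus_1_phi_kernel:
  assumes n: "n \<ge> 2" and s: "s \<in> slope_group n"
  shows "s - 1 \<in> phi_kernel n"
proof -
  have nat_power: "real n ^ j - 1 \<in> phi_kernel n" for j
  proof -
    have "real n ^ j - 1 = (real n - 1) * (\<Sum>i<j. real n ^ i)"
      by (rule power_diff_1_eq)
    also have "(\<Sum>i<j. real n ^ i) = of_int (\<Sum>i<j. int n ^ i)"
      by simp
    finally show ?thesis
      using n_adic_of_int unfolding phi_kernel_def by blast
  qed
  obtain k where k: "s = real n powi k"
    using s by (auto simp: slope_group_def)
  show ?thesis
  proof (cases "k \<ge> 0")
    case True
    then show ?thesis
      using nat_power k by (simp add: power_int_def)
  next
    case False
    then have "s - 1 = - ((real n ^ nat (- k) - 1) * s)"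
      using n k by (simp add: power_int_def field_simps)
    then show ?thesis
      using nat_power phi_kernel_mult phi_kernel_minus slope_group_n_adic n s by metis
  qed
qed

lemma slope_mult_phi_kernel_iff:
  assumes n: "n \<ge> 2" and s: "s \<in> slope_group n"
  shows "s * x \<in> phi_kernel n \<longleftrightarrow> x \<in> phi_kernel n"
proof
  assume "s * x \<in> phi_kernel n"
  then have "(s * x) * (1 / s) \<in> phi_kernel n"
    using assms slope_group_inverse slope_group_n_adic phi_kernel_mult by blast
  then show "x \<in> phi_kernel n"
    using slope_group_pos[OF assms] by simp
next
  assume "x \<in> phi_kernel n"
  then have "x * s \<in> phi_kernel n"
    using assms slope_group_n_adic phi_kernel_mult by blast
  then show "s * x \<in> phi_kernel n"
    by (simp add: mult.commute)
qed

lemma phi_kernel_iff: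
  assumes n: "n \<ge> 2" and x: "x \<in> n_adic n"
  shows "x \<in> phi_kernel n \<longleftrightarrow> phi n x = 0"
proof -
  obtain a b :: int where ab: "x = of_int a * real n powi b"
    using x by (auto simp: n_adic_def)
  show ?thesis
  proof
    assume "x \<in> phi_kernel n"
    then obtain c d :: int where "x = (real n - 1) * (of_int c * real n powi d)"
      by (auto simp: phi_kernel_def n_adic_def)
    then have "x = of_int (int (n - 1) * c) * real n powi d"
      using n by (simp add: of_nat_diff)
    then show "phi n x = 0"
      by (simp only: phi_eq[OF n]) simp
  next
    assume "phi n x = 0"
    then have "a mod int (n - 1) = 0"
      using ab phi_eq[OF n] by simp
    then obtain c where "a = int (n - 1) * c"
      by auto
    then have "x = (real n - 1) * (of_int c * real n powi b)"
      using n ab by (simp add: of_nat_diff)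
    then show "x \<in> phi_kernel n"
      by (auto simp: phi_kernel_def n_adic_def)
  qed
qed

lemma phi_diff:
  assumes n: "n \<ge> 2" and x: "x \<in> n_adic n" and y: "y \<in> n_adic n"
  shows "phi n (x - y) = (phi n x - phi n y) mod int (n - 1)"
proof -
  obtain a b :: int and k where ab: "x = of_int a / real n ^ k" "y = of_int b / real n ^ k"
    using n_adic_common_denominator[OF n x y] .
  have phi_fraction: "phi n (of_int c / real n ^ k) = c mod int (n - 1)" for c
    using phi_eq[OF n, of c "- int k"] by (simp add: power_int_minus divide_inverse)
  have "x - y = of_int (a - b) / real n ^ k"
    using ab by (simp add: diff_divide_distrib)
  then show ?thesis
    by (simp only: ab phi_fraction mod_diff_eq)
qed

lemma phi_range: "n \<ge> 2 \<Longrightarrow> x \<in> n_adic n \<Longrightarrow> phi n x mod int (n - 1) = phi n x"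
  using phi_diff[of n x 0] phi_kernel_iff[of n 0] phi_kernel_0 n_adic_0 by fastforce

lemma phi_cong:
  assumes n: "n \<ge> 2" and x: "x \<in> n_adic n" and y: "y \<in> n_adic n" and "x - y \<in> phi_kernel n"
  shows "phi n x = phi n y"
proof -
  have "(phi n x - phi n y) mod int (n - 1) = 0"
    using assms phi_diff phi_kernel_iff n_adic_diff by metis
  then have "phi n x mod int (n - 1) = phi n y mod int (n - 1)"
    by (simp add: mod_eq_dvd_iff mod_0_imp_dvd)
  then show ?thesis
    using phi_range n x y by simp
qed

text \<open>Every residue class is dense, since it contains arithmetic progressions of step \<open>(n - 1) / n\<^sup>k\<close> for
all \<open>k\<close>.  So break points can be chosen with a prescribed residue in any open interval.\<close>

lemma phi_kernel_coset_dense: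
  assumes n: "n \<ge> 2" and uv: "u < v"
  obtains x where "u < x" "x < v" "x - c \<in> phi_kernel n"
proof -
  define m where "m = real n - 1"
  have m: "m > 0"
    using n by (simp add: m_def)
  obtain k where k: "m / (v - u) < real n ^ k"
    using n real_arch_pow[of "real n" "m / (v - u)"] by auto
  define e where "e = m / real n ^ k"
  have e: "e > 0" "e < v - u"
    using k m uv n by (auto simp: e_def field_simps)
  define j where "j = \<lfloor>(u - c) / e\<rfloor> + 1"
  have j: "of_int j - 1 \<le> (u - c) / e" "(u - c) / e < of_int j"
    unfolding j_def by linarith+
  have "(real_of_int j - 1) * e \<le> u - c"
    using j(1) e(1) by (simp add: pos_le_divide_eq)
  then have 1: "of_int j * e \<le> u - c + e"
    by (simp add: algebra_simps)
  have 2: "u - c < of_int j * e"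
    using j(2) e(1) by (simp add: pos_divide_less_eq)
  show thesis
  proof (rule that)
    show "u < c + of_int j * e"
      using 2 by linarith
    show "c + of_int j * e < v"
      using 1 e by linarith
    have "of_int j * e = (real n - 1) * (of_int j / real n ^ k)"
      by (simp add: e_def m_def)
    then show "c + of_int j * e - c \<in> phi_kernel n"
      using n_adic_fraction[OF n, of j k] unfolding phi_kernel_def
      by (intro image_eqI[of _ _ "of_int j / real n ^ k"]) auto
  qed
qed

lemma n_adic_coset:
  assumes "n \<ge> 2" "x - c \<in> phi_kernel n"
  shows "x \<in> n_adic n \<longleftrightarrow> c \<in> n_adic n"
proof -
  have "x - c \<in> n_adic n"
    using assms phi_kernel_n_adic by blast
  then show ?thesis
    using n_adic_add[of n "x - c" c] n_adic_diff[of n x "x - c"] assms(1) by auto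
qed

lemma n_adic_dense:
  assumes "n \<ge> 2" "u < v"
  obtains x where "u < x" "x < v" "x \<in> n_adic n"
  using phi_kernel_coset_dense[OF assms, of 0] phi_kernel_n_adic[OF assms(1)] by auto

section \<open>One-sided slopes\<close>

text \<open>The slopes are stated as exact equations of germs instead of derivatives, so that slopes of compositions,
inverses and glued maps come from substitution.\<close>

definition right_slope :: "(real \<Rightarrow> real) \<Rightarrow> real \<Rightarrow> real \<Rightarrow> bool" where
  "right_slope F t b \<longleftrightarrow> (\<forall>\<^sub>F h in at_right 0. F (t + h) = F t + b * h)"

definition left_slope :: "(real \<Rightarrow> real) \<Rightarrow> real \<Rightarrow> real \<Rightarrow> bool" where
  "left_slope F t a \<longleftrightarrow> (\<forall>\<^sub>F h in at_right 0. F (t - h) = F t - a * h)"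

text \<open>Rotation by a half turn exchanges the two sides, which reduces facts on left slopes to facts on
right slopes.\<close>

lemma left_slope_eq_right_slope: "left_slope F t a \<longleftrightarrow> right_slope (\<lambda>s. - F (- s)) (- t) a"
proof -
  have "F (t - h) = F t - a * h \<longleftrightarrow> - F (- (- t + h)) = - F (- (- t)) + a * h" for h
    by auto
  then show ?thesis
    unfolding left_slope_def right_slope_def by presburger
qed

lemma right_slope_unique:
  assumes "right_slope F t b" "right_slope F t b'"
  shows "b = b'"
proof -
  have "\<forall>\<^sub>F h in at_right (0::real). h > 0"
    by (rule eventually_at_right_less)
  then have "\<forall>\<^sub>F h in at_right (0::real). b = b'"
    using assms unfolding right_slope_def by eventually_elim auto
  then show ?thesis
    by simp
qed

lemma left_slope_unique: "left_slope F t a \<Longrightarrow> left_slope F t a' \<Longrightarrow> a = a'"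
  using right_slope_unique by (auto simp: left_slope_eq_right_slope)

lemma filterlim_scale_at_right_0:
  assumes "b > 0"
  shows "filterlim (\<lambda>h. b * h) (at_right 0) (at_right (0::real))"
  unfolding filterlim_at using assms
  by (auto intro!: tendsto_eq_intros simp: eventually_at_right_field)

lemma right_slope_compose:
  assumes "right_slope F t b" "right_slope G (F t) c" "b > 0"
  shows "right_slope (G \<circ> F) t (c * b)"
proof -
  have "\<forall>\<^sub>F h in at_right 0. G (F t + b * h) = G (F t) + c * (b * h)"
    using assms(2) filterlim_scale_at_right_0[OF assms(3)]
    unfolding right_slope_def filterlim_iff by blast
  then show ?thesis
    using assms(1) unfolding right_slope_def by eventually_elim simp
qed

lemma left_slope_compose:
  assumes "left_slope F t a" "left_slope G (F t) c" "a > 0"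
  shows "left_slope (G \<circ> F) t (c * a)"
  using assms right_slope_compose[of "\<lambda>s. - F (- s)" "- t" a "\<lambda>s. - G (- s)" c]
  by (simp add: left_slope_eq_right_slope o_def)

lemma right_slope_inverse:
  assumes "right_slope F t b" "b > 0" "\<And>s. G (F s) = s"
  shows "right_slope G (F t) (1 / b)"
proof -
  have "\<forall>\<^sub>F h in at_right 0. F (t + 1 / b * h) = F t + b * (1 / b * h)"
    using assms(1) filterlim_scale_at_right_0[of "1 / b"] assms(2)
    unfolding right_slope_def filterlim_iff by fastforce
  then have "\<forall>\<^sub>F h in at_right 0. F t + h = F (t + 1 / b * h)"
    by eventually_elim (use assms(2) in simp)
  then show ?thesis
    unfolding right_slope_def by eventually_elim (simp add: assms(3))
qed

lemma left_slope_inverse: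
  assumes "left_slope F t a" "a > 0" "\<And>s. G (F s) = s"
  shows "left_slope G (F t) (1 / a)"
  using assms right_slope_inverse[of "\<lambda>s. - F (- s)" "- t" a "\<lambda>s. - G (- s)"]
  by (simp add: left_slope_eq_right_slope)

lemma right_slope_cong:
  assumes "right_slope F t b" "e > 0" "\<And>s. t \<le> s \<Longrightarrow> s < t + e \<Longrightarrow> G s = F s"
  shows "right_slope G t b"
proof -
  have "\<forall>\<^sub>F h in at_right 0. 0 < h \<and> h < e"
    using assms(2) by (auto simp: eventually_at_right_field)
  then show ?thesis
    using assms(1) unfolding right_slope_def
    by eventually_elim (simp add: assms(2,3))
qed

lemma left_slope_cong:
  assumes "left_slope F t b" "e > 0" "\<And>s. t - e < s \<Longrightarrow> s \<le> t \<Longrightarrow> G s = F s"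
  shows "left_slope G t b"
  using assms right_slope_cong[of "\<lambda>s. - F (- s)" "- t" b e "\<lambda>s. - G (- s)"]
  by (simp add: left_slope_eq_right_slope)

lemma right_slope_affine: "right_slope (\<lambda>t. s * t + c) t s"
  and left_slope_affine: "left_slope (\<lambda>t. s * t + c) t s"
  by (simp_all add: right_slope_def left_slope_def algebra_simps)

lemma right_slopeE:
  assumes "right_slope F t b"
  obtains e where "e > 0" "\<And>h. 0 \<le> h \<Longrightarrow> h < e \<Longrightarrow> F (t + h) = F t + b * h"
proof -
  obtain e where "e > 0" "\<And>h. 0 < h \<Longrightarrow> h < e \<Longrightarrow> F (t + h) = F t + b * h"
    using assms by (auto simp: right_slope_def eventually_at_right_field)
  then show thesis
    by (intro that[of e]) (auto simp: le_less)
qed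

lemma left_slopeE:
  assumes "left_slope F t a"
  obtains e where "e > 0" "\<And>h. 0 \<le> h \<Longrightarrow> h < e \<Longrightarrow> F (t - h) = F t - a * h"
proof -
  obtain e where "e > 0" "\<And>h. 0 < h \<Longrightarrow> h < e \<Longrightarrow> F (t - h) = F t - a * h"
    using assms by (auto simp: left_slope_def eventually_at_right_field)
  then show thesis
    by (intro that[of e]) (auto simp: le_less)
qed

section \<open>Piecewise linear maps of the line\<close>

text \<open>A local form of the conditions on lifts: near each point, a map is made of two affine pieces, which
may differ at \<open>n\<close>-adic points only.  Local finiteness of the breaks follows by compactness, and
the local form is visibly stable under composition, inversion and gluing at \<open>n\<close>-adic points.\<close>

definition pl_map :: "nat \<Rightarrow> (real \<Rightarrow> real) \<Rightarrow> bool" where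
  "pl_map n F \<longleftrightarrow> strict_mono F \<and> surj F \<and>
     (\<forall>t. \<exists>a\<in>slope_group n. \<exists>b\<in>slope_group n.
        left_slope F t a \<and> right_slope F t b \<and> (a = b \<or> t \<in> n_adic n)) \<and>
     (\<forall>t. F t \<in> n_adic n \<longleftrightarrow> t \<in> n_adic n)"

lemma pl_mapI:
  assumes "strict_mono F" "surj F" "\<And>t. F t \<in> n_adic n \<longleftrightarrow> t \<in> n_adic n"
    "\<And>t. \<exists>a\<in>slope_group n. \<exists>b\<in>slope_group n.
        left_slope F t a \<and> right_slope F t b \<and> (a = b \<or> t \<in> n_adic n)"
  shows "pl_map n F"
  using assms by (simp add: pl_map_def)

lemma pl_map_slopes:
  assumes "pl_map n F"
  obtains a b where "a \<in> slope_group n" "b \<in> slope_group n" "left_slope F t a" "right_slope F t b"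
    "a = b \<or> t \<in> n_adic n"
  using assms unfolding pl_map_def by meson

lemma pl_map_strict_mono: "pl_map n F \<Longrightarrow> strict_mono F"
  and pl_map_surj: "pl_map n F \<Longrightarrow> surj F"
  and pl_map_n_adic_iff: "pl_map n F \<Longrightarrow> F t \<in> n_adic n \<longleftrightarrow> t \<in> n_adic n"
  by (auto simp: pl_map_def)

lemma pl_map_less_iff: "pl_map n F \<Longrightarrow> F s < F t \<longleftrightarrow> s < t"
  and pl_map_le_iff: "pl_map n F \<Longrightarrow> F s \<le> F t \<longleftrightarrow> s \<le> t"
  and pl_map_eq_iff: "pl_map n F \<Longrightarrow> F s = F t \<longleftrightarrow> s = t"
  using pl_map_strict_mono strict_mono_less strict_mono_less_eq strict_mono_eq by blast+

lemma pl_map_bij: "pl_map n F \<Longrightarrow> bij F"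
  using pl_map_surj pl_map_eq_iff by (auto simp: bij_def inj_def)

abbreviation inverse_map :: "(real \<Rightarrow> real) \<Rightarrow> real \<Rightarrow> real" where
  "inverse_map F \<equiv> inv_into UNIV F"

lemma pl_map_inv_f [simp]: "pl_map n F \<Longrightarrow> inverse_map F (F t) = t"
  and pl_map_f_inv [simp]: "pl_map n F \<Longrightarrow> F (inverse_map F t) = t"
  using pl_map_bij by (simp_all add: bij_def surj_f_inv_f)

lemma pl_map_affine:
  assumes n: "n \<ge> 2" and "s \<in> slope_group n" "c \<in> n_adic n"
  shows "pl_map n (\<lambda>t. s * t + c)"
proof (rule pl_mapI)
  have s: "s > 0"
    using assms slope_group_pos by blast
  then show "strict_mono (\<lambda>t. s * t + c)"
    by (simp add: strict_mono_def)
  have "y = s * ((y - c) / s) + c" for y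
    using s by simp
  then show "surj (\<lambda>t. s * t + c)"
    by (rule surjI[OF sym])
  show "s * t + c \<in> n_adic n \<longleftrightarrow> t \<in> n_adic n" for t
    using assms n_adic_add[OF n, of "s * t" c] n_adic_diff[OF n, of "s * t + c" c]
      slope_mult_n_adic_iff[of n s t] by auto
  show "\<exists>a\<in>slope_group n. \<exists>b\<in>slope_group n.
      left_slope (\<lambda>t. s * t + c) t a \<and> right_slope (\<lambda>t. s * t + c) t b \<and> (a = b \<or> t \<in> n_adic n)"
    for t
    using right_slope_affine left_slope_affine assms by blast
qed

lemma pl_map_id: "n \<ge> 2 \<Longrightarrow> pl_map n (\<lambda>t. t)"
  using pl_map_affine[of n 1 0] slope_group_1 n_adic_0 by simp

lemma pl_map_translation: "n \<ge> 2 \<Longrightarrow> c \<in> n_adic n \<Longrightarrow> pl_map n (\<lambda>t. t + c)"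
  using pl_map_affine[of n 1 c] slope_group_1 by simp

lemma pl_map_compose:
  assumes n: "n \<ge> 2" and F: "pl_map n F" and G: "pl_map n G"
  shows "pl_map n (G \<circ> F)"
proof (rule pl_mapI)
  show "strict_mono (G \<circ> F)"
    using pl_map_strict_mono F G by (simp add: strict_mono_def)
  show "surj (G \<circ> F)"
    using comp_surj[OF pl_map_surj[OF F] pl_map_surj[OF G]] .
  show "(G \<circ> F) t \<in> n_adic n \<longleftrightarrow> t \<in> n_adic n" for t
    using pl_map_n_adic_iff F G by simp
  show "\<exists>a\<in>slope_group n. \<exists>b\<in>slope_group n.
      left_slope (G \<circ> F) t a \<and> right_slope (G \<circ> F) t b \<and> (a = b \<or> t \<in> n_adic n)" for t
  proof -
    obtain a b where ab: "a \<in> slope_group n" "b \<in> slope_group n" "left_slope F t a"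
      "right_slope F t b" "a = b \<or> t \<in> n_adic n"
      using pl_map_slopes[OF F] .
    obtain c d where cd: "c \<in> slope_group n" "d \<in> slope_group n" "left_slope G (F t) c"
      "right_slope G (F t) d" "c = d \<or> F t \<in> n_adic n"
      using pl_map_slopes[OF G] .
    have "left_slope (G \<circ> F) t (c * a)" "right_slope (G \<circ> F) t (d * b)"
      by (rule left_slope_compose[OF ab(3) cd(3) slope_group_pos[OF n ab(1)]],
          rule right_slope_compose[OF ab(4) cd(4) slope_group_pos[OF n ab(2)]])
    moreover have "c * a = d * b \<or> t \<in> n_adic n"
      using ab cd pl_map_n_adic_iff[OF F] by auto
    ultimately show ?thesis
      using ab cd n slope_group_mult by blast
  qed
qed

lemma pl_map_inv:
  assumes n: "n \<ge> 2" and F: "pl_map n F"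
  shows "pl_map n (inverse_map F)"
proof (rule pl_mapI)
  show "strict_mono (inverse_map F)"
    unfolding strict_mono_def using F pl_map_less_iff[OF F] by (metis pl_map_f_inv)
  show "surj (inverse_map F)"
    using pl_map_bij[OF F] by (simp add: bij_imp_bij_inv bij_is_surj)
  show "inverse_map F t \<in> n_adic n \<longleftrightarrow> t \<in> n_adic n" for t
    using pl_map_n_adic_iff[OF F, of "inverse_map F t"] F by simp
  show "\<exists>a\<in>slope_group n. \<exists>b\<in>slope_group n.
      left_slope (inverse_map F) t a \<and> right_slope (inverse_map F) t b \<and> (a = b \<or> t \<in> n_adic n)" for t
  proof -
    obtain a b where ab: "a \<in> slope_group n" "b \<in> slope_group n" "left_slope F (inverse_map F t) a"
      "right_slope F (inverse_map F t) b" "a = b \<or> inverse_map F t \<in> n_adic n"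
      using pl_map_slopes[OF F] .
    have "left_slope (inverse_map F) (F (inverse_map F t)) (1 / a)" "right_slope (inverse_map F) (F (inverse_map F t)) (1 / b)"
      using ab n F slope_group_pos
      by (intro left_slope_inverse right_slope_inverse; simp)+
    moreover have "1 / a = 1 / b \<or> t \<in> n_adic n"
      using ab pl_map_n_adic_iff[OF F, of "inverse_map F t"] F by auto
    ultimately show ?thesis
      using ab F slope_group_inverse by (metis pl_map_f_inv)
  qed
qed

section \<open>Gluing and interpolation\<close>

text \<open>The points of a subdivision cut the line into consecutive intervals that are indexed by the integers and
have no accumulation point.\<close>

definition subdivision :: "(int \<Rightarrow> real) \<Rightarrow> bool" where
  "subdivision a \<longleftrightarrow> strict_mono a \<and> (\<forall>t. \<exists>k. a k \<le> t \<and> t < a (k + 1))"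

lemma strict_mono_intI:
  fixes a :: "int \<Rightarrow> real"
  assumes "\<And>k. a k < a (k + 1)"
  shows "strict_mono a"
proof (rule strict_monoI)
  fix i j :: int assume "i < j"
  then show "a i < a j"
  proof (induction rule: int_gr_induct)
    case (step k)
    then show ?case using assms[of k] by linarith
  qed (use assms in simp)
qed

text \<open>If no interval contained \<open>t\<close>, then \<open>a k \<le> t\<close> would pass from \<open>k\<close> to \<open>k + 1\<close> forever.\<close>

lemma subdivisionI:
  assumes "\<And>k. a k < a (k + 1)" "\<And>t. \<exists>i. a i \<le> t" "\<And>t. \<exists>j. t < a j"
  shows "subdivision a"
  unfolding subdivision_def
proof (intro conjI allI)
  show mono: "strict_mono a"
    using assms(1) by (rule strict_mono_intI)
  fix t
  obtain i j where ij: "a i \<le> t" "t < a j"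
    using assms by blast
  show "\<exists>k. a k \<le> t \<and> t < a (k + 1)"
  proof (rule ccontr)
    assume "\<nexists>k. a k \<le> t \<and> t < a (k + 1)"
    then have step: "a k \<le> t \<Longrightarrow> a (k + 1) \<le> t" for k
      by (meson not_le)
    have "i < j"
      using ij mono strict_mono_less[of a i j] by linarith
    then have "i \<le> j" by simp
    then have "a j \<le> t"
      by (induction rule: int_ge_induct) (use ij step in auto)
    then show False
      using ij by simp
  qed
qed

lemma subdivision_progression:
  assumes "m > 0"
  shows "subdivision (\<lambda>k. a + of_int k * m)"
proof (rule subdivisionI)
  fix t
  have "a + of_int \<lfloor>(t - a) / m\<rfloor> * m \<le> t"
    using assms pos_le_divide_eq[of m "of_int \<lfloor>(t - a) / m\<rfloor>" "t - a"] by linarith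
  then show "\<exists>k. a + of_int k * m \<le> t" ..
  have "t < a + of_int (\<lfloor>(t - a) / m\<rfloor> + 1) * m"
    using assms pos_divide_less_eq[of m "t - a" "of_int (\<lfloor>(t - a) / m\<rfloor> + 1)"]
    by linarith
  then show "\<exists>k. t < a + of_int k * m" ..
qed (use assms in \<open>simp add: algebra_simps\<close>)

definition cell :: "(int \<Rightarrow> real) \<Rightarrow> real \<Rightarrow> int" where
  "cell a t = (THE k. a k \<le> t \<and> t < a (k + 1))"

lemma cell_eq:
  assumes "strict_mono a" "a k \<le> t" "t < a (k + 1)"
  shows "cell a t = k"
  unfolding cell_def
proof (rule the_equality)
  fix j assume j: "a j \<le> t \<and> t < a (j + 1)"
  then have "a j < a (k + 1)" "a k < a (j + 1)"
    using assms by linarith+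
  then show "j = k"
    using assms(1) by (simp add: strict_mono_less)
qed (use assms in simp)

lemma cell_bounds:
  assumes "subdivision a"
  shows "a (cell a t) \<le> t" "t < a (cell a t + 1)"
proof -
  obtain k where "a k \<le> t" "t < a (k + 1)"
    using assms by (auto simp: subdivision_def)
  then show "a (cell a t) \<le> t" "t < a (cell a t + 1)"
    using assms cell_eq[of a k t] by (auto simp: subdivision_def)
qed

definition glue :: "(int \<Rightarrow> real) \<Rightarrow> (int \<Rightarrow> real \<Rightarrow> real) \<Rightarrow> real \<Rightarrow> real" where
  "glue a F t = F (cell a t) t"

lemma glue_eq:
  assumes "strict_mono a" "a k \<le> t" "t < a (k + 1)"
  shows "glue a F t = F k t"
  using cell_eq[OF assms] by (simp add: glue_def)

text \<open>Right slopes come from the piece that starts or continues at a point, left slopes from the piece before.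
The assumption that the images of the end points form a subdivision makes the glued map surjective.\<close>

lemma pl_map_glue:
  assumes a: "subdivision a" "\<And>k. a k \<in> n_adic n"
    and F: "\<And>k. pl_map n (F k)" "\<And>k. F k (a (k + 1)) = F (k + 1) (a (k + 1))"
    and im: "subdivision (\<lambda>k. F k (a k))"
  shows "pl_map n (glue a F)"
proof (rule pl_mapI)
  have mono_a: "strict_mono a"
    using a by (simp add: subdivision_def)
  note glue = glue_eq[OF mono_a]
  note bounds = cell_bounds[OF a(1)]
  show "strict_mono (glue a F)"
  proof (rule strict_monoI)
    fix s t :: real assume st: "s < t"
    define j k where "j = cell a s" and "k = cell a t"
    have j: "a j \<le> s" "s < a (j + 1)" and k: "a k \<le> t" "t < a (k + 1)"
      using bounds by (auto simp: j_def k_def)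
    have "a j < a (k + 1)"
      using j k st by linarith
    then have "j < k + 1"
      using mono_a by (simp add: strict_mono_less)
    show "glue a F s < glue a F t"
    proof (cases "j = k")
      case True
      then show ?thesis
        using st pl_map_less_iff[OF F(1)] by (simp add: glue_def j_def k_def)
    next
      case False
      then have "j + 1 \<le> k"
        using \<open>j < k + 1\<close> by simp
      have "F j s < F j (a (j + 1))"
        using j F(1) pl_map_less_iff by blast
      also have "\<dots> \<le> F k (a k)"
        using \<open>j + 1 \<le> k\<close> im F(2)[of j] strict_mono_less_eq[of "\<lambda>k. F k (a k)" "j + 1" k]
        by (simp add: subdivision_def)
      also have "\<dots> \<le> F k t"
        using k F(1) pl_map_le_iff by blast
      finally show ?thesis
        by (simp add: glue_def j_def k_def)
    qed
  qed
  show "surj (glue a F)"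
  proof (rule surjI)
    fix y
    define k where "k = cell (\<lambda>k. F k (a k)) y"
    define t where "t = inverse_map (F k) y"
    have "F k (a k) \<le> F k t" "F k t < F k (a (k + 1))"
      using cell_bounds[OF im, of y] F(2)[of k] pl_map_f_inv[OF F(1)] by (simp_all add: k_def t_def)
    then have "glue a F t = F k t"
      using glue F(1) pl_map_less_iff pl_map_le_iff by metis
    then show "glue a F (inverse_map (F (cell (\<lambda>k. F k (a k)) y)) y) = y"
      using pl_map_f_inv[OF F(1)] by (simp add: t_def k_def)
  qed
  show "glue a F t \<in> n_adic n \<longleftrightarrow> t \<in> n_adic n" for t
    using F(1) pl_map_n_adic_iff by (simp add: glue_def)
  fix t
  define k where "k = cell a t"
  have k: "a k \<le> t" "t < a (k + 1)"
    using bounds by (auto simp: k_def)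
  obtain c d where cd: "c \<in> slope_group n" "d \<in> slope_group n" "left_slope (F k) t c"
      "right_slope (F k) t d" "c = d \<or> t \<in> n_adic n"
    using pl_map_slopes[OF F(1)] .
  have right: "right_slope (glue a F) t d"
    using cd(4) by (rule right_slope_cong[of _ _ _ "a (k + 1) - t"]) (use k glue in auto)
  show "\<exists>c\<in>slope_group n. \<exists>d\<in>slope_group n.
      left_slope (glue a F) t c \<and> right_slope (glue a F) t d \<and> (c = d \<or> t \<in> n_adic n)"
  proof (cases "a k = t")
    case False
    have "left_slope (glue a F) t c"
      using cd(3) by (rule left_slope_cong[of _ _ _ "t - a k"]) (use k False glue in auto)
    then show ?thesis
      using right cd by blast
  next
    case True
    obtain c' where c': "c' \<in> slope_group n" "left_slope (F (k - 1)) t c'"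
      using pl_map_slopes[OF F(1)] by metis
    have "a (k - 1) < a k"
      using mono_a by (simp add: strict_mono_less)
    have "left_slope (glue a F) t c'"
      using c'(2)
    proof (rule left_slope_cong[of _ _ _ "t - a (k - 1)"])
      fix s assume "t - (t - a (k - 1)) < s" "s \<le> t"
      then show "glue a F s = F (k - 1) s"
        using glue[of "k - 1" s F] glue[of k t F] k True F(2)[of "k - 1"] by (cases "s = t") auto
    qed (use True \<open>a (k - 1) < a k\<close> in auto)
    then show ?thesis
      using right cd c' a(2)[of k] True by blast
  qed
qed

lemma pl_map_glue2:
  assumes c: "c \<in> n_adic n" and F: "pl_map n F" and G: "pl_map n G" and eq: "F c = G c"
  shows "pl_map n (\<lambda>t. if t \<le> c then F t else G t)" (is "pl_map n ?H")
proof (rule pl_mapI)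
  show "strict_mono ?H"
  proof (rule strict_monoI)
    fix s t :: real assume "s < t"
    moreover have "F s \<le> F c" if "s \<le> c"
      using that F pl_map_le_iff by blast
    moreover have "G c < G t" if "c < t"
      using that G pl_map_less_iff by blast
    ultimately show "?H s < ?H t"
      using eq pl_map_less_iff[OF F, of s t] pl_map_less_iff[OF G, of s t] by force
  qed
  show "surj ?H"
  proof (rule surjI)
    fix y
    show "?H (if y \<le> F c then inverse_map F y else inverse_map G y) = y"
      using pl_map_le_iff[OF F, of "inverse_map F y" c] pl_map_le_iff[OF G, of "inverse_map G y" c] F G eq
      by auto
  qed
  show "?H t \<in> n_adic n \<longleftrightarrow> t \<in> n_adic n" for t
    using F G pl_map_n_adic_iff by simp
  fix t
  obtain a b where ab: "a \<in> slope_group n" "b \<in> slope_group n" "left_slope F t a"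
      "right_slope F t b" "a = b \<or> t \<in> n_adic n"
    using pl_map_slopes[OF F] .
  obtain a' b' where ab': "a' \<in> slope_group n" "b' \<in> slope_group n" "left_slope G t a'"
      "right_slope G t b'" "a' = b' \<or> t \<in> n_adic n"
    using pl_map_slopes[OF G] .
  have left: "left_slope ?H t a" if "t \<le> c"
    using ab(3) by (rule left_slope_cong[of _ _ _ 1]) (use that in auto)
  have right: "right_slope ?H t b'" if "c \<le> t"
    using ab'(4)
  proof (rule right_slope_cong[of _ _ _ 1])
    fix s assume "t \<le> s"
    then show "?H s = G s"
      using that eq by (cases "s = c") auto
  qed simp
  have left': "left_slope ?H t a'" if "c < t"
    using ab'(3) by (rule left_slope_cong[of _ _ _ "t - c"]) (use that in auto)
  have right': "right_slope ?H t b" if "t < c"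
    using ab(4) by (rule right_slope_cong[of _ _ _ "c - t"]) (use that in auto)
  show "\<exists>c\<in>slope_group n. \<exists>d\<in>slope_group n.
      left_slope ?H t c \<and> right_slope ?H t d \<and> (c = d \<or> t \<in> n_adic n)"
  proof (cases t c rule: linorder_cases)
    case less then show ?thesis using left[OF less_imp_le] right' ab by blast
  next
    case equal then show ?thesis using left[OF eq_refl] right[OF eq_refl[OF sym]] ab ab' c by blast
  next
    case greater then show ?thesis using left' right[OF less_imp_le] ab' by blast
  qed
qed

lemma ex_power_int_between:
  assumes n: "n \<ge> 2" and "0 < x"
  obtains k :: int where "real n powi k \<le> x" "x < real n powi (k + 1)"
proof -
  have n1: "1 < real n"
    using n by simp
  define k where "k = \<lfloor>log (real n) x\<rfloor>"
  have "real n powr of_int k \<le> x" "x < real n powr (of_int k + 1)"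
    using n1 assms(2) unfolding k_def
    by (simp_all add: le_log_iff[symmetric] log_less_iff[symmetric])
  moreover have "real n powr of_int k = real n powi k" "real n powr (of_int k + 1) = real n powi (k + 1)"
    using n1 powr_real_of_int'[of "real n" k] powr_real_of_int'[of "real n" "k + 1"] by auto
  ultimately show thesis
    using that by simp
qed

text \<open>If \<open>s\<close> is the largest power of \<open>n\<close> with \<open>s (b - a) \<le> d - c\<close>, then slope \<open>s\<close> alone makes the image too
short and slope \<open>s n\<close> makes it too long, so slope \<open>s n\<close> on an initial part and slope \<open>s\<close> on the
rest will do.  The excess that the first part has to make up for is a multiple of \<open>n - 1\<close> by
the congruence of the lengths, and this is what makes the break point \<open>n\<close>-adic.\<close>

lemma pl_map_between_intervals:
  assumes n: "n \<ge> 2" and ab: "a < b" and cd: "c < d"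
    and adic: "a \<in> n_adic n" "b \<in> n_adic n" "c \<in> n_adic n" "d \<in> n_adic n"
    and cong: "(d - c) - (b - a) \<in> phi_kernel n"
  obtains F where "pl_map n F" "F a = c" "F b = d"
proof -
  obtain k where "real n powi k \<le> (d - c) / (b - a)" "(d - c) / (b - a) < real n powi (k + 1)"
    using ex_power_int_between[OF n] ab cd by (metis diff_gt_0_iff_gt divide_pos_pos)
  moreover define s where "s = real n powi k"
  ultimately have s: "s * (b - a) \<le> d - c" "d - c < s * real n * (b - a)"
    using ab n by (simp_all add: power_int_add field_simps)
  have sg: "s \<in> slope_group n" "s * real n \<in> slope_group n"
    using slope_group_power_int[of n k] slope_group_power_int[of n "k + 1"] n
    by (simp_all add: s_def power_int_add)
  have "s > 0"
    using sg n slope_group_pos by blast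
  have "(s - 1) * (b - a) \<in> phi_kernel n"
    using n sg slope_minus_1_phi_kernel phi_kernel_mult n_adic_diff adic by blast
  then have "(d - c) - (b - a) - (s - 1) * (b - a) \<in> phi_kernel n"
    using n cong phi_kernel_diff by blast
  then obtain w where w: "w \<in> n_adic n" "d - c - s * (b - a) = (real n - 1) * w"
    by (auto simp: phi_kernel_def algebra_simps)
  \<comment> \<open>The larger slope is used on \<open>[a, p]\<close>; the length \<open>p - a\<close> makes up for the excess of
    \<open>d - c\<close> over \<open>s * (b - a)\<close>.\<close>
  define p where "p = a + 1 / s * w"
  have p: "p \<in> n_adic n"
    unfolding p_def using n w adic sg slope_group_inverse slope_group_n_adic n_adic_mult n_adic_add
    by meson
  have eq: "d - c - s * (b - a) = (real n - 1) * (s * (p - a))"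
    using w \<open>s > 0\<close> by (simp add: p_def)
  have "0 \<le> (real n - 1) * (s * (p - a))"
    using s eq by linarith
  then have "a \<le> p"
    using n \<open>s > 0\<close> by (simp add: zero_le_mult_iff)
  have "(real n - 1) * (s * (p - a)) < (real n - 1) * (s * (b - a))"
    using s eq by (simp add: algebra_simps)
  then have "p < b"
    using n \<open>s > 0\<close> by (simp add: mult_less_cancel_left)
  define F where "F t = (if t \<le> p then (s * real n) * t + (c - (s * real n) * a)
    else s * t + (d - s * b))" for t
  have "pl_map n F"
    unfolding F_def
  proof (rule pl_map_glue2[OF p])
    have "c - s * real n * a \<in> n_adic n" "d - s * b \<in> n_adic n"
      using n adic sg slope_group_n_adic n_adic_mult n_adic_diff by simp_all
    then show "pl_map n (\<lambda>t. (s * real n) * t + (c - (s * real n) * a))"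
      "pl_map n (\<lambda>t. s * t + (d - s * b))"
      using n sg pl_map_affine by blast+
    show "s * real n * p + (c - s * real n * a) = s * p + (d - s * b)"
      using eq by (simp add: algebra_simps)
  qed
  moreover have "F a = c" "F b = d"
    using \<open>a \<le> p\<close> \<open>p < b\<close> by (simp_all add: F_def)
  ultimately show thesis
    using that by blast
qed

section \<open>Groups of lifts and the displacement modulo n - 1\<close>

text \<open>On an affine piece of slope \<open>a\<close> the difference is \<open>(a - 1) (y - x)\<close>.  The local statement is
extended by compactness.  Intervals are enlarged by some \<open>e\<close>, because they have to be joined at an
\<open>n\<close>-adic point and their end points need not be \<open>n\<close>-adic.\<close>

lemma pl_map_displacement:
  assumes n: "n \<ge> 2" and F: "pl_map n F" and x: "x \<in> n_adic n" and y: "y \<in> n_adic n"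
  shows "(F y - F x) - (y - x) \<in> phi_kernel n"
proof -
  have step: "(a - 1) * h \<in> phi_kernel n" if "a \<in> slope_group n" "h \<in> n_adic n" for a h
    using that n slope_minus_1_phi_kernel phi_kernel_mult by blast
  define P where "P u v \<longleftrightarrow> (\<exists>e>0. \<forall>x\<in>{u - e<..<v + e} \<inter> n_adic n. \<forall>y\<in>{u - e<..<v + e} \<inter> n_adic n.
      (F y - F x) - (y - x) \<in> phi_kernel n)" for u v
  have "P u v" if "u \<le> v" for u v
    using that
  proof (induction rule: Bolzano)
    case (trans a b c)
    obtain e where e: "e > 0" "\<And>x y. x \<in> {a - e<..<b + e} \<inter> n_adic n \<Longrightarrow> y \<in> {a - e<..<b + e} \<inter> n_adic n
        \<Longrightarrow> (F y - F x) - (y - x) \<in> phi_kernel n"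
      using trans(1) unfolding P_def by blast
    obtain d where d: "d > 0" "\<And>x y. x \<in> {b - d<..<c + d} \<inter> n_adic n \<Longrightarrow> y \<in> {b - d<..<c + d} \<inter> n_adic n
        \<Longrightarrow> (F y - F x) - (y - x) \<in> phi_kernel n"
      using trans(2) unfolding P_def by blast
    define r where "r = min d e"
    have r: "r > 0" "r \<le> d" "r \<le> e"
      using e d by (auto simp: r_def)
    \<comment> \<open>An \<open>n\<close>-adic point of the overlap, through which all others are compared.\<close>
    obtain z where z: "b - r < z" "z < b + r" "z \<in> n_adic n"
      using n_adic_dense[OF n, of "b - r" "b + r"] r by auto
    have to_z: "(F z - F w) - (z - w) \<in> phi_kernel n"
      if "w \<in> {a - r<..<c + r} \<inter> n_adic n" for w
    proof (cases "w < b + r")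
      case True
      then show ?thesis
        using that z r trans by (intro e(2)) auto
    next
      case False
      then show ?thesis
        using that z r trans by (intro d(2)) auto
    qed
    have "(F y - F x) - (y - x) \<in> phi_kernel n"
      if "x \<in> {a - r<..<c + r} \<inter> n_adic n" "y \<in> {a - r<..<c + r} \<inter> n_adic n" for x y
      using phi_kernel_diff[OF n to_z[OF that(1)] to_z[OF that(2)]] by (simp add: algebra_simps)
    then show ?case
      unfolding P_def using r(1) by blast
  next
    case (local t)
    obtain a b where ab: "a \<in> slope_group n" "b \<in> slope_group n" "left_slope F t a"
        "right_slope F t b" "a = b \<or> t \<in> n_adic n"
      using pl_map_slopes[OF F] .
    obtain d where d: "d > 0" "\<And>h. 0 \<le> h \<Longrightarrow> h < d \<Longrightarrow> F (t - h) = F t - a * h"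
      using left_slopeE[OF ab(3)] by blast
    obtain e where e: "e > 0" "\<And>h. 0 \<le> h \<Longrightarrow> h < e \<Longrightarrow> F (t + h) = F t + b * h"
      using right_slopeE[OF ab(4)] by blast
    define r where "r = min d e"
    have r: "r > 0" "r \<le> d" "r \<le> e"
      using e d by (auto simp: r_def)
    have left: "F x = F t + a * (x - t)" if "t - r < x" "x \<le> t" for x
      using d(2)[of "t - x"] that r by (simp add: algebra_simps)
    have right: "F x = F t + b * (x - t)" if "t \<le> x" "x < t + r" for x
      using e(2)[of "x - t"] that r by simp
    have near: "(F y - F x) - (y - x) \<in> phi_kernel n"
      if "x \<in> {t - r<..<t + r} \<inter> n_adic n" "y \<in> {t - r<..<t + r} \<inter> n_adic n" for x y
    proof (cases "t \<in> n_adic n")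
      case True
      have to_t: "(F x - F t) - (x - t) \<in> phi_kernel n" if "x \<in> {t - r<..<t + r} \<inter> n_adic n" for x
      proof (cases "x \<le> t")
        case le: True
        have "(F x - F t) - (x - t) = (a - 1) * (x - t)"
          using left[of x] le that by (simp add: algebra_simps)
        then show ?thesis
          using step ab that True n_adic_diff[OF n] by simp
      next
        case False
        then have "(F x - F t) - (x - t) = (b - 1) * (x - t)"
          using right[of x] that by (simp add: algebra_simps)
        then show ?thesis
          using step ab that True n_adic_diff[OF n] by simp
      qed
      show ?thesis
        using phi_kernel_diff[OF n to_t[OF that(2)] to_t[OF that(1)]] by (simp add: algebra_simps)
    next
      case False
      then have "a = b"
        using ab(5) by simp
      then have affine: "F z = F t + a * (z - t)" if "z \<in> {t - r<..<t + r}" for z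
        using left[of z] right[of z] that by (metis greaterThanLessThan_iff linear)
      have "(F y - F x) - (y - x) = (a - 1) * (y - x)"
        using affine[of x] affine[of y] that by (simp add: algebra_simps)
      then show ?thesis
        using step[OF ab(1)] that n_adic_diff[OF n] by simp
    qed
    show ?case
    proof (intro exI[of _ "r / 2"] conjI allI impI)
      show "r / 2 > 0"
        using r by simp
      fix u v assume uv: "u \<le> t \<and> t \<le> v \<and> v - u < r / 2"
      show "P u v"
        unfolding P_def
      proof (intro exI[of _ "r / 2"] conjI ballI)
        fix x y
        assume "x \<in> {u - r / 2<..<v + r / 2} \<inter> n_adic n" "y \<in> {u - r / 2<..<v + r / 2} \<inter> n_adic n"
        then show "(F y - F x) - (y - x) \<in> phi_kernel n"
          by (intro near) (use uv in auto)
      qed (use r in simp)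
    qed
  qed
  then have "P (min x y) (max x y)"
    by simp
  then show ?thesis
    using x y unfolding P_def by force
qed

text \<open>Maps act on the right, as in \<open>Homeo\<close>.  With \<open>p = 0\<close> these are all the maps of the line, with \<open>p = n - 1\<close> the
lifts of maps of the circle.\<close>

definition pl_group :: "nat \<Rightarrow> real \<Rightarrow> (real \<Rightarrow> real) monoid" where
  "pl_group n p = \<lparr>carrier = {F. pl_map n F \<and> (\<forall>t. F (t + p) = F t + p)},
     mult = (\<lambda>F G. G \<circ> F), one = (\<lambda>t. t)\<rparr>"

lemma pl_group_simps [simp]:
  "F \<otimes>\<^bsub>pl_group n p\<^esub> G = G \<circ> F" "\<one>\<^bsub>pl_group n p\<^esub> = (\<lambda>t. t)"
  by (simp_all add: pl_group_def)

lemma pl_group_carrier: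
  "F \<in> carrier (pl_group n p) \<longleftrightarrow> pl_map n F \<and> (\<forall>t. F (t + p) = F t + p)"
  by (simp add: pl_group_def)

lemma pl_group_pl_map: "F \<in> carrier (pl_group n p) \<Longrightarrow> pl_map n F"
  and pl_group_shift: "F \<in> carrier (pl_group n p) \<Longrightarrow> F (t + p) = F t + p"
  by (simp_all add: pl_group_carrier)

lemma pl_group_shift_int:
  assumes "F \<in> carrier (pl_group n p)"
  shows "F (t + of_int k * p) = F t + of_int k * p"
proof (induction k rule: int_induct[of _ 0])
  case (step1 i)
  then show ?case
    using pl_group_shift[OF assms, of "t + of_int i * p"] by (simp add: algebra_simps)
next
  case (step2 i)
  then show ?case
    using pl_group_shift[OF assms, of "t + of_int (i - 1) * p"] by (simp add: algebra_simps)
qed simp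

lemma inverse_map_pl_group:
  assumes n: "n \<ge> 2" and F: "F \<in> carrier (pl_group n p)"
  shows "inverse_map F \<in> carrier (pl_group n p)"
proof -
  note pl = pl_group_pl_map[OF F]
  have "inverse_map F (t + p) = inverse_map F t + p" for t
    using pl_group_shift[OF F, of "inverse_map F t"] pl_map_f_inv[OF pl] pl_map_inv_f[OF pl]
    by metis
  then show ?thesis
    using pl_map_inv[OF n pl] by (simp add: pl_group_carrier)
qed

lemma group_pl_group:
  assumes n: "n \<ge> 2"
  shows "group (pl_group n p)"
proof (rule groupI)
  fix F assume F: "F \<in> carrier (pl_group n p)"
  have "F \<circ> inverse_map F = (\<lambda>t. t)"
    using pl_map_f_inv[OF pl_group_pl_map[OF F]] by auto
  then show "\<exists>G\<in>carrier (pl_group n p). G \<otimes>\<^bsub>pl_group n p\<^esub> F = \<one>\<^bsub>pl_group n p\<^esub>"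
    using inverse_map_pl_group[OF n F] by auto
qed (use pl_map_compose[OF n] pl_map_id[OF n] in \<open>auto simp: pl_group_carrier\<close>)

lemma inv_pl_group:
  assumes n: "n \<ge> 2" and F: "F \<in> carrier (pl_group n p)"
  shows "inv\<^bsub>pl_group n p\<^esub> F = inverse_map F"
proof (rule group.inv_equality[OF group_pl_group[OF n]])
  show "inverse_map F \<otimes>\<^bsub>pl_group n p\<^esub> F = \<one>\<^bsub>pl_group n p\<^esub>"
    using pl_map_f_inv[OF pl_group_pl_map[OF F]] by auto
qed (use inverse_map_pl_group[OF n F] F in auto)

text \<open>It suffices to look at the displacement of \<open>0\<close>, by \<open>pl_map_displacement\<close>.\<close>

definition rho_kernel :: "nat \<Rightarrow> real \<Rightarrow> (real \<Rightarrow> real) set" where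
  "rho_kernel n p = {F \<in> carrier (pl_group n p). F 0 \<in> phi_kernel n}"

lemma pl_map_preserves_coset:
  assumes n: "n \<ge> 2" and F: "pl_map n F" "F 0 \<in> phi_kernel n" and x: "x \<in> n_adic n"
  shows "F x - x \<in> phi_kernel n"
proof -
  have "(F x - F 0) - (x - 0) \<in> phi_kernel n"
    using pl_map_displacement[OF n F(1) n_adic_0 x] .
  then show ?thesis
    using phi_kernel_add[OF n F(2)] by fastforce
qed

lemma rho_kernel_iff:
  assumes n: "n \<ge> 2" and F: "F \<in> carrier (pl_group n p)" and x: "x \<in> n_adic n"
  shows "F \<in> rho_kernel n p \<longleftrightarrow> F x - x \<in> phi_kernel n"
proof -
  have "(F x - F 0) - (x - 0) \<in> phi_kernel n"
    using pl_map_displacement[OF n pl_group_pl_map[OF F] n_adic_0 x] .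
  then have "F x - x - ((F x - F 0) - (x - 0)) \<in> phi_kernel n" if "F x - x \<in> phi_kernel n"
    using that n phi_kernel_diff by blast
  then show ?thesis
    using pl_map_preserves_coset[OF n pl_group_pl_map[OF F] _ x] F
    by (auto simp: rho_kernel_def)
qed

lemma rho_kernel_carrier: "F \<in> rho_kernel n p \<Longrightarrow> F \<in> carrier (pl_group n p)"
  by (simp add: rho_kernel_def)

lemma displacement_compose:
  assumes n: "n \<ge> 2" and F: "F \<in> carrier (pl_group n p)" and G: "G \<in> carrier (pl_group n p)"
  shows "(G \<circ> F) 0 - (F 0 + G 0) \<in> phi_kernel n"
proof -
  have "F 0 \<in> n_adic n"
    using pl_map_n_adic_iff[OF pl_group_pl_map[OF F]] n_adic_0 by blast
  then show ?thesis
    using pl_map_displacement[OF n pl_group_pl_map[OF G] n_adic_0, of "F 0"]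
    by (simp add: algebra_simps)
qed

lemma subgroup_rho_kernel:
  assumes n: "n \<ge> 2"
  shows "subgroup (rho_kernel n p) (pl_group n p)"
proof -
  interpret group "pl_group n p"
    using group_pl_group[OF n] .
  show ?thesis
  proof (rule subgroupI)
    show "rho_kernel n p \<subseteq> carrier (pl_group n p)"
      by (auto simp: rho_kernel_def)
    show "rho_kernel n p \<noteq> {}"
      using one_closed phi_kernel_0 by (auto simp: rho_kernel_def)
    fix F assume F: "F \<in> rho_kernel n p"
    then have carr: "F \<in> carrier (pl_group n p)"
      by (rule rho_kernel_carrier)
    have "F (inverse_map F 0) - inverse_map F 0 \<in> phi_kernel n"
      using rho_kernel_iff[OF n carr, of "inverse_map F 0"] F
        pl_map_n_adic_iff[OF pl_map_inv[OF n pl_group_pl_map[OF carr]]] n_adic_0 by blast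
    then have "inverse_map F 0 \<in> phi_kernel n"
      using phi_kernel_minus[OF n] pl_map_f_inv[OF pl_group_pl_map[OF carr]] by fastforce
    then show "inv\<^bsub>pl_group n p\<^esub> F \<in> rho_kernel n p"
      using inv_pl_group[OF n carr] inverse_map_pl_group[OF n carr] by (simp add: rho_kernel_def)
    fix G assume G: "G \<in> rho_kernel n p"
    have "(G \<circ> F) 0 - (F 0 + G 0) + (F 0 + G 0) \<in> phi_kernel n"
      using displacement_compose[OF n, of F p G] F G
      by (intro phi_kernel_add[OF n]) (auto simp: rho_kernel_def)
    then show "F \<otimes>\<^bsub>pl_group n p\<^esub> G \<in> rho_kernel n p"
      using m_closed[of F G] F G by (simp add: rho_kernel_def)
  qed
qed

text \<open>Displacements add up under composition, up to \<open>phi_kernel\<close>, so \<open>F G\<close> and \<open>G F\<close> move \<open>0\<close> to congruent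
points, and \<open>[F, G] = (F G) (G F)\<inverse>\<close>.\<close>

lemma derived_subset_rho_kernel:
  assumes n: "n \<ge> 2"
  shows "derived (pl_group n p) (carrier (pl_group n p)) \<subseteq> rho_kernel n p"
proof -
  interpret group "pl_group n p"
    using group_pl_group[OF n] .
  have "commutator (pl_group n p) F G
      \<in> rho_kernel n p"
    if F: "F \<in> carrier (pl_group n p)" and G: "G \<in> carrier (pl_group n p)" for F G
  proof -
    let ?FG = "F \<otimes>\<^bsub>pl_group n p\<^esub> G" and ?GF = "G \<otimes>\<^bsub>pl_group n p\<^esub> F"
    define x where "x = inverse_map ?GF 0"
    have carr: "?FG \<in> carrier (pl_group n p)" "?GF \<in> carrier (pl_group n p)"
      using F G by blast+
    have "?FG \<otimes>\<^bsub>pl_group n p\<^esub> inv\<^bsub>pl_group n p\<^esub> ?GF \<in> rho_kernel n p"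
    proof -
      have "(G \<circ> F) 0 - (F 0 + G 0) - ((F \<circ> G) 0 - (G 0 + F 0)) \<in> phi_kernel n"
        using phi_kernel_diff[OF n displacement_compose[OF n F G] displacement_compose[OF n G F]] .
      then have 1: "?FG 0 - ?GF 0 \<in> phi_kernel n"
        by (simp add: algebra_simps)
      let ?I = "inverse_map ?GF"
      have I: "pl_map n ?I"
        using inverse_map_pl_group[OF n carr(2)] pl_group_pl_map by blast
      have "?FG 0 \<in> n_adic n" "?GF 0 \<in> n_adic n"
        using carr pl_group_pl_map pl_map_n_adic_iff n_adic_0 by blast+
      then have "?I (?FG 0) - ?I (?GF 0) - (?FG 0 - ?GF 0) \<in> phi_kernel n"
        using pl_map_displacement[OF n I] by blast
      then have "?I (?FG 0) - 0 - (?FG 0 - ?GF 0) + (?FG 0 - ?GF 0) \<in> phi_kernel n"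
        using 1 phi_kernel_add[OF n] pl_map_inv_f[OF pl_group_pl_map[OF carr(2)]] by metis
      then show ?thesis
        using m_closed[OF carr(1) inv_closed[OF carr(2)]] inv_pl_group[OF n carr(2)]
        by (simp add: rho_kernel_def)
    qed
    then show ?thesis
      using F G by (simp only: inv_mult_group m_assoc m_closed inv_closed)
  qed
  then have "derived_set (pl_group n p) (carrier (pl_group n p)) \<subseteq> rho_kernel n p"
    by blast
  then show ?thesis
    unfolding derived_def using generate_subgroup_incl subgroup_rho_kernel[OF n] by blast
qed

section \<open>The line: elements of trivial displacement are commutators\<close>

lemma pl_group_int_pow_add:
  assumes n: "n \<ge> 2" and F: "F \<in> carrier (pl_group n p)"
  shows "(F [^]\<^bsub>pl_group n p\<^esub> (i + j :: int)) t = (F [^]\<^bsub>pl_group n p\<^esub> j) ((F [^]\<^bsub>pl_group n p\<^esub> i) t)"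
  using group.int_pow_mult[OF group_pl_group[OF n] F, of i j] by simp

lemma pl_group_int_pow_Suc:
  assumes n: "n \<ge> 2" and F: "F \<in> carrier (pl_group n p)"
  shows "(F [^]\<^bsub>pl_group n p\<^esub> (k + 1 :: int)) t = F ((F [^]\<^bsub>pl_group n p\<^esub> k) t)"
  using pl_group_int_pow_add[OF n F, of k 1 t] group.int_pow_1[OF group_pl_group[OF n] F] by simp

text \<open>A bound for the orbit would give a supremum or infimum fixed by \<open>F\<close>.\<close>

lemma subdivision_orbit:
  assumes n: "n \<ge> 2" and F: "F \<in> carrier (pl_group n p)" and expand: "\<And>t. t < F t"
  shows "subdivision (\<lambda>k::int. (F [^]\<^bsub>pl_group n p\<^esub> k) t)" (is "subdivision ?a")
proof (rule subdivisionI)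
  note pl = pl_group_pl_map[OF F]
  note Suc = pl_group_int_pow_Suc[OF n F, of _ t]
  show "?a k < ?a (k + 1)" for k
    using Suc expand by simp
  show "\<exists>i. ?a i \<le> s" for s
  proof (rule ccontr)
    assume "\<nexists>i. ?a i \<le> s"
    then have lower: "s \<le> ?a i" for i
      by (meson linear)
    define l where "l = Inf (range ?a)"
    have bdd: "bdd_below (range ?a)"
      using lower by (auto intro!: bdd_belowI)
    have "l < F l"
      using expand .
    then obtain i where "?a i < F l"
      unfolding l_def using cInf_less_iff[OF _ bdd] by auto
    moreover have "F (?a (i - 1)) = ?a i"
      using Suc[of "i - 1"] by simp
    ultimately have "?a (i - 1) < l"
      using pl_map_less_iff[OF pl, of "?a (i - 1)" l] by simp
    moreover have "l \<le> ?a (i - 1)"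
      unfolding l_def using bdd by (intro cInf_lower) auto
    ultimately show False
      by simp
  qed
  show "\<exists>j. s < ?a j" for s
  proof (rule ccontr)
    assume "\<nexists>j. s < ?a j"
    then have upper: "?a i \<le> s" for i
      by (meson not_le)
    define u where "u = Sup (range ?a)"
    have bdd: "bdd_above (range ?a)"
      using upper by (auto intro!: bdd_aboveI)
    have "inverse_map F u < u"
      using expand[of "inverse_map F u"] pl_map_f_inv[OF pl] by simp
    then obtain i where "inverse_map F u < ?a i"
      unfolding u_def using less_cSup_iff[OF _ bdd] by auto
    then have "u < ?a (i + 1)"
      using pl_map_less_iff[OF pl, of "inverse_map F u" "?a i"] pl_map_f_inv[OF pl] Suc by simp
    moreover have "?a (i + 1) \<le> u"
      unfolding u_def using bdd by (intro cSup_upper) auto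
    ultimately show False
      by simp
  qed
qed

text \<open>The intervals \<open>[a k, a (k + 1)]\<close> between points of the orbit of \<open>0\<close> under \<open>u\<close> are fundamental domains for \<open>u\<close>, and
those of the orbit under \<open>v\<close> are fundamental domains for \<open>v\<close>.  The map \<open>c\<close> is a map \<open>c\<^sub>0\<close> of the domains with
\<open>k = 0\<close>, which exists since both lengths are \<open>0\<close> modulo \<open>n - 1\<close>, extended by
\<open>u\<^sup>-\<^sup>k c\<^sub>0 v\<^sup>k\<close> to the others.\<close>

lemma expanding_pl_maps_conjugate:
  assumes n: "n \<ge> 2"
    and u: "u \<in> rho_kernel n 0" "\<And>t. t < u t" and v: "v \<in> rho_kernel n 0" "\<And>t. t < v t"
  obtains c where "c \<in> carrier (pl_group n 0)" "v \<circ> c = c \<circ> u"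
proof -
  let ?G = "pl_group n 0"
  interpret group ?G
    using group_pl_group[OF n] .
  have u': "u \<in> carrier ?G" and v': "v \<in> carrier ?G"
    using u v rho_kernel_carrier by blast+
  define a where "a k = (u [^]\<^bsub>?G\<^esub> k) 0" for k :: int
  define b where "b k = (v [^]\<^bsub>?G\<^esub> k) 0" for k :: int
  have sub: "subdivision a" "subdivision b"
    unfolding a_def b_def using subdivision_orbit[OF n u' u(2)] subdivision_orbit[OF n v' v(2)] by blast+
  have pl: "pl_map n (u [^]\<^bsub>?G\<^esub> k)" "pl_map n (v [^]\<^bsub>?G\<^esub> k)" for k :: int
    using u' v' int_pow_closed pl_group_pl_map by blast+
  have adic: "a k \<in> n_adic n" for k
    using pl_map_n_adic_iff[OF pl(1)] n_adic_0 by (simp add: a_def)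
  have "(v 0 - 0) - (u 0 - 0) \<in> phi_kernel n" "v 0 \<in> n_adic n" "u 0 \<in> n_adic n"
    using u v phi_kernel_diff[OF n] phi_kernel_n_adic[OF n] by (auto simp: rho_kernel_def)
  then obtain c\<^sub>0 where c0: "pl_map n c\<^sub>0" "c\<^sub>0 0 = 0" "c\<^sub>0 (u 0) = v 0"
    using pl_map_between_intervals[OF n u(2)[of 0] v(2)[of 0] n_adic_0] n_adic_0 by metis
  define F where "F k t = (v [^]\<^bsub>?G\<^esub> k) (c\<^sub>0 ((u [^]\<^bsub>?G\<^esub> (- k)) t))" for k :: int and t
  have plF: "pl_map n (F k)" for k
  proof -
    have "F k = v [^]\<^bsub>?G\<^esub> k \<circ> (c\<^sub>0 \<circ> u [^]\<^bsub>?G\<^esub> (- k))"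
      by (auto simp: F_def)
    then show ?thesis
      using pl_map_compose[OF n] pl c0(1) by metis
  qed
  have pow0: "(u [^]\<^bsub>?G\<^esub> (0::int)) t = t" "(v [^]\<^bsub>?G\<^esub> (0::int)) t = t" for t
    by simp_all
  have shift: "(u [^]\<^bsub>?G\<^esub> (- k)) ((u [^]\<^bsub>?G\<^esub> (k + 1)) t) = u t" for k :: int and t
    using pl_group_int_pow_add[OF n u', of "k + 1" "- k"] pl_group_int_pow_Suc[OF n u', of 0] pow0
    by simp
  have shift0: "(u [^]\<^bsub>?G\<^esub> (- k)) ((u [^]\<^bsub>?G\<^esub> k) t) = t" for k :: int and t
    using pl_group_int_pow_add[OF n u', of k "- k"] pow0 by simp
  have vSuc: "(v [^]\<^bsub>?G\<^esub> k) (v t) = (v [^]\<^bsub>?G\<^esub> (k + 1)) t"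
    "v ((v [^]\<^bsub>?G\<^esub> k) t) = (v [^]\<^bsub>?G\<^esub> (k + 1)) t" for k :: int and t
    using pl_group_int_pow_add[OF n v', of 1 k] pl_group_int_pow_Suc[OF n v', of 0] 
      pl_group_int_pow_Suc[OF n v', of k] pow0 by (simp_all add: add.commute)
  have Fa: "F k (a k) = b k" "F k (a (k + 1)) = b (k + 1)" for k
    unfolding F_def a_def b_def shift shift0 using c0 vSuc(1) by simp_all
  have c: "pl_map n (glue a F)"
    using sub adic plF Fa by (intro pl_map_glue) auto
  have "glue a F (u t) = v (glue a F t)" for t
  proof -
    define k where "k = cell a t"
    have k: "a k \<le> t" "t < a (k + 1)"
      using cell_bounds[OF sub(1)] by (auto simp: k_def)
    have a_Suc: "a (i + 1) = u (a i)" for i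
      using pl_group_int_pow_Suc[OF n u'] by (simp add: a_def)
    have mono: "strict_mono a"
      using sub by (simp add: subdivision_def)
    have "a (k + 1) \<le> u t" "u t < a (k + 1 + 1)"
      unfolding a_Suc[of "k + 1"] using k a_Suc pl_map_le_iff[OF pl_group_pl_map[OF u']]
        pl_map_less_iff[OF pl_group_pl_map[OF u']] by simp_all
    then have "glue a F (u t) = F (k + 1) (u t)"
      by (rule glue_eq[OF mono])
    also have "(u [^]\<^bsub>?G\<^esub> (- (k + 1))) (u t) = (u [^]\<^bsub>?G\<^esub> (- k)) t"
      using pl_group_int_pow_add[OF n u', of 1 "- (k + 1)"] pl_group_int_pow_Suc[OF n u', of 0] pow0
      by simp
    then have "F (k + 1) (u t) = v (F k t)"
      by (simp add: F_def vSuc)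
    also have "F k t = glue a F t"
      using glue_eq[OF mono k] by simp
    finally show ?thesis .
  qed
  then have "v \<circ> glue a F = glue a F \<circ> u"
    by (simp add: fun_eq_iff)
  then show thesis
    using that c by (simp add: pl_group_carrier)
qed

text \<open>The map \<open>u\<close> takes the multiple \<open>x k\<close> of \<open>n - 1\<close> to a point \<open>y k\<close> that exceeds both \<open>x (k + 1)\<close> and
\<open>F (x (k + 1))\<close>; by monotonicity this bounds \<open>t\<close> and \<open>F t\<close> on the whole interval up to \<open>x (k + 1)\<close>.\<close>

lemma expanding_pl_map_above:
  assumes n: "n \<ge> 2" and F: "F \<in> rho_kernel n 0"
  obtains u where "u \<in> rho_kernel n 0" "\<And>t. t < u t" "\<And>t. F t < u t"
proof -
  note pl = pl_group_pl_map[OF rho_kernel_carrier[OF F]]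
  define m where "m = real n - 1"
  have m: "m \<ge> 1"
    using n by (simp add: m_def)
  define x where "x k = of_int k * m" for k :: int
  define y where "y k = max (F (x (k + 1))) (x (k + 1)) + m" for k :: int
  have x_mono: "x k < x (k + 1)" for k
    using m by (simp add: x_def algebra_simps)
  have x_kernel: "x k \<in> phi_kernel n" for k
    using phi_kernel_int_period[OF n] by (simp add: x_def m_def)
  then have "x k \<in> n_adic n" for k
    using phi_kernel_n_adic[OF n] by blast
  then have "F (x k) - x k \<in> phi_kernel n" for k
    using rho_kernel_iff[OF n rho_kernel_carrier[OF F]] F by blast
  then have "F (x k) \<in> phi_kernel n" for k
    using phi_kernel_add[OF n _ x_kernel, of "F (x k) - x k" k for k] by simp
  then have y_kernel: "y k \<in> phi_kernel n" for k
    using x_kernel phi_kernel_add[OF n] phi_kernel_period by (auto simp: y_def m_def max_def)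
  have sub_x: "subdivision x"
    using subdivision_progression[of m 0] m by (simp add: x_def[abs_def])
  have unbounded: "\<exists>k. x k \<le> t" "\<exists>k. t < x k" for t
    using sub_x by (auto simp: subdivision_def)
  have sub_y: "subdivision y"
  proof (rule subdivisionI)
    show "y k < y (k + 1)" for k
      using x_mono[of "k + 1"] pl_map_less_iff[OF pl, of "x (k + 1)" "x (k + 1 + 1)"]
      by (auto simp: y_def max_def)
    show "\<exists>k. t < y k" for t
    proof -
      obtain k where "t < x k"
        using unbounded by blast
      then have "t < y (k - 1)"
        using m by (simp add: y_def)
      then show ?thesis ..
    qed
    show "\<exists>k. y k \<le> t" for t
    proof -
      obtain k where "x k \<le> min (t - m) (inverse_map F (t - m))"
        using unbounded by blast
      then have "x k \<le> t - m" "F (x k) \<le> t - m"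
        using pl_map_le_iff[OF pl, of "x k" "inverse_map F (t - m)"] pl_map_f_inv[OF pl] by auto
      then have "y (k - 1) \<le> t"
        by (simp add: y_def)
      then show ?thesis ..
    qed
  qed
  have "\<exists>P. pl_map n P \<and> P (x k) = y k \<and> P (x (k + 1)) = y (k + 1)" for k
  proof -
    have "(y (k + 1) - y k) - (x (k + 1) - x k) \<in> phi_kernel n"
      using x_kernel y_kernel phi_kernel_diff[OF n] by blast
    moreover have "y k < y (k + 1)"
      using sub_y by (simp add: subdivision_def strict_mono_less)
    ultimately show ?thesis
      using pl_map_between_intervals[OF n x_mono] phi_kernel_n_adic[OF n] x_kernel y_kernel by metis
  qed
  then obtain P where P: "\<And>k. pl_map n (P k)" "\<And>k. P k (x k) = y k"
      "\<And>k. P k (x (k + 1)) = y (k + 1)"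
    by metis
  have u: "pl_map n (glue x P)"
    using sub_x sub_y P x_kernel phi_kernel_n_adic[OF n] by (intro pl_map_glue) auto
  have glue: "glue x P t = P k t" if "x k \<le> t" "t < x (k + 1)" for k t
    using glue_eq that sub_x by (simp add: subdivision_def)
  have "glue x P 0 = y 0"
    using glue[of 0 0] P(2)[of 0] m by (simp add: x_def)
  then have "glue x P \<in> rho_kernel n 0"
    using u y_kernel by (simp add: rho_kernel_def pl_group_carrier)
  moreover have "t < glue x P t" "F t < glue x P t" for t
  proof -
    define k where "k = cell x t"
    have k: "x k \<le> t" "t < x (k + 1)"
      using cell_bounds[OF sub_x] by (auto simp: k_def)
    have "y k \<le> glue x P t"
      using glue[OF k] P(2) pl_map_le_iff[OF P(1)] k by metis
    moreover have "F t < F (x (k + 1))"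
      using pl_map_less_iff[OF pl] k by blast
    ultimately show "t < glue x P t" "F t < glue x P t"
      using k m by (auto simp: y_def)
  qed
  ultimately show thesis
    using that by blast
qed

text \<open>With \<open>u\<close> above the identity and the inverse of \<open>f\<close>, both \<open>u\<close> and \<open>f u\<close> move points to the right, hence
\<open>f u = c\<inverse> u c\<close> for some \<open>c\<close>, and \<open>f = c\<inverse> u c u\<inverse>\<close>.\<close>

lemma rho_kernel_line_eq_derived:
  assumes n: "n \<ge> 2"
  shows "rho_kernel n 0 = derived (pl_group n 0) (carrier (pl_group n 0))"
proof
  let ?G = "pl_group n 0"
  interpret group ?G
    using group_pl_group[OF n] .
  interpret B: subgroup "rho_kernel n 0" ?G
    using subgroup_rho_kernel[OF n] .
  show "derived ?G (carrier ?G) \<subseteq> rho_kernel n 0"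
    using derived_subset_rho_kernel[OF n] .
  show "rho_kernel n 0 \<subseteq> derived ?G (carrier ?G)"
  proof
    fix f assume f: "f \<in> rho_kernel n 0"
    note carr = rho_kernel_carrier[OF f]
    have inv_f: "inv\<^bsub>?G\<^esub> f = inverse_map f"
      using inv_pl_group[OF n carr] .
    then have "inverse_map f \<in> rho_kernel n 0"
      using f B.m_inv_closed by metis
    then obtain u where u: "u \<in> rho_kernel n 0" "\<And>t. t < u t" "\<And>t. inverse_map f t < u t"
      using expanding_pl_map_above[OF n] by blast
    define v where "v = f \<otimes>\<^bsub>?G\<^esub> u"
    have "t < v t" for t
      using u(3)[of "f t"] pl_map_inv_f[OF pl_group_pl_map[OF carr]] by (simp add: v_def)
    moreover have "v \<in> rho_kernel n 0"
      unfolding v_def using f u by blast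
    ultimately obtain c where c: "c \<in> carrier ?G" "v \<circ> c = c \<circ> u"
      using expanding_pl_maps_conjugate[OF n u(1,2)] by blast
    have u': "u \<in> carrier ?G"
      using u rho_kernel_carrier by blast
    have "c \<otimes>\<^bsub>?G\<^esub> (f \<otimes>\<^bsub>?G\<^esub> u) = u \<otimes>\<^bsub>?G\<^esub> c"
      using c(2) by (simp add: v_def)
    then have "c \<otimes>\<^bsub>?G\<^esub> f \<otimes>\<^bsub>?G\<^esub> u = u \<otimes>\<^bsub>?G\<^esub> c"
      using m_assoc c u' carr by simp
    then have "c \<otimes>\<^bsub>?G\<^esub> f = u \<otimes>\<^bsub>?G\<^esub> c \<otimes>\<^bsub>?G\<^esub> inv\<^bsub>?G\<^esub> u"
      using c u' carr inv_solve_right m_closed by metis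
    then have "f = inv\<^bsub>?G\<^esub> c \<otimes>\<^bsub>?G\<^esub> (u \<otimes>\<^bsub>?G\<^esub> c \<otimes>\<^bsub>?G\<^esub> inv\<^bsub>?G\<^esub> u)"
      using c u' carr inv_solve_left m_closed inv_closed by metis
    then have "f = commutator ?G (inv\<^bsub>?G\<^esub> c) u"
      using c u' by (simp only: m_assoc m_closed inv_closed inv_inv)
    then show "f \<in> derived ?G (carrier ?G)"
      unfolding derived_def using c u' inv_closed by (intro generate.incl) blast
  qed
qed

section \<open>The circle: maps supported in an arc\<close>

abbreviation circle_lifts :: "nat \<Rightarrow> (real \<Rightarrow> real) monoid" where
  "circle_lifts n \<equiv> pl_group n (real n - 1)"

lemma n_adic_period: "n \<ge> 2 \<Longrightarrow> real n - 1 \<in> n_adic n"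
  using phi_kernel_period phi_kernel_n_adic by blast

lemma n_adic_add_period:
  assumes "n \<ge> 2"
  shows "a + (real n - 1) \<in> n_adic n \<longleftrightarrow> a \<in> n_adic n"
  using n_adic_coset[OF assms, of "a + (real n - 1)" a] phi_kernel_period by simp

text \<open>Copies of \<open>F\<close>, shifted by multiples of the period, are glued at the points \<open>a + k (n - 1)\<close>.\<close>

lemma periodic_extension:
  assumes n: "n \<ge> 2" and F: "pl_map n F" and a: "a \<in> n_adic n"
    and Fa: "F (a + (real n - 1)) = F a + (real n - 1)"
  obtains G where "G \<in> carrier (circle_lifts n)" "\<And>t. a \<le> t \<Longrightarrow> t \<le> a + (real n - 1) \<Longrightarrow> G t = F t"
proof -
  define m where "m = real n - 1"
  have m: "m > 0"
    using n by (simp add: m_def)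
  define x where "x k = a + of_int k * m" for k :: int
  define P where "P k t = F (t - of_int k * m) + of_int k * m" for k :: int and t
  have x_Suc: "x (k + 1) = x k + m" for k
    by (simp add: x_def algebra_simps)
  have sub: "subdivision x"
    unfolding x_def[abs_def] using subdivision_progression[OF m] .
  then have mono: "strict_mono x"
    by (simp add: subdivision_def)
  have km: "of_int k * m \<in> n_adic n" for k
    using phi_kernel_int_period[OF n] phi_kernel_n_adic[OF n] by (auto simp: m_def)
  have pl: "pl_map n (P k)" for k
  proof -
    have "P k = (\<lambda>t. t + of_int k * m) \<circ> (F \<circ> (\<lambda>t. t + - (of_int k * m)))"
      by (auto simp: P_def)
    then show ?thesis
      using F km n_adic_minus[OF n km] pl_map_translation[OF n] pl_map_compose[OF n] by metis
  qed
  have Px: "P k (x k) = F a + of_int k * m" "P k (x (k + 1)) = F a + of_int (k + 1) * m" for k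
    using Fa by (simp_all add: P_def x_def algebra_simps flip: m_def)
  have "pl_map n (glue x P)"
  proof (rule pl_map_glue[OF sub])
    show "x k \<in> n_adic n" for k
      using a km n_adic_add[OF n] by (simp add: x_def)
    show "subdivision (\<lambda>k. P k (x k))"
      unfolding Px using subdivision_progression[OF m] .
    show "P k (x (k + 1)) = P (k + 1) (x (k + 1))" for k
      by (simp only: Px)
  qed (rule pl)
  moreover have "glue x P (t + m) = glue x P t + m" for t
  proof -
    define k where "k = cell x t"
    have k: "x k \<le> t" "t < x (k + 1)"
      using cell_bounds[OF sub] by (auto simp: k_def)
    then have "glue x P (t + m) = P (k + 1) (t + m)"
      by (intro glue_eq[OF mono]) (simp_all only: x_Suc add_less_cancel_right add_le_cancel_right)
    also have "\<dots> = P k t + m"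
      by (simp add: P_def algebra_simps)
    finally show ?thesis
      using glue_eq[OF mono k] by simp
  qed
  ultimately have G: "glue x P \<in> carrier (circle_lifts n)"
    by (simp add: pl_group_carrier m_def)
  show thesis
  proof (rule that[OF G])
    fix t assume t: "a \<le> t" "t \<le> a + (real n - 1)"
    show "glue x P t = F t"
    proof (cases "t = a + m")
      case True
      have "glue x P t = P 1 (x 1)"
        using True m by (subst glue_eq[OF mono, of 1]) (simp_all add: x_def)
      also have "\<dots> = F t"
        using True Fa by (simp add: P_def x_def m_def)
      finally show ?thesis .
    next
      case False
      then have "glue x P t = P 0 t"
        using t by (intro glue_eq[OF mono]) (simp_all add: x_def m_def)
      then show ?thesis
        by (simp add: P_def)
    qed
  qed
qed

text \<open>The maps of the circle with support in the image of \<open>[a, b]\<close>, each represented by its lift with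
fixed points.\<close>

definition arc_group :: "nat \<Rightarrow> real \<Rightarrow> real \<Rightarrow> (real \<Rightarrow> real) set" where
  "arc_group n a b = {F \<in> carrier (circle_lifts n). \<forall>t\<in>{b..a + (real n - 1)}. F t = t}"

lemma arc_group_carrier: "F \<in> arc_group n a b \<Longrightarrow> F \<in> carrier (circle_lifts n)"
  by (simp add: arc_group_def)

lemma arc_group_fixes:
  assumes "F \<in> arc_group n a b" "b \<le> t + of_int k * (real n - 1)" "t + of_int k * (real n - 1) \<le> a + (real n - 1)"
  shows "F t = t"
  using assms pl_group_shift_int[of F n "real n - 1" t k] by (simp add: arc_group_def)

lemma arc_group_mono:
  assumes "F \<in> arc_group n a b" "c \<le> a" "b \<le> d"
  shows "F \<in> arc_group n c d"
  using assms by (auto simp: arc_group_def)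

lemma arc_group_shift:
  assumes "F \<in> arc_group n a b"
  shows "F \<in> arc_group n (a + of_int k * (real n - 1)) (b + of_int k * (real n - 1))"
  using assms arc_group_fixes[OF assms, of _ "- k"] by (auto simp: arc_group_def)

lemma inverse_map_arc_group:
  assumes "n \<ge> 2" "F \<in> arc_group n a b"
  shows "inverse_map F \<in> arc_group n a b"
proof -
  have "inverse_map F t = t" if "F t = t" for t
    using pl_map_inv_f[OF pl_group_pl_map[OF arc_group_carrier[OF assms(2)]], of t] that by simp
  then show ?thesis
    using assms(2) inverse_map_pl_group[OF assms(1) arc_group_carrier[OF assms(2)]]
    by (simp add: arc_group_def)
qed

lemma conjugate_arc_group:
  assumes n: "n \<ge> 2" and F: "F \<in> arc_group n a b" and H: "H \<in> carrier (circle_lifts n)"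
  shows "inv\<^bsub>circle_lifts n\<^esub> H \<otimes>\<^bsub>circle_lifts n\<^esub> F \<otimes>\<^bsub>circle_lifts n\<^esub> H \<in> arc_group n (H a) (H b)"
proof -
  interpret group "circle_lifts n"
    using group_pl_group[OF n] .
  note pl = pl_group_pl_map[OF H]
  have "F (inverse_map H t) = inverse_map H t" if "H b \<le> t" "t \<le> H a + (real n - 1)" for t
  proof -
    have "H (inverse_map H t) \<le> H (a + (real n - 1))" "H b \<le> H (inverse_map H t)"
      using that pl_group_shift[OF H] pl_map_f_inv[OF pl] by auto
    then show ?thesis
      using F pl_map_le_iff[OF pl] by (auto simp: arc_group_def)
  qed
  then show ?thesis
    using m_closed[OF m_closed[OF inv_closed[OF H] arc_group_carrier[OF F]] H]
      inv_pl_group[OF n H] pl_map_f_inv[OF pl] by (simp add: arc_group_def)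
qed

lemma pl_group_eqI:
  assumes F: "F \<in> carrier (pl_group n p)" and G: "G \<in> carrier (pl_group n p)" and p: "p > 0"
    and eq: "\<And>t. a \<le> t \<Longrightarrow> t \<le> a + p \<Longrightarrow> F t = G t"
  shows "F = G"
proof
  fix t
  define k where "k = \<lfloor>(t - a) / p\<rfloor>"
  have "of_int k * p \<le> t - a" "t - a < (of_int k + 1) * p"
    using p unfolding k_def by (simp_all add: pos_le_divide_eq[symmetric] pos_divide_less_eq[symmetric])
  then have "a \<le> t + of_int (- k) * p" "t + of_int (- k) * p \<le> a + p"
    by (simp_all add: algebra_simps)
  then have "F (t + of_int (- k) * p) = G (t + of_int (- k) * p)"
    by (rule eq)
  then show "F t = G t"
    by (simp only: pl_group_shift_int[OF F] pl_group_shift_int[OF G] add_right_cancel)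
qed

text \<open>Each of the two maps is the identity where the other one moves points, and it
suffices to compare the products on one period.\<close>

lemma disjoint_arc_groups_commute:
  assumes n: "n \<ge> 2" and F: "F \<in> arc_group n a b" and G: "G \<in> arc_group n c d"
    and "a \<le> b" "b \<le> c" "c \<le> d" "d \<le> a + (real n - 1)"
  shows "F \<otimes>\<^bsub>circle_lifts n\<^esub> G = G \<otimes>\<^bsub>circle_lifts n\<^esub> F"
proof (rule pl_group_eqI)
  interpret group "circle_lifts n"
    using group_pl_group[OF n] .
  show "F \<otimes>\<^bsub>circle_lifts n\<^esub> G \<in> carrier (circle_lifts n)" "G \<otimes>\<^bsub>circle_lifts n\<^esub> F \<in> carrier (circle_lifts n)"
    using F G arc_group_carrier by blast+
  show "real n - 1 > 0"
    using n by simp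
  fix t assume t: "a \<le> t" "t \<le> a + (real n - 1)"
  have F_fix: "F t = t" if "t \<le> a + (real n - 1)" "b \<le> t" for t
    using arc_group_fixes[OF F, of t 0] that by simp
  have G_fix: "G t = t" if "d - (real n - 1) \<le> t" "t \<le> c" for t
    using arc_group_fixes[OF G, of t 1] that by simp
  have G_fix': "G t = t" if "d \<le> t" "t \<le> c + (real n - 1)" for t
    using arc_group_fixes[OF G, of t 0] that by simp
  have Fa: "F a = a"
    using arc_group_fixes[OF F, of a 1] assms by simp
  have leF: "F s \<le> F t \<longleftrightarrow> s \<le> t" and leG: "G s \<le> G t \<longleftrightarrow> s \<le> t" for s t
    using F G arc_group_carrier pl_group_pl_map pl_map_le_iff by blast+
  show "(F \<otimes>\<^bsub>circle_lifts n\<^esub> G) t = (G \<otimes>\<^bsub>circle_lifts n\<^esub> F) t"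
  proof (cases "t \<le> b")
    case True
    then have "a \<le> F t" "F t \<le> b"
      using leF[of a t] leF[of t b] Fa t F_fix[of b] assms by simp_all
    then show ?thesis
      using G_fix assms t True by simp
  next
    case b: False
    show ?thesis
    proof (cases "t \<le> c")
      case True
      then show ?thesis
        using b F_fix G_fix t assms by simp
    next
      case c: False
      show ?thesis
      proof (cases "t \<le> d")
        case True
        then have "c \<le> G t" "G t \<le> d"
          using leG[of c t] leG[of t d] G_fix[of c] G_fix'[of d] assms c by simp_all
        then show ?thesis
          using F_fix b t assms by simp
      next
        case False
        then show ?thesis
          using F_fix[of t] G_fix'[of t] b t assms by simp
      qed
    qed
  qed
qed

text \<open>Points of \<open>(s, t)\<close> congruent to \<open>a\<close> and \<open>b\<close> are possible images of \<open>a\<close> and \<open>b\<close>; then the interval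
\<open>[a, b]\<close> and its complement in a period are mapped onto intervals of congruent lengths.\<close>

lemma move_arc:
  assumes n: "n \<ge> 2" and ab: "a < b" "b < a + (real n - 1)" "a \<in> n_adic n" "b \<in> n_adic n"
    and st: "s < t" "t \<le> s + (real n - 1)"
  obtains H where "H \<in> carrier (circle_lifts n)" "s < H a" "H b < t"
proof -
  define m where "m = real n - 1"
  obtain a' where a': "s < a'" "a' < t" "a' - a \<in> phi_kernel n"
    using phi_kernel_coset_dense[OF n st(1)] .
  obtain b' where b': "a' < b'" "b' < t" "b' - b \<in> phi_kernel n"
    using phi_kernel_coset_dense[OF n a'(2)] .
  have adic: "a' \<in> n_adic n" "b' \<in> n_adic n" "a + m \<in> n_adic n" "a' + m \<in> n_adic n"
    using a' b' n_adic_coset[OF n] ab n_adic_add_period[OF n] by (auto simp: m_def)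
  have cong: "(b' - b) - (a' - a) \<in> phi_kernel n" "(a' - a) - (b' - b) \<in> phi_kernel n"
    using phi_kernel_diff[OF n] a' b' by blast+
  obtain F where F: "pl_map n F" "F a = a'" "F b = b'"
    using pl_map_between_intervals[OF n ab(1) b'(1) ab(3,4) adic(1,2)] cong
    by (auto simp: algebra_simps)
  obtain G where G: "pl_map n G" "G b = b'" "G (a + m) = a' + m"
    using pl_map_between_intervals[OF n, of b "a + m" b' "a' + m"] ab b' a' st adic cong
    by (auto simp: algebra_simps m_def)
  let ?H = "\<lambda>t. if t \<le> b then F t else G t"
  have "pl_map n ?H"
    using pl_map_glue2[OF ab(4) F(1) G(1)] F G by simp
  moreover have "?H (a + m) = ?H a + m"
    using F G ab by (simp add: m_def)
  ultimately obtain H where H: "H \<in> carrier (circle_lifts n)"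
      "\<And>t. a \<le> t \<Longrightarrow> t \<le> a + m \<Longrightarrow> H t = ?H t"
    unfolding m_def by (rule periodic_extension[OF n _ ab(3), of ?H]) blast
  have "H a = a'" "H b = b'"
    using H(2)[of a] H(2)[of b] F ab by (simp_all add: m_def)
  then show thesis
    using that H(1) a' b' by simp
qed

text \<open>The version of \<open>move_arc\<close> with support in a larger arc \<open>[c, d]\<close>.\<close>

lemma move_arc_inside:
  assumes n: "n \<ge> 2" and order: "c < a" "a < b" "b < d" "d < c + (real n - 1)"
    and adic: "a \<in> n_adic n" "b \<in> n_adic n" "c \<in> n_adic n" "d \<in> n_adic n"
    and st: "c \<le> s" "s < t" "t \<le> d"
  obtains H where "H \<in> arc_group n c d" "s < H a" "H b < t"
proof -
  define m where "m = real n - 1"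
  obtain a' where a': "s < a'" "a' < t" "a' - a \<in> phi_kernel n"
    using phi_kernel_coset_dense[OF n st(2)] .
  obtain b' where b': "a' < b'" "b' < t" "b' - b \<in> phi_kernel n"
    using phi_kernel_coset_dense[OF n a'(2)] .
  have adic': "a' \<in> n_adic n" "b' \<in> n_adic n"
    using a' b' n_adic_coset[OF n] adic by auto
  have cong: "(b' - b) - (a' - a) \<in> phi_kernel n" "- (b' - b) \<in> phi_kernel n"
    using phi_kernel_diff[OF n] phi_kernel_minus[OF n] a' b' by blast+
  obtain P where P: "pl_map n P" "P c = c" "P a = a'"
    using pl_map_between_intervals[OF n, of c a c a'] order st a' adic adic'
    by (auto simp: algebra_simps)
  obtain Q where Q: "pl_map n Q" "Q a = a'" "Q b = b'"
    using pl_map_between_intervals[OF n order(2) b'(1) adic(1,2) adic'] cong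
    by (auto simp: algebra_simps)
  obtain R where R: "pl_map n R" "R b = b'" "R d = d"
    using pl_map_between_intervals[OF n, of b d b' d] order st b' adic adic' cong
    by (auto simp: algebra_simps)
  let ?H = "\<lambda>t. if t \<le> a then P t else if t \<le> b then Q t else if t \<le> d then R t else t"
  have 1: "pl_map n (\<lambda>t. if t \<le> d then R t else t)"
    using pl_map_glue2[OF adic(4) R(1) pl_map_id[OF n]] R by simp
  have 2: "pl_map n (\<lambda>t. if t \<le> b then Q t else if t \<le> d then R t else t)"
    using pl_map_glue2[OF adic(2) Q(1) 1] order Q R by simp
  have "pl_map n ?H"
    using pl_map_glue2[OF adic(1) P(1) 2] order P Q by simp
  moreover have "?H (c + m) = ?H c + m"
    using P order by (simp add: m_def)
  ultimately obtain H where H: "H \<in> carrier (circle_lifts n)"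
      "\<And>t. c \<le> t \<Longrightarrow> t \<le> c + m \<Longrightarrow> H t = ?H t"
    unfolding m_def by (rule periodic_extension[OF n _ adic(3), of ?H]) blast
  have "H t = t" if "d \<le> t" "t \<le> c + m" for t
    using H(2)[of t] that order R by (cases "t = d") (auto simp: m_def)
  then have "H \<in> arc_group n c d"
    using H(1) by (simp add: arc_group_def m_def)
  moreover have "H a = a'" "H b = b'"
    using H(2)[of a] H(2)[of b] P Q order by (simp_all add: m_def)
  ultimately show thesis
    using that a' b' by simp
qed

text \<open>After a translation, \<open>f\<close> takes \<open>0\<close> to a point of \<open>[0, n - 1)\<close>.  As \<open>f 0 \<equiv> 0\<close>, there is a map
\<open>g\<close> that agrees with \<open>f\<close> on a short interval \<open>[0, y]\<close> and is the identity outside an arc.  Then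
\<open>f g\<inverse>\<close> is the identity on \<open>[0, y]\<close>, so that it has support in an arc, too.\<close>

lemma rho_kernel_fragmentation:
  assumes n: "n \<ge> 2" and f: "f \<in> rho_kernel n (real n - 1)"
  obtains k a b c d g h where "g \<in> arc_group n a b" "h \<in> arc_group n c d"
    "a < b" "b < a + (real n - 1)" "c < d" "d < c + (real n - 1)"
    "a \<in> n_adic n" "b \<in> n_adic n" "c \<in> n_adic n" "d \<in> n_adic n"
    "f = h \<otimes>\<^bsub>circle_lifts n\<^esub> g \<otimes>\<^bsub>circle_lifts n\<^esub> (\<lambda>t. t + of_int k * (real n - 1))"
proof -
  define m where "m = real n - 1"
  have m: "m > 0" "m \<in> n_adic n"
    using n n_adic_period by (simp_all add: m_def)
  interpret group "circle_lifts n"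
    using group_pl_group[OF n] .
  have f_carr: "f \<in> carrier (circle_lifts n)"
    using f rho_kernel_carrier by blast
  define k where "k = \<lfloor>f 0 / m\<rfloor>"
  define f\<^sub>0 where "f\<^sub>0 t = f t + - (of_int k * m)" for t
  have km: "of_int k * m \<in> phi_kernel n"
    using phi_kernel_int_period[OF n] by (simp add: m_def)
  have f0_pl: "pl_map n f\<^sub>0"
  proof -
    have "f\<^sub>0 = (\<lambda>t. t + - (of_int k * m)) \<circ> f"
      by (auto simp: f\<^sub>0_def)
    then show ?thesis
      using pl_map_compose[OF n pl_group_pl_map[OF f_carr]] pl_map_translation[OF n]
        n_adic_minus[OF n phi_kernel_n_adic[OF n km]] by metis
  qed
  have f0_carr: "f\<^sub>0 \<in> carrier (circle_lifts n)"
    using f0_pl pl_group_shift[OF f_carr] by (simp add: pl_group_carrier f\<^sub>0_def)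
  have "f 0 \<in> phi_kernel n"
    using f by (simp add: rho_kernel_def)
  then have f0_0: "f\<^sub>0 0 \<in> phi_kernel n"
    using phi_kernel_diff[OF n _ km] by (simp add: f\<^sub>0_def)
  have "of_int k * m \<le> f 0" "f 0 < (of_int k + 1) * m"
    using m(1) unfolding k_def by (simp_all add: pos_le_divide_eq[symmetric] pos_divide_less_eq[symmetric])
  then have f0_range: "0 \<le> f\<^sub>0 0" "f\<^sub>0 0 < m"
    by (simp_all add: f\<^sub>0_def algebra_simps)
  then have "0 < inverse_map f\<^sub>0 m"
    using pl_map_less_iff[OF f0_pl, of 0 "inverse_map f\<^sub>0 m"] pl_map_f_inv[OF f0_pl] by simp
  \<comment> \<open>Choose \<open>y\<close> so close to \<open>0\<close> that its image stays below \<open>m\<close>; then there is room for \<open>c < 0\<close>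
    and \<open>d > f\<^sub>0 y\<close> with \<open>d < c + m\<close>.\<close>
  then obtain y where y: "0 < y" "y < min m (inverse_map f\<^sub>0 m)" "y \<in> n_adic n"
    using n_adic_dense[OF n, of 0 "min m (inverse_map f\<^sub>0 m)"] m by auto
  have "f\<^sub>0 y < m"
    using pl_map_less_iff[OF f0_pl, of y "inverse_map f\<^sub>0 m"] pl_map_f_inv[OF f0_pl] y by simp
  then obtain d where d: "max y (f\<^sub>0 y) < d" "d < m" "d \<in> n_adic n"
    using n_adic_dense[OF n, of "max y (f\<^sub>0 y)" m] y by auto
  then obtain c where c: "d - m < c" "c < 0" "c \<in> n_adic n"
    using n_adic_dense[OF n, of "d - m" 0] by auto
  have f0y: "f\<^sub>0 y \<in> n_adic n" "- (f\<^sub>0 y - y) \<in> phi_kernel n"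
    using pl_map_n_adic_iff[OF f0_pl] y pl_map_preserves_coset[OF n f0_pl f0_0] phi_kernel_minus[OF n]
    by blast+
  obtain P where P: "pl_map n P" "P c = c" "P 0 = f\<^sub>0 0"
    using pl_map_between_intervals[OF n, of c 0 c "f\<^sub>0 0"] c f0_range f0_0 n_adic_0[of n]
      phi_kernel_n_adic[OF n f0_0] by auto
  obtain R where R: "pl_map n R" "R y = f\<^sub>0 y" "R d = d"
    using pl_map_between_intervals[OF n, of y d "f\<^sub>0 y" d] d y f0y by (auto simp: algebra_simps)
  let ?g = "\<lambda>t. if t \<le> 0 then P t else if t \<le> y then f\<^sub>0 t else if t \<le> d then R t else t"
  have 1: "pl_map n (\<lambda>t. if t \<le> d then R t else t)"
    using pl_map_glue2[OF d(3) R(1) pl_map_id[OF n]] R by simp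
  have 2: "pl_map n (\<lambda>t. if t \<le> y then f\<^sub>0 t else if t \<le> d then R t else t)"
    using pl_map_glue2[OF y(3) f0_pl 1] d R by simp
  have "pl_map n ?g"
    using pl_map_glue2[OF n_adic_0 P(1) 2] y P by simp
  moreover have "?g (c + m) = ?g c + m"
    using P c d y by auto
  ultimately obtain g where g: "g \<in> carrier (circle_lifts n)"
      "\<And>t. c \<le> t \<Longrightarrow> t \<le> c + m \<Longrightarrow> g t = ?g t"
    unfolding m_def by (rule periodic_extension[OF n _ c(3), of ?g]) blast
  have "g t = t" if "d \<le> t" "t \<le> c + m" for t
    using g(2)[of t] that c d y R by (cases "t = d") auto
  then have g_arc: "g \<in> arc_group n c d"
    using g(1) by (simp add: arc_group_def m_def)
  define h where "h = f\<^sub>0 \<otimes>\<^bsub>circle_lifts n\<^esub> inv\<^bsub>circle_lifts n\<^esub> g"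
  have h_carr: "h \<in> carrier (circle_lifts n)"
    unfolding h_def using f0_carr g(1) by blast
  have "h t = t" if "0 \<le> t" "t \<le> y" for t
  proof -
    have "g t = f\<^sub>0 t"
      using g(2)[of t] that c d y P by (cases "t = 0") auto
    then show ?thesis
      using inv_pl_group[OF n g(1)] pl_map_inv_f[OF pl_group_pl_map[OF g(1)], of t] by (simp add: h_def)
  qed
  then have "h t = t" if "m \<le> t" "t \<le> y + m" for t
    using that pl_group_shift[OF h_carr, of "t - m"] by (force simp: m_def)
  then have h_arc: "h \<in> arc_group n y m"
    using h_carr by (simp add: arc_group_def m_def)
  have "h \<otimes>\<^bsub>circle_lifts n\<^esub> g = f\<^sub>0"
    using f0_carr g(1) by (simp only: h_def m_assoc inv_closed l_inv r_one)
  then have "f = h \<otimes>\<^bsub>circle_lifts n\<^esub> g \<otimes>\<^bsub>circle_lifts n\<^esub> (\<lambda>t. t + of_int k * (real n - 1))"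
    by (simp add: f\<^sub>0_def m_def fun_eq_iff)
  then show thesis
    using that[OF g_arc h_arc] c d y m by (simp add: m_def)
qed

section \<open>The circle: maps of trivial displacement commute modulo the second derived subgroup\<close>

text \<open>Choose \<open>u\<close> and \<open>v\<close> that move the arc \<open>[a, b]\<close> off itself, to two disjoint places.  Then \<open>[f, u\<inverse>]\<close> is \<open>f\<close> times
a map \<open>f'\<close> supported in the first place, and \<open>[g, v\<inverse>]\<close> is \<open>g\<close> times a map \<open>g'\<close> supported in the
second.  By disjointness of supports, the commutator of these two commutators is \<open>[f, g]\<close>.\<close>

lemma arc_group_commutator_in_second_derived:
  assumes n: "n \<ge> 2" and f: "f \<in> arc_group n a b" and g: "g \<in> arc_group n a b"
    and ab: "a < b" "b < a + (real n - 1)" "a \<in> n_adic n" "b \<in> n_adic n"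
  shows "commutator (circle_lifts n) f g
    \<in> second_derived (circle_lifts n)"
proof -
  let ?G = "circle_lifts n"
  interpret group ?G
    using group_pl_group[OF n] .
  note carr = arc_group_carrier[OF f] arc_group_carrier[OF g]
  define m where "m = real n - 1"
  define e where "e = (b + (a + m)) / 2"
  have e: "b < e" "e < a + m"
    using ab by (simp_all add: e_def m_def)
  obtain u where u: "u \<in> carrier ?G" "b < u a" "u b < e"
    using move_arc[OF n ab, of b e] e ab by (auto simp: m_def)
  obtain v where v: "v \<in> carrier ?G" "e < v a" "v b < a + m"
    using move_arc[OF n ab, of e "a + m"] e ab by (auto simp: m_def)
  have mono: "u a < u b" "v a < v b"
    using u v ab pl_group_pl_map pl_map_less_iff by blast+
  define f' where "f' = inv\<^bsub>?G\<^esub> u \<otimes>\<^bsub>?G\<^esub> inv\<^bsub>?G\<^esub> f \<otimes>\<^bsub>?G\<^esub> u"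
  define g' where "g' = inv\<^bsub>?G\<^esub> v \<otimes>\<^bsub>?G\<^esub> inv\<^bsub>?G\<^esub> g \<otimes>\<^bsub>?G\<^esub> v"
  have "inv\<^bsub>?G\<^esub> f \<in> arc_group n a b" "inv\<^bsub>?G\<^esub> g \<in> arc_group n a b"
    using inverse_map_arc_group[OF n f] inverse_map_arc_group[OF n g] inv_pl_group[OF n carr(1)]
      inv_pl_group[OF n carr(2)] by simp_all
  then have arcs: "f' \<in> arc_group n (u a) (u b)" "g' \<in> arc_group n (v a) (v b)"
    unfolding f'_def g'_def using conjugate_arc_group[OF n] u v by blast+
  have carr': "f' \<in> carrier ?G" "g' \<in> carrier ?G"
    using arcs arc_group_carrier by blast+
  have comm: "f' \<otimes>\<^bsub>?G\<^esub> g = g \<otimes>\<^bsub>?G\<^esub> f'" "f \<otimes>\<^bsub>?G\<^esub> g' = g' \<otimes>\<^bsub>?G\<^esub> f" "f' \<otimes>\<^bsub>?G\<^esub> g' = g' \<otimes>\<^bsub>?G\<^esub> f'"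
    using disjoint_arc_groups_commute[OF n g arcs(1)] disjoint_arc_groups_commute[OF n f arcs(2)]
      disjoint_arc_groups_commute[OF n arcs] u v ab e mono by (simp_all add: m_def)
  have "f \<otimes>\<^bsub>?G\<^esub> f' = commutator ?G f (inv\<^bsub>?G\<^esub> u)"
    "g \<otimes>\<^bsub>?G\<^esub> g' = commutator ?G g (inv\<^bsub>?G\<^esub> v)"
    using carr u v by (simp_all only: f'_def g'_def m_assoc m_closed inv_closed inv_inv)
  then have "f \<otimes>\<^bsub>?G\<^esub> f' \<in> derived ?G (carrier ?G)" "g \<otimes>\<^bsub>?G\<^esub> g' \<in> derived ?G (carrier ?G)"
    using commutator_in_derived[OF order_refl] carr u v inv_closed by metis+
  then have "commutator ?G (f \<otimes>\<^bsub>?G\<^esub> f') (g \<otimes>\<^bsub>?G\<^esub> g')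
      \<in> second_derived ?G"
    using commutator_in_derived[OF derived_in_carrier[OF order_refl]] by blast
  then show ?thesis
    using commutator_mult_commuting[OF carr carr' comm] by simp
qed

lemma normal_second_derived:
  "n \<ge> 2 \<Longrightarrow> normal (second_derived (pl_group n p)) (pl_group n p)"
  using group.derived_is_normal[OF group_pl_group group.derived_self_is_normal[OF group_pl_group]]
  by blast

text \<open>Let \<open>h\<close> be supported in a slightly larger arc and squeeze \<open>[a, b]\<close> into \<open>(s, t)\<close>.  Then \<open>f\<close> and \<open>h\<close> commute
modulo the second derived subgroup, so \<open>h\<inverse> f h\<close> lies in the class of \<open>f\<close>.\<close>

lemma shrink_arc_mod_second_derived:
  assumes n: "n \<ge> 2" and f: "f \<in> arc_group n a b"
    and ab: "a < b" "b < a + (real n - 1)" "a \<in> n_adic n" "b \<in> n_adic n"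
    and st: "a \<le> s" "s < t" "t \<le> b"
  obtains f' a' b' where "f' \<in> arc_group n a' b'" "s < a'" "a' < b'" "b' < t"
    "second_derived (circle_lifts n) #>\<^bsub>circle_lifts n\<^esub> f' = second_derived (circle_lifts n) #>\<^bsub>circle_lifts n\<^esub> f"
proof -
  let ?G = "circle_lifts n"
  let ?N = "second_derived ?G"
  interpret normal ?N ?G
    using normal_second_derived[OF n] .
  interpret quot: group_hom ?G "?G Mod ?N" "\<lambda>x. ?N #>\<^bsub>?G\<^esub> x"
    using group_hom_quotient .
  define m where "m = real n - 1"
  obtain c where c: "b - m < c" "c < a" "c \<in> n_adic n"
    using n_adic_dense[OF n, of "b - m" a] ab by (auto simp: m_def)
  obtain d where d: "b < d" "d < c + m" "d \<in> n_adic n"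
    using n_adic_dense[OF n, of b "c + m"] c by (auto simp: m_def)
  obtain h where h: "h \<in> arc_group n c d" "s < h a" "h b < t"
    using move_arc_inside[OF n, of c a b d s t] c d ab st by (auto simp: m_def)
  have carr: "f \<in> carrier ?G" "h \<in> carrier ?G"
    using f h arc_group_carrier by blast+
  have "f \<in> arc_group n c d"
    using arc_group_mono[OF f] c d by simp
  then have "commutator ?G f h \<in> ?N"
    using arc_group_commutator_in_second_derived[OF n _ h(1)] c d ab by (simp add: m_def)
  then have comm: "(?N #>\<^bsub>?G\<^esub> f) \<otimes>\<^bsub>?G Mod ?N\<^esub> (?N #>\<^bsub>?G\<^esub> h) = (?N #>\<^bsub>?G\<^esub> h) \<otimes>\<^bsub>?G Mod ?N\<^esub> (?N #>\<^bsub>?G\<^esub> f)"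
    using quot.commutator_kernel_iff[OF carr] kernel_quotient by simp
  define f' where "f' = inv\<^bsub>?G\<^esub> h \<otimes>\<^bsub>?G\<^esub> f \<otimes>\<^bsub>?G\<^esub> h"
  have "f' = inv\<^bsub>?G\<^esub> h \<otimes>\<^bsub>?G\<^esub> (f \<otimes>\<^bsub>?G\<^esub> h)"
    using carr by (simp only: f'_def m_assoc inv_closed)
  then have "?N #>\<^bsub>?G\<^esub> f' = inv\<^bsub>?G Mod ?N\<^esub> (?N #>\<^bsub>?G\<^esub> h) \<otimes>\<^bsub>?G Mod ?N\<^esub>
      ((?N #>\<^bsub>?G\<^esub> h) \<otimes>\<^bsub>?G Mod ?N\<^esub> (?N #>\<^bsub>?G\<^esub> f))"
    using carr by (simp only: quot.hom_mult quot.hom_inv m_closed inv_closed comm)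
  then have "?N #>\<^bsub>?G\<^esub> f' = ?N #>\<^bsub>?G\<^esub> f"
    using carr by (simp only: quot.hom_closed quot.H.inv_closed quot.H.l_inv quot.H.l_one
        quot.H.m_assoc[symmetric])
  moreover have "f' \<in> arc_group n (h a) (h b)"
    unfolding f'_def using conjugate_arc_group[OF n f carr(2)] .
  moreover have "h a < h b"
    using carr ab pl_group_pl_map pl_map_less_iff by blast
  ultimately show thesis
    using that h by blast
qed

text \<open>The two arcs may overlap, or even cover the circle together; but up to the second derived
subgroup, the maps may be replaced by maps with support in small disjoint parts of the arcs.\<close>

lemma arc_groups_commute_mod_second_derived:
  assumes n: "n \<ge> 2" and f: "f \<in> arc_group n a b" and g: "g \<in> arc_group n c d"
    and ab: "a < b" "b < a + (real n - 1)" "a \<in> n_adic n" "b \<in> n_adic n"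
    and cd: "c < d" "d < c + (real n - 1)" "c \<in> n_adic n" "d \<in> n_adic n"
  shows "second_derived (circle_lifts n) #>\<^bsub>circle_lifts n\<^esub> (f \<otimes>\<^bsub>circle_lifts n\<^esub> g)
    = second_derived (circle_lifts n) #>\<^bsub>circle_lifts n\<^esub> (g \<otimes>\<^bsub>circle_lifts n\<^esub> f)"
proof -
  let ?G = "circle_lifts n"
  let ?N = "second_derived ?G"
  interpret normal ?N ?G
    using normal_second_derived[OF n] .
  interpret quot: group_hom ?G "?G Mod ?N" "\<lambda>x. ?N #>\<^bsub>?G\<^esub> x"
    using group_hom_quotient .
  define m where "m = real n - 1"
  have m: "m > 0"
    using n by (simp add: m_def)
  \<comment> \<open>Shift the second arc by periods until it starts in \<open>[a, a + m)\<close>.\<close>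
  define k where "k = - \<lfloor>(c - a) / m\<rfloor>"
  define c' where "c' = c + of_int k * m"
  define d' where "d' = d + of_int k * m"
  have "of_int (- k) * m \<le> c - a" "c - a < (of_int (- k) + 1) * m"
    using m unfolding k_def by (simp_all add: pos_le_divide_eq[symmetric] pos_divide_less_eq[symmetric])
  then have c': "a \<le> c'" "c' < a + m"
    by (simp_all add: c'_def algebra_simps)
  have g_shifted: "g \<in> arc_group n c' d'"
    using arc_group_shift[OF g] by (simp add: c'_def d'_def m_def)
  have cd': "c' < d'" "d' < c' + (real n - 1)" "c' \<in> n_adic n" "d' \<in> n_adic n"
    using cd n_adic_add[OF n _ phi_kernel_n_adic[OF n phi_kernel_int_period[OF n]]]
    by (simp_all add: c'_def d'_def m_def)
  \<comment> \<open>Two disjoint intervals of length \<open>e\<close>: one at the start of \<open>[a, b]\<close>, the other at distance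
    \<open>e\<close> from the start of \<open>[c', d']\<close>, in case \<open>a = c'\<close>.\<close>
  define e where "e = min (b - a) (min (d' - c') (a + m - c')) / 2"
  have e: "0 < e" "2 * e \<le> b - a" "2 * e \<le> d' - c'" "2 * e \<le> a + m - c'"
    using ab cd' c' by (auto simp: e_def min_def)
  obtain f' a' b' where f': "f' \<in> arc_group n a' b'" "a < a'" "a' < b'" "b' < a + e"
      "?N #>\<^bsub>?G\<^esub> f' = ?N #>\<^bsub>?G\<^esub> f"
    using shrink_arc_mod_second_derived[OF n f ab, of a "a + e"] e by auto
  obtain g' s t where g': "g' \<in> arc_group n s t" "c' + e < s" "s < t" "t < c' + 2 * e"
      "?N #>\<^bsub>?G\<^esub> g' = ?N #>\<^bsub>?G\<^esub> g"
    using shrink_arc_mod_second_derived[OF n g_shifted cd', of "c' + e" "c' + 2 * e"] e by auto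
  have carr: "f \<in> carrier ?G" "g \<in> carrier ?G" "f' \<in> carrier ?G" "g' \<in> carrier ?G"
    using f g f'(1) g'(1) arc_group_carrier by blast+
  have "f' \<otimes>\<^bsub>?G\<^esub> g' = g' \<otimes>\<^bsub>?G\<^esub> f'"
    using disjoint_arc_groups_commute[OF n f'(1) g'(1)] f' g' c' e by (simp add: m_def)
  then have "(?N #>\<^bsub>?G\<^esub> f') \<otimes>\<^bsub>?G Mod ?N\<^esub> (?N #>\<^bsub>?G\<^esub> g') = (?N #>\<^bsub>?G\<^esub> g') \<otimes>\<^bsub>?G Mod ?N\<^esub> (?N #>\<^bsub>?G\<^esub> f')"
    using carr quot.hom_mult by metis
  then show ?thesis
    using carr quot.hom_mult by (simp only: f'(5) g'(5))
qed

lemma period_translation_central: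
  assumes n: "n \<ge> 2"
  shows "(\<lambda>t. t + of_int k * (real n - 1)) \<in> carrier (circle_lifts n)"
    and "F \<in> carrier (circle_lifts n) \<Longrightarrow>
      (\<lambda>t. t + of_int k * (real n - 1)) \<otimes>\<^bsub>circle_lifts n\<^esub> F
      = F \<otimes>\<^bsub>circle_lifts n\<^esub> (\<lambda>t. t + of_int k * (real n - 1))"
proof -
  show "(\<lambda>t. t + of_int k * (real n - 1)) \<in> carrier (circle_lifts n)"
    using pl_map_translation[OF n phi_kernel_n_adic[OF n phi_kernel_int_period[OF n]]]
    by (simp add: pl_group_carrier)
  show "(\<lambda>t. t + of_int k * (real n - 1)) \<otimes>\<^bsub>circle_lifts n\<^esub> F
      = F \<otimes>\<^bsub>circle_lifts n\<^esub> (\<lambda>t. t + of_int k * (real n - 1))" if "F \<in> carrier (circle_lifts n)"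
    using pl_group_shift_int[OF that] by (auto simp: fun_eq_iff)
qed

text \<open>By fragmentation, both maps are products of maps supported in arcs and of central translations, and all
these factors commute modulo the second derived subgroup.\<close>

lemma rho_kernel_commutator_in_second_derived:
  assumes n: "n \<ge> 2" and f: "f \<in> rho_kernel n (real n - 1)" and g: "g \<in> rho_kernel n (real n - 1)"
  shows "commutator (circle_lifts n) f g
    \<in> second_derived (circle_lifts n)"
proof -
  let ?G = "circle_lifts n"
  let ?N = "second_derived ?G"
  interpret normal ?N ?G
    using normal_second_derived[OF n] .
  interpret quot: group_hom ?G "?G Mod ?N" "\<lambda>x. ?N #>\<^bsub>?G\<^esub> x"
    using group_hom_quotient .
  define comm where "comm x y \<longleftrightarrow> (?N #>\<^bsub>?G\<^esub> x) \<otimes>\<^bsub>?G Mod ?N\<^esub> (?N #>\<^bsub>?G\<^esub> y)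
    = (?N #>\<^bsub>?G\<^esub> y) \<otimes>\<^bsub>?G Mod ?N\<^esub> (?N #>\<^bsub>?G\<^esub> x)" for x y
  have comm_sym: "comm x y \<Longrightarrow> comm y x" for x y
    by (simp add: comm_def)
  have comm_mult: "comm (x \<otimes>\<^bsub>?G\<^esub> y) z" if "comm x z" "comm y z" "x \<in> carrier ?G" "y \<in> carrier ?G" "z \<in> carrier ?G"
    for x y z
    unfolding comm_def quot.hom_mult[OF that(3,4)]
    by (rule quot.H.commute_mult) (use that in \<open>simp_all add: comm_def\<close>)
  have commI: "comm x y" if "x \<otimes>\<^bsub>?G\<^esub> y = y \<otimes>\<^bsub>?G\<^esub> x" "x \<in> carrier ?G" "y \<in> carrier ?G" for x y
    using that unfolding comm_def by (metis quot.hom_mult)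
  have comm_arcs: "comm x y"
    if "x \<in> arc_group n a b" "a < b" "b < a + (real n - 1)" "a \<in> n_adic n" "b \<in> n_adic n"
      "y \<in> arc_group n c d" "c < d" "d < c + (real n - 1)" "c \<in> n_adic n" "d \<in> n_adic n"
    for x y a b c d
    using arc_groups_commute_mod_second_derived[OF n that(1,6,2-5,7-10)]
      arc_group_carrier[OF that(1)] arc_group_carrier[OF that(6)]
    unfolding comm_def by (metis quot.hom_mult)
  note decompose = rho_kernel_fragmentation[OF n]
  have comm_arc_rho: "comm y x" if x: "x \<in> arc_group n a b" "a < b" "b < a + (real n - 1)" "a \<in> n_adic n" "b \<in> n_adic n"
    and y: "y \<in> rho_kernel n (real n - 1)" for x y a b
    using decompose[OF y]
  proof cases
    case (1 k a' b' c d g h)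
    note carr = arc_group_carrier[OF x(1)] arc_group_carrier[OF 1(1)] arc_group_carrier[OF 1(2)]
    have "comm (\<lambda>t. t + of_int k * (real n - 1)) x"
      using period_translation_central[OF n] carr(1) by (intro commI)
    then show ?thesis
      unfolding 1(11) using comm_arcs 1 x carr period_translation_central(1)[OF n]
      by (intro comm_mult m_closed) blast+
  qed
  have "comm g f"
    using decompose[OF f]
  proof cases
    case (1 k a b c d x y)
    note carr = rho_kernel_carrier[OF g] arc_group_carrier[OF 1(1)] arc_group_carrier[OF 1(2)]
    have "comm (\<lambda>t. t + of_int k * (real n - 1)) g"
      using period_translation_central[OF n] carr(1) by (intro commI)
    then have "comm f g"
      unfolding 1(11) using comm_sym[OF comm_arc_rho[OF _ _ _ _ _ g]] 1 carr period_translation_central(1)[OF n]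
      by (intro comm_mult m_closed) blast+
    then show ?thesis
      by (rule comm_sym)
  qed
  then show ?thesis
    using quot.commutator_kernel_iff[of f g] rho_kernel_carrier f g kernel_quotient
    by (simp add: comm_def)
qed

section \<open>The circle: jumps of the slope, summed over a residue class\<close>

lemma slopes_if_affine:
  assumes "u < t" "t < v" "\<And>s. u < s \<Longrightarrow> s < v \<Longrightarrow> F s = a * s + c"
  shows "left_slope F t a" "right_slope F t a"
proof -
  show "left_slope F t a"
    by (rule left_slope_cong[OF left_slope_affine[of a c], of "t - u"]) (use assms in auto)
  show "right_slope F t a"
    by (rule right_slope_cong[OF right_slope_affine[of a c], of "v - t"]) (use assms in auto)
qed

text \<open>The difference of the right and left logarithmic slopes.  It is meant for maps \<open>F\<close> that have
one-sided slopes at \<open>t\<close>, which are unique then.\<close>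

definition jump :: "nat \<Rightarrow> (real \<Rightarrow> real) \<Rightarrow> real \<Rightarrow> real" where
  "jump n F t = log (real n) ((THE b. right_slope F t b) / (THE a. left_slope F t a))"

lemma jump_eq:
  assumes "left_slope F t a" "right_slope F t b"
  shows "jump n F t = log (real n) (b / a)"
proof -
  have "(THE b. right_slope F t b) = b" "(THE a. left_slope F t a) = a"
    using assms right_slope_unique left_slope_unique by blast+
  then show ?thesis
    by (simp add: jump_def)
qed

lemma jump_id: "jump n (\<lambda>t. t) t = 0"
  using jump_eq[of "\<lambda>t. t" t 1 1] slopes_if_affine[of "t - 1" t "t + 1" "\<lambda>t. t" 1 0] by simp

text \<open>The chain rule for the logarithm of the slopes.\<close>

lemma jump_compose:
  assumes n: "n \<ge> 2" and F: "pl_map n F" and G: "pl_map n G"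
  shows "jump n (G \<circ> F) t = jump n F t + jump n G (F t)"
proof -
  obtain a b where ab: "a \<in> slope_group n" "b \<in> slope_group n" "left_slope F t a" "right_slope F t b"
    using pl_map_slopes[OF F] by metis
  obtain c d where cd: "c \<in> slope_group n" "d \<in> slope_group n" "left_slope G (F t) c"
      "right_slope G (F t) d"
    using pl_map_slopes[OF G] by metis
  have pos: "a > 0" "b > 0" "c > 0" "d > 0"
    using ab cd slope_group_pos[OF n] by blast+
  have "jump n (G \<circ> F) t = log (real n) ((d * b) / (c * a))"
    using jump_eq[OF left_slope_compose[OF ab(3) cd(3)] right_slope_compose[OF ab(4) cd(4)]] pos
    by simp
  also have "(d * b) / (c * a) = (b / a) * (d / c)"
    by (simp add: mult.commute)
  also have "log (real n) \<dots> = log (real n) (b / a) + log (real n) (d / c)"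
    using pos by (simp add: log_def ln_mult ln_div add_divide_distrib diff_divide_distrib)
  finally show ?thesis
    using jump_eq[OF ab(3,4)] jump_eq[OF cd(3,4)] by (simp add: o_def)
qed

lemma jump_shift_int:
  assumes "F \<in> carrier (pl_group n p)"
  shows "jump n F (t + of_int k * p) = jump n F t"
proof -
  define q where "q = of_int k * p"
  have shift: "F (s + q) = F s + q" for s
    using pl_group_shift_int[OF assms] by (simp add: q_def)
  have "F (t + q + h) = F (t + q) + b * h \<longleftrightarrow> F (t + h) = F t + b * h"
    "F (t + q - h) = F (t + q) - b * h \<longleftrightarrow> F (t - h) = F t - b * h" for b h
    using shift[of t] shift[of "t + h"] shift[of "t - h"] by (auto simp: add_ac add_diff_eq[symmetric])
  then have "right_slope F (t + q) b \<longleftrightarrow> right_slope F t b"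
    "left_slope F (t + q) b \<longleftrightarrow> left_slope F t b" for b
    unfolding right_slope_def left_slope_def by presburger+
  then show ?thesis
    by (simp add: jump_def q_def)
qed

lemma jump_eq_0_iff:
  assumes n: "n \<ge> 2" and a: "a \<in> slope_group n" "b \<in> slope_group n" "left_slope F t a" "right_slope F t b"
  shows "jump n F t = 0 \<longleftrightarrow> a = b"
proof -
  have "a > 0" "b > 0"
    using a slope_group_pos[OF n] by blast+
  moreover from this have "ln (b / a) = 0 \<longleftrightarrow> b / a = 1"
    by (intro ln_eq_zero_iff) simp
  ultimately show ?thesis
    using n jump_eq[OF a(3,4)] by (auto simp: log_def)
qed

lemma pl_map_jump_n_adic:
  assumes n: "n \<ge> 2" and F: "pl_map n F" and "jump n F t \<noteq> 0"
  shows "t \<in> n_adic n"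
  using pl_map_slopes[OF F, of t] jump_eq_0_iff[OF n] assms(3) by metis

lemma pl_map_locally_affine:
  assumes n: "n \<ge> 2" and F: "pl_map n F" and "jump n F t = 0"
  obtains a e where "a \<in> slope_group n" "e > 0" "\<And>s. \<bar>s - t\<bar> < e \<Longrightarrow> F s = a * s + (F t - a * t)"
proof -
  obtain a b where ab: "a \<in> slope_group n" "b \<in> slope_group n" "left_slope F t a" "right_slope F t b"
    using pl_map_slopes[OF F] by metis
  have "a = b"
    using jump_eq_0_iff[OF n ab] assms(3) by simp
  obtain d where d: "d > 0" "\<And>h. 0 \<le> h \<Longrightarrow> h < d \<Longrightarrow> F (t - h) = F t - a * h"
    using left_slopeE[OF ab(3)] by blast
  obtain e where e: "e > 0" "\<And>h. 0 \<le> h \<Longrightarrow> h < e \<Longrightarrow> F (t + h) = F t + b * h"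
    using right_slopeE[OF ab(4)] by blast
  have "F s = a * s + (F t - a * t)" if "\<bar>s - t\<bar> < min d e" for s
  proof (cases "s \<le> t")
    case True
    then show ?thesis
      using d(2)[of "t - s"] that by (simp add: algebra_simps)
  next
    case False
    then have "F s = F t + b * (s - t)"
      using e(2)[of "s - t"] that by simp
    moreover have "b * (s - t) = a * s - a * t"
      by (simp only: \<open>a = b\<close> right_diff_distrib)
    ultimately show ?thesis
      by linarith
  qed
  then show thesis
    by (rule that[of a "min d e", rotated 2]) (use ab d e in auto)
qed

lemma pl_map_jumps_isolated:
  assumes n: "n \<ge> 2" and F: "pl_map n F"
  obtains e where "e > 0" "\<And>s. s \<noteq> t \<Longrightarrow> \<bar>s - t\<bar> < e \<Longrightarrow> jump n F s = 0"
proof -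
  obtain a b where ab: "a \<in> slope_group n" "b \<in> slope_group n" "left_slope F t a" "right_slope F t b"
    using pl_map_slopes[OF F] by metis
  obtain d where d: "d > 0" "\<And>h. 0 \<le> h \<Longrightarrow> h < d \<Longrightarrow> F (t - h) = F t - a * h"
    using left_slopeE[OF ab(3)] by blast
  obtain e where e: "e > 0" "\<And>h. 0 \<le> h \<Longrightarrow> h < e \<Longrightarrow> F (t + h) = F t + b * h"
    using right_slopeE[OF ab(4)] by blast
  have "jump n F s = 0" if "s \<noteq> t" "\<bar>s - t\<bar> < min d e" for s
  proof (cases "s < t")
    case True
    have "F r = a * r + (F t - a * t)" if "t - d < r" "r < t" for r
      using d(2)[of "t - r"] that by (simp add: algebra_simps)
    then have "left_slope F s a" "right_slope F s a"
      using slopes_if_affine[of "t - d" s t F a] True that by auto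
    then show ?thesis
      using jump_eq_0_iff[OF n ab(1) ab(1)] by blast
  next
    case False
    have "F r = b * r + (F t - b * t)" if "t < r" "r < t + e" for r
      using e(2)[of "r - t"] that right_diff_distrib[of b r t] by simp
    then have "left_slope F s b" "right_slope F s b"
      using slopes_if_affine[of t s "t + e" F b] False that by auto
    then show ?thesis
      using jump_eq_0_iff[OF n ab(2) ab(2)] by blast
  qed
  then show thesis
    using that[of "min d e"] d e by simp
qed

lemma pl_map_finite_jumps:
  assumes n: "n \<ge> 2" and F: "pl_map n F"
  shows "finite {t \<in> {a..b}. jump n F t \<noteq> 0}"
proof -
  have "finite ({a..b} \<inter> {t. jump n F t \<noteq> 0})"
  proof (rule finite_not_islimpt_in_compact)
    fix z
    obtain e where "e > 0" "\<And>s. s \<noteq> z \<Longrightarrow> \<bar>s - z\<bar> < e \<Longrightarrow> jump n F s = 0"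
      using pl_map_jumps_isolated[OF n F, of z] by blast
    then show "\<not> z islimpt {t. jump n F t \<noteq> 0}"
      unfolding islimpt_approachable dist_real_def by blast
  qed simp
  then show ?thesis
    by (simp add: Int_def)
qed

text \<open>The sum extends over the points of the circle in one residue class.  Only finitely many summands are
nonzero, so the infinite sum merely avoids naming the finite support.\<close>

definition jump_sum :: "nat \<Rightarrow> real \<Rightarrow> (real \<Rightarrow> real) \<Rightarrow> real" where
  "jump_sum n c F = (\<Sum>\<^sub>\<infinity>t | t \<in> {0..<real n - 1} \<and> t - c \<in> phi_kernel n. jump n F t)"

lemma jumps_summable:
  assumes n: "n \<ge> 2" and F: "pl_map n F"
  shows "jump n F summable_on {t. t \<in> {0..<real n - 1} \<and> t - c \<in> phi_kernel n}"
  by (intro finite_nonzero_values_imp_summable_on finite_subset[OF _ pl_map_finite_jumps[OF n F, of 0 "real n - 1"]])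
    auto

lemma jump_sum_cong:
  assumes n: "n \<ge> 2" and "c - d \<in> phi_kernel n"
  shows "jump_sum n c F = jump_sum n d F"
proof -
  have "t - c \<in> phi_kernel n \<longleftrightarrow> t - d \<in> phi_kernel n" for t
    using phi_kernel_add[OF n _ assms(2), of "t - c"] phi_kernel_diff[OF n _ assms(2), of "t - d"]
    by auto
  then show ?thesis
    by (simp add: jump_sum_def)
qed

text \<open>By the chain rule for jumps; the second summand is reindexed along \<open>F\<close>, which maps the points of
the circle in the class of \<open>c\<close> bijectively onto those in the class of \<open>F c\<close>.\<close>

lemma jump_sum_compose:
  assumes n: "n \<ge> 2" and F: "F \<in> carrier (circle_lifts n)" and G: "G \<in> carrier (circle_lifts n)"
    and c: "c \<in> n_adic n"
  shows "jump_sum n c (G \<circ> F) = jump_sum n c F + jump_sum n (F c) G"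
proof -
  define m where "m = real n - 1"
  have m: "m > 0"
    using n by (simp add: m_def)
  define S where "S c = {t. t \<in> {0..<m} \<and> t - c \<in> phi_kernel n}" for c
  note plF = pl_group_pl_map[OF F] and plG = pl_group_pl_map[OF G]
  \<comment> \<open>The representative in \<open>[0, m)\<close> of a point of the circle.\<close>
  define wrap where "wrap y = y + of_int (- \<lfloor>y / m\<rfloor>) * m" for y
  have wrap_range: "wrap y \<in> {0..<m}" for y
  proof -
    have "of_int \<lfloor>y / m\<rfloor> * m \<le> y" "y < (of_int \<lfloor>y / m\<rfloor> + 1) * m"
      using m by (simp_all add: pos_le_divide_eq[symmetric] pos_divide_less_eq[symmetric])
    then show ?thesis
      by (auto simp: wrap_def algebra_simps)
  qed
  have wrap_kernel: "y - wrap y \<in> phi_kernel n" for y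
    using phi_kernel_int_period[OF n, of "\<lfloor>y / m\<rfloor>"] by (simp add: wrap_def m_def)
  have wrap_unique: "x = y + of_int k * m \<Longrightarrow> x \<in> {0..<m} \<Longrightarrow> y \<in> {0..<m} \<Longrightarrow> x = y" for x y and k :: int
  proof -
    assume *: "x = y + of_int k * m" "x \<in> {0..<m}" "y \<in> {0..<m}"
    then have "of_int k * m < 1 * m" "(- 1) * m < of_int k * m"
      unfolding atLeastLessThan_iff by linarith+
    then have "(of_int k :: real) < 1" "- 1 < (of_int k :: real)"
      using m mult_right_less_imp_less by (blast intro: less_imp_le)+
    then show "x = y"
      using * by simp
  qed
  have F_coset: "(F t - F c) - (t - c) \<in> phi_kernel n" if "t \<in> n_adic n" for t
    using pl_map_displacement[OF n plF c that] .
  have bij: "bij_betw (wrap \<circ> F) (S c) (S (F c))"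
    unfolding bij_betw_def
  proof
    show "inj_on (wrap \<circ> F) (S c)"
    proof (rule inj_onI)
      fix x y assume xy: "x \<in> S c" "y \<in> S c" "(wrap \<circ> F) x = (wrap \<circ> F) y"
      then have "F x = F y + of_int (\<lfloor>F x / m\<rfloor> - \<lfloor>F y / m\<rfloor>) * m"
        by (simp add: wrap_def algebra_simps)
      also have "\<dots> = F (y + of_int (\<lfloor>F x / m\<rfloor> - \<lfloor>F y / m\<rfloor>) * m)"
        using pl_group_shift_int[OF F] by (simp only: m_def)
      finally have "x = y + of_int (\<lfloor>F x / m\<rfloor> - \<lfloor>F y / m\<rfloor>) * m"
        using pl_map_eq_iff[OF plF] by simp
      then show "x = y"
        by (rule wrap_unique) (use xy in \<open>simp_all add: S_def\<close>)
    qed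
    show "(wrap \<circ> F) ` S c = S (F c)"
    proof
      show "(wrap \<circ> F) ` S c \<subseteq> S (F c)"
      proof clarify
        fix t assume t: "t \<in> S c"
        then have "t \<in> n_adic n"
          using n_adic_coset[OF n] c by (auto simp: S_def)
        then have "(F t - F c) - (t - c) + (t - c) - (F t - wrap (F t)) \<in> phi_kernel n"
          using t by (intro phi_kernel_add[OF n] phi_kernel_diff[OF n _ wrap_kernel] F_coset)
            (simp_all add: S_def)
        then show "(wrap \<circ> F) t \<in> S (F c)"
          using wrap_range by (simp add: S_def)
      qed
      show "S (F c) \<subseteq> (wrap \<circ> F) ` S c"
      proof
        fix z assume z: "z \<in> S (F c)"
        define t where "t = inverse_map F z"
        have Ft: "F t = z"
          using pl_map_f_inv[OF plF] by (simp add: t_def)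
        have "z \<in> n_adic n"
          using z n_adic_coset[OF n] pl_map_n_adic_iff[OF plF] c by (auto simp: S_def)
        then have "t \<in> n_adic n"
          using Ft pl_map_n_adic_iff[OF plF] by metis
        then have "(z - F c) - ((F t - F c) - (t - c)) - (t - wrap t) \<in> phi_kernel n"
          using z phi_kernel_diff[OF n phi_kernel_diff[OF n _ F_coset] wrap_kernel, of "z - F c" t t]
          by (simp only: S_def mem_Collect_eq)
        then have "wrap t \<in> S c"
          using wrap_range Ft by (simp add: S_def)
        moreover have "(wrap \<circ> F) (wrap t) = z"
        proof (rule wrap_unique[of _ z])
          have "F (wrap t) = z + of_int (- \<lfloor>t / m\<rfloor>) * m"
            unfolding wrap_def using pl_group_shift_int[OF F] Ft by (simp only: m_def)
          then show "(wrap \<circ> F) (wrap t) = z + of_int (- \<lfloor>t / m\<rfloor> - \<lfloor>F (wrap t) / m\<rfloor>) * m"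
            by (simp add: wrap_def[of "F (wrap t)"] algebra_simps)
        qed (use wrap_range z in \<open>auto simp: S_def\<close>)
        ultimately show "z \<in> (wrap \<circ> F) ` S c"
          by (metis image_eqI)
      qed
    qed
  qed
  have jump_wrap: "jump n G (wrap y) = jump n G y" for y
    unfolding wrap_def using jump_shift_int[OF G] by (simp only: m_def)
  have jumps: "jump n (G \<circ> F) t = jump n F t + jump n G (F t)" for t
    using jump_compose[OF n plF plG] .
  have sumF: "jump n F summable_on S c"
    using jumps_summable[OF n plF] by (simp add: S_def m_def)
  have "(\<lambda>t. jump n G (F t)) summable_on S c"
  proof (rule finite_nonzero_values_imp_summable_on)
    have "finite ({t \<in> {0..m}. jump n (G \<circ> F) t \<noteq> 0} \<union> {t \<in> {0..m}. jump n F t \<noteq> 0})"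
      using pl_map_finite_jumps[OF n] plF pl_map_compose[OF n plF plG] by blast
    then show "finite {t \<in> S c. jump n G (F t) \<noteq> 0}"
      by (rule rev_finite_subset) (auto simp: S_def jumps)
  qed
  then have "infsum (jump n (G \<circ> F)) (S c) = infsum (jump n F) (S c) + infsum (\<lambda>t. jump n G (F t)) (S c)"
    unfolding jumps using sumF by (intro infsum_add)
  also have "infsum (\<lambda>t. jump n G (F t)) (S c) = infsum (\<lambda>t. jump n G ((wrap \<circ> F) t)) (S c)"
    by (simp add: jump_wrap)
  also have "\<dots> = infsum (jump n G) (S (F c))"
    by (rule infsum_reindex_bij_betw[OF bij])
  finally show ?thesis
    by (simp only: jump_sum_def S_def m_def)
qed

lemma jump_sum_id: "jump_sum n c (\<lambda>t. t) = 0"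
  by (simp add: jump_sum_def jump_id)

lemma jump_sum_inverse_map:
  assumes n: "n \<ge> 2" and F: "F \<in> carrier (circle_lifts n)" and c: "c \<in> n_adic n"
  shows "jump_sum n (F c) (inverse_map F) = - jump_sum n c F"
proof -
  have "inverse_map F \<circ> F = (\<lambda>t. t)"
    using pl_map_inv_f[OF pl_group_pl_map[OF F]] by auto
  then have "0 = jump_sum n c F + jump_sum n (F c) (inverse_map F)"
    using jump_sum_compose[OF n F inverse_map_pl_group[OF n F] c] jump_sum_id by metis
  then show ?thesis
    by simp
qed

text \<open>The contributions of \<open>f\<close> and its inverse cancel, because \<open>b\<close> preserves the residue classes.\<close>

lemma jump_sum_commutator:
  assumes n: "n \<ge> 2" and f: "f \<in> carrier (circle_lifts n)" and b: "b \<in> rho_kernel n (real n - 1)"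
    and c: "c \<in> n_adic n"
  shows "jump_sum n c (commutator (circle_lifts n) f b)
    = jump_sum n (f c) b - jump_sum n c b"
proof -
  interpret group "circle_lifts n"
    using group_pl_group[OF n] .
  have b': "b \<in> carrier (circle_lifts n)"
    using b rho_kernel_carrier by blast
  let ?f' = "inverse_map f" and ?b' = "inverse_map b"
  have inv: "?f' \<in> carrier (circle_lifts n)" "?b' \<in> carrier (circle_lifts n)"
    using inverse_map_pl_group[OF n] f b' by blast+
  have carr: "b \<circ> f \<in> carrier (circle_lifts n)" "?f' \<circ> (b \<circ> f) \<in> carrier (circle_lifts n)"
    using m_closed[OF f b'] m_closed[OF m_closed[OF f b'] inv(1)] by simp_all
  have adic: "f c \<in> n_adic n" "b (f c) \<in> n_adic n" "?b' c \<in> n_adic n" "?f' (b (f c)) \<in> n_adic n"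
    using c f b' inv pl_group_pl_map pl_map_n_adic_iff by meson+
  have b_coset: "b t - t \<in> phi_kernel n" if "t \<in> n_adic n" for t
    using b rho_kernel_iff[OF n b' that] by blast
  have "jump_sum n c (?b' \<circ> (?f' \<circ> (b \<circ> f)))
      = jump_sum n c f + jump_sum n (f c) b + jump_sum n (b (f c)) ?f' + jump_sum n (?f' (b (f c))) ?b'"
    using jump_sum_compose[OF n carr(2) inv(2) c] jump_sum_compose[OF n carr(1) inv(1) c]
      jump_sum_compose[OF n f b' c] by simp
  also have "jump_sum n (b (f c)) ?f' = - jump_sum n c f"
    using jump_sum_cong[OF n b_coset[OF adic(1)], of ?f'] jump_sum_inverse_map[OF n f c] by simp
  also have "jump_sum n (?f' (b (f c))) ?b' = - jump_sum n c b"
  proof -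
    have "(?f' (b (f c)) - ?f' (f c)) - (b (f c) - f c) + (b (f c) - f c) \<in> phi_kernel n"
      using pl_map_displacement[OF n pl_group_pl_map[OF inv(1)] adic(1,2)] b_coset[OF adic(1)]
        phi_kernel_add[OF n] by blast
    then have "?f' (b (f c)) - c \<in> phi_kernel n"
      using pl_map_inv_f[OF pl_group_pl_map[OF f]] by simp
    then have "jump_sum n (?f' (b (f c))) ?b' = jump_sum n (b (?b' c)) ?b'"
      using jump_sum_cong[OF n] pl_map_f_inv[OF pl_group_pl_map[OF b']] by simp
    also have "\<dots> = - jump_sum n (?b' c) b"
      using jump_sum_inverse_map[OF n b' adic(3)] .
    also have "jump_sum n (?b' c) b = jump_sum n c b"
      using jump_sum_cong[OF n b_coset[OF adic(3)], of b] pl_map_f_inv[OF pl_group_pl_map[OF b']] by simp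
    finally show ?thesis .
  qed
  finally show ?thesis
    using inv_pl_group[OF n f] inv_pl_group[OF n b'] by (simp add: o_def)
qed

definition jump_sum_kernel :: "nat \<Rightarrow> (real \<Rightarrow> real) set" where
  "jump_sum_kernel n = {F \<in> rho_kernel n (real n - 1). \<forall>c\<in>n_adic n. jump_sum n c F = 0}"

lemma subgroup_jump_sum_kernel:
  assumes n: "n \<ge> 2"
  shows "subgroup (jump_sum_kernel n) (circle_lifts n)"
proof -
  interpret group "circle_lifts n"
    using group_pl_group[OF n] .
  interpret B: subgroup "rho_kernel n (real n - 1)" "circle_lifts n"
    using subgroup_rho_kernel[OF n] .
  show ?thesis
  proof (rule subgroupI)
    show "jump_sum_kernel n \<subseteq> carrier (circle_lifts n)"
      using B.subset by (auto simp: jump_sum_kernel_def)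
    show "jump_sum_kernel n \<noteq> {}"
      using B.one_closed jump_sum_id by (auto simp: jump_sum_kernel_def)
    fix F assume F: "F \<in> jump_sum_kernel n"
    then have carr: "F \<in> carrier (circle_lifts n)"
      using B.subset by (auto simp: jump_sum_kernel_def)
    note pl = pl_group_pl_map[OF carr]
    have "jump_sum n c (inverse_map F) = 0" if "c \<in> n_adic n" for c
    proof -
      have "inverse_map F c \<in> n_adic n"
        using that pl_map_n_adic_iff[OF pl_map_inv[OF n pl]] by simp
      then show ?thesis
        using F jump_sum_inverse_map[OF n carr, of "inverse_map F c"] pl_map_f_inv[OF pl]
        by (simp add: jump_sum_kernel_def)
    qed
    then show "inv\<^bsub>circle_lifts n\<^esub> F \<in> jump_sum_kernel n"
      using F B.m_inv_closed[of F] inv_pl_group[OF n carr] by (simp add: jump_sum_kernel_def)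
    fix G assume G: "G \<in> jump_sum_kernel n"
    then have carr': "G \<in> carrier (circle_lifts n)"
      using B.subset by (auto simp: jump_sum_kernel_def)
    have "jump_sum n c (G \<circ> F) = 0" if "c \<in> n_adic n" for c
      using that F G jump_sum_compose[OF n carr carr' that] pl_map_n_adic_iff[OF pl]
      by (simp add: jump_sum_kernel_def)
    then show "F \<otimes>\<^bsub>circle_lifts n\<^esub> G \<in> jump_sum_kernel n"
      using F G B.m_closed[of F G] by (simp add: jump_sum_kernel_def)
  qed
qed

lemma second_derived_subset_jump_sum_kernel:
  assumes n: "n \<ge> 2"
  shows "second_derived (circle_lifts n) \<subseteq> jump_sum_kernel n"
proof -
  interpret group "circle_lifts n"
    using group_pl_group[OF n] .
  interpret B: subgroup "rho_kernel n (real n - 1)" "circle_lifts n"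
    using subgroup_rho_kernel[OF n] .
  have "commutator (circle_lifts n) x y \<in> jump_sum_kernel n"
    if x: "x \<in> rho_kernel n (real n - 1)" and y: "y \<in> rho_kernel n (real n - 1)" for x y
  proof -
    have "jump_sum n (x c) y = jump_sum n c y" if "c \<in> n_adic n" for c
      using jump_sum_cong[OF n] rho_kernel_iff[OF n rho_kernel_carrier[OF x] that] x by blast
    then show ?thesis
      using x y jump_sum_commutator[OF n rho_kernel_carrier[OF x] y] B.m_closed B.m_inv_closed
      unfolding jump_sum_kernel_def by simp
  qed
  then have "derived_set (circle_lifts n) (rho_kernel n (real n - 1)) \<subseteq> jump_sum_kernel n"
    by blast
  then have "derived (circle_lifts n) (rho_kernel n (real n - 1)) \<subseteq> jump_sum_kernel n"
    unfolding derived_def using generate_subgroup_incl subgroup_jump_sum_kernel[OF n] by blast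
  then show ?thesis
    using mono_derived[OF derived_subset_rho_kernel[OF n]] by blast
qed

text \<open>The map has slopes \<open>n\<close>, \<open>1/n\<close> and \<open>1\<close> on the intervals cut out by \<open>0\<close>, \<open>1/n\<close>, \<open>1 + 1/n\<close> and \<open>n - 1\<close>, so its
jumps are \<open>1\<close>, \<open>-2\<close> and \<open>1\<close> at the first three points.  For \<open>n \<ge> 3\<close> there is room for this in one
period, and neither \<open>0\<close> nor \<open>1 + 1/n\<close> is congruent to \<open>1/n\<close>.\<close>

lemma jump_sum_separating_element:
  assumes n: "n \<ge> 3"
  obtains g where "g \<in> rho_kernel n (real n - 1)" "jump_sum n (1 / real n) g < 0"
    "\<And>c. c - 1 / real n \<notin> phi_kernel n \<Longrightarrow> jump_sum n c g \<ge> 0"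
proof -
  have n2: "n \<ge> 2"
    using n by simp
  define m where "m = real n - 1"
  define w where "w = 1 / real n"
  have w: "0 < w" "w \<le> 1 / 3" "real n * w = 1"
    using n by (simp_all add: w_def field_simps)
  have m: "m \<ge> 2"
    using n by (simp add: m_def)
  have w_slope: "w \<in> slope_group n" and n_slope: "real n \<in> slope_group n"
    using slope_group_power_int[of n "- 1"] slope_group_power_int[of n 1]
    by (simp_all add: w_def power_int_minus divide_inverse)
  have adic: "w \<in> n_adic n" "1 + w \<in> n_adic n" "1 - w * w \<in> n_adic n"
    using n_adic_add[OF n2 n_adic_1] n_adic_diff[OF n2 n_adic_1] n_adic_mult[OF n2]
      slope_group_n_adic[OF w_slope] by blast+
  define F where "F = (\<lambda>t. if t \<le> w then real n * t + 0 else if t \<le> 1 + w then w * t + (1 - w * w) else t)"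
  have 1: "pl_map n (\<lambda>t. if t \<le> 1 + w then w * t + (1 - w * w) else t)"
    using pl_map_glue2[OF adic(2) pl_map_affine[OF n2 w_slope adic(3)] pl_map_id[OF n2]]
    by (simp add: algebra_simps)
  have "pl_map n F"
    unfolding F_def using pl_map_glue2[OF adic(1) pl_map_affine[OF n2 n_slope n_adic_0] 1] w by simp
  moreover have "F (0 + (real n - 1)) = F 0 + (real n - 1)"
    using m w by (simp add: F_def flip: m_def)
  ultimately obtain g where g: "g \<in> carrier (circle_lifts n)" "\<And>t. 0 \<le> t \<Longrightarrow> t \<le> 0 + (real n - 1) \<Longrightarrow> g t = F t"
    by (rule periodic_extension[OF n2 _ n_adic_0]) blast
  have g_eq: "g t = F t" if "0 \<le> t" "t \<le> m" for t
    using g(2) that by (simp add: m_def)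
  have g_n: "g t = real n * t + 0" if "0 \<le> t" "t \<le> w" for t
    using g_eq[of t] that w m by (simp add: F_def)
  have g_w: "g t = w * t + (1 - w * w)" if "w \<le> t" "t \<le> 1 + w" for t
    using g_eq[of t] that w m by (cases "t = w") (simp_all add: F_def)
  have g_1: "g t = t" if "1 + w \<le> t" "t \<le> m" for t
    using g_eq[of t] that w m by (cases "t = 1 + w") (simp_all add: F_def algebra_simps)
  have g_neg: "g t = t" if "1 + w - m \<le> t" "t \<le> 0" for t
    using g_1[of "t + m"] that pl_group_shift[OF g(1), of t] by (simp add: m_def)
  have jump_0: "jump n g 0 = 1"
  proof -
    have "left_slope g 0 1"
      by (rule left_slope_cong[OF left_slope_affine[of 1 0], of "m - (1 + w)"]) (use m w g_neg in auto)
    moreover have "right_slope g 0 (real n)"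
      by (rule right_slope_cong[OF right_slope_affine[of "real n" 0], of w]) (use w g_n in auto)
    ultimately show ?thesis
      using jump_eq n by simp
  qed
  have jump_w: "jump n g w = - 2"
  proof -
    have "left_slope g w (real n)"
      by (rule left_slope_cong[OF left_slope_affine[of "real n" 0], of w]) (use w g_n in auto)
    moreover have "right_slope g w w"
      by (rule right_slope_cong[OF right_slope_affine[of w "1 - w * w"], of 1]) (use g_w in auto)
    ultimately have "jump n g w = log (real n) (1 / (real n ^ 2))"
      using jump_eq by (simp add: w_def power2_eq_square)
    then show ?thesis
      using n by (simp add: log_divide log_nat_power)
  qed
  have jump_1w: "jump n g (1 + w) = 1"
  proof -
    have "left_slope g (1 + w) w"
      by (rule left_slope_cong[OF left_slope_affine[of w "1 - w * w"], of 1]) (use g_w in auto)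
    moreover have "right_slope g (1 + w) 1"
      by (rule right_slope_cong[OF right_slope_affine[of 1 0], of "m - (1 + w)"]) (use m w g_1 in auto)
    ultimately show ?thesis
      using jump_eq n by (simp add: w_def)
  qed
  have jump_other: "jump n g t = 0" if t: "0 < t" "t < m" "t \<noteq> w" "t \<noteq> 1 + w" for t
  proof -
    consider "t < w" | "w < t" "t < 1 + w" | "1 + w < t"
      using t by linarith
    then show ?thesis
    proof cases
      case 1
      then show ?thesis
        using slopes_if_affine[of 0 t w g "real n" 0] g_n t n jump_eq by force
    next
      case 2
      then show ?thesis
        using slopes_if_affine[of w t "1 + w" g w "1 - w * w"] g_w w n jump_eq by force
    next
      case 3
      then show ?thesis
        using slopes_if_affine[of "1 + w" t m g 1 0] g_1 t n jump_eq by force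
    qed
  qed
  have "1 \<notin> phi_kernel n"
    using phi_kernel_iff[OF n2 n_adic_1] phi_eq[OF n2, of 1 0] n by simp
  then have one: "(1 + w) - w \<notin> phi_kernel n" and zero: "0 - w \<notin> phi_kernel n"
    using slope_mult_phi_kernel_iff[OF n2 n_slope, of w] w phi_kernel_minus[OF n2, of "- w"] by auto
  define S where "S c = {t. t \<in> {0..<m} \<and> t - c \<in> phi_kernel n}" for c
  have jump_sum_eq: "jump_sum n c g = infsum (jump n g) (S c)" for c
    by (simp add: jump_sum_def S_def m_def)
  have "jump_sum n w g = infsum (jump n g) {w}"
    unfolding jump_sum_eq
  proof (rule infsum_cong_neutral)
    fix t assume "t \<in> S w - {w}"
    then show "jump n g t = 0"
      using jump_other[of t] zero one by (cases "t = 0 \<or> t = 1 + w") (auto simp: S_def)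
  next
    fix t assume "t \<in> {w} - S w"
    then show "jump n g t = 0"
      using w m phi_kernel_0 by (auto simp: S_def)
  qed simp
  then have "jump_sum n w g < 0"
    using jump_w by simp
  moreover have "jump_sum n c g \<ge> 0" if "c - w \<notin> phi_kernel n" for c
    unfolding jump_sum_eq
  proof (rule infsum_nonneg)
    fix t assume t: "t \<in> S c"
    then have "t \<noteq> w"
      using that phi_kernel_minus[OF n2, of "w - c"] by (auto simp: S_def)
    then show "0 \<le> jump n g t"
      using jump_other[of t] jump_0 jump_1w t by (cases "t = 0 \<or> t = 1 + w") (auto simp: S_def)
  qed
  moreover have "g \<in> rho_kernel n (real n - 1)"
    using g(1) g_n[of 0] w phi_kernel_0 by (simp add: rho_kernel_def)
  ultimately show thesis
    using that by (simp add: w_def)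
qed

text \<open>Take \<open>a = [f, g]\<close> with the map \<open>g\<close> of \<open>jump_sum_separating_element\<close>, and let \<open>d\<close> be its jump sum.  By
\<open>jump_sum_commutator\<close>, applied twice, the jump sum of \<open>[f, a]\<close> is a second difference of \<open>d\<close> along an
orbit of \<open>f\<close> on the residue classes.  It is positive if the middle term is the unique negative
value of \<open>d\<close>, since \<open>f\<close> has no fixed class.\<close>

lemma rho_kernel_detected_by_jump_sum:
  assumes n: "n \<ge> 2" and f: "f \<in> carrier (circle_lifts n)" "f \<notin> rho_kernel n (real n - 1)"
  obtains a c where "a \<in> derived (circle_lifts n) (carrier (circle_lifts n))" "c \<in> n_adic n"
    "jump_sum n c (commutator (circle_lifts n) f a) \<noteq> 0"
proof -
  interpret group "circle_lifts n"
    using group_pl_group[OF n] .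
  \<comment> \<open>For \<open>n = 2\<close> all residues are \<open>0\<close>, so there is no \<open>f\<close> outside the kernel.\<close>
  have "n \<noteq> 2"
  proof
    assume "n = 2"
    then have "phi_kernel n = n_adic n"
      by (auto simp: phi_kernel_def)
    then show False
      using f pl_map_n_adic_iff[OF pl_group_pl_map[OF f(1)], of 0] n_adic_0 by (simp add: rho_kernel_def)
  qed
  then have "n \<ge> 3"
    using n by simp
  then obtain g where g: "g \<in> rho_kernel n (real n - 1)" "jump_sum n (1 / real n) g < 0"
    "\<And>c. c - 1 / real n \<notin> phi_kernel n \<Longrightarrow> jump_sum n c g \<ge> 0"
    using jump_sum_separating_element by blast
  let ?w = "1 / real n"
  have w: "?w \<in> n_adic n"
    using n_adic_power_int[of n "- 1"] by (simp add: power_int_minus divide_inverse)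
  note pl = pl_group_pl_map[OF f(1)]
  define a where "a = commutator (circle_lifts n) f g"
  define c where "c = inverse_map f ?w"
  have fc: "f c = ?w"
    using pl_map_f_inv[OF pl] by (simp add: c_def)
  have c: "c \<in> n_adic n"
    using w fc pl_map_n_adic_iff[OF pl] by metis
  have a: "a \<in> derived (circle_lifts n) (carrier (circle_lifts n))"
    unfolding a_def using f(1) g(1) rho_kernel_carrier by (intro commutator_in_derived) auto
  then have "a \<in> rho_kernel n (real n - 1)"
    using derived_subset_rho_kernel[OF n] by blast
  then have "jump_sum n c (commutator (circle_lifts n) f a)
      = jump_sum n ?w a - jump_sum n c a"
    using jump_sum_commutator[OF n f(1) _ c] fc by simp
  also have "\<dots> = jump_sum n (f ?w) g - 2 * jump_sum n ?w g + jump_sum n c g"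
    unfolding a_def using jump_sum_commutator[OF n f(1) g(1)] c w fc by simp
  also have "\<dots> > 0"
  proof -
    have "f ?w - ?w \<notin> phi_kernel n" "?w - c \<notin> phi_kernel n"
      using rho_kernel_iff[OF n f(1)] w c f(2) fc by metis+
    then have "jump_sum n (f ?w) g \<ge> 0" "jump_sum n c g \<ge> 0"
      using g(3) phi_kernel_minus[OF n, of "c - ?w"] by auto
    then show ?thesis
      using g(2) by simp
  qed
  finally show thesis
    using that a c by simp
qed

section \<open>Derivatives, breaks and slopes\<close>

lemma pl_map_continuous: "pl_map n F \<Longrightarrow> continuous_on UNIV F"
  using pl_map_surj[of n F] pl_map_le_iff[of n F] by (intro continuous_onI_mono) auto

lemma right_slope_eq_derivative:
  assumes "(F has_real_derivative D) (at t)" "right_slope F t b"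
  shows "D = b"
proof (rule tendsto_unique[OF trivial_limit_at_right_real])
  show "((\<lambda>h. (F (t + h) - F t) / h) \<longlongrightarrow> D) (at_right 0)"
    using assms(1) unfolding DERIV_def by (rule filterlim_mono) (simp_all add: at_le)
  have "\<forall>\<^sub>F h in at_right 0. b = (F (t + h) - F t) / h"
    using assms(2) eventually_at_right_less[of "0::real"] unfolding right_slope_def
    by eventually_elim simp
  then show "((\<lambda>h. (F (t + h) - F t) / h) \<longlongrightarrow> b) (at_right 0)"
    by (rule tendsto_eventually[OF eventually_mono]) auto
qed

lemma left_slope_eq_derivative:
  assumes "(F has_real_derivative D) (at t)" "left_slope F t a"
  shows "D = a"
proof (rule right_slope_eq_derivative)
  show "((\<lambda>s. - F (- s)) has_real_derivative D) (at (- t))"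
    using assms(1) by (auto intro!: derivative_eq_intros DERIV_chain2[of F D])
  show "right_slope (\<lambda>s. - F (- s)) (- t) a"
    using assms(2) by (simp add: left_slope_eq_right_slope)
qed

lemma derivative_if_locally_affine:
  fixes F :: "real \<Rightarrow> real"
  assumes "e > 0" "\<And>s. \<bar>s - t\<bar> < e \<Longrightarrow> F s = a * s + c" "\<bar>u - t\<bar> < e"
  shows "(F has_real_derivative a) (at u)"
proof -
  have "((\<lambda>s. a * s + c) has_real_derivative a) (at u)"
    by (auto intro!: derivative_eq_intros)
  then show ?thesis
    by (rule has_field_derivative_transform_within_open[of _ _ _ "ball t e"])
      (use assms in \<open>auto simp: dist_real_def abs_minus_commute\<close>)
qed

lemma pl_map_deriv_locally_constant:
  assumes n: "n \<ge> 2" and F: "pl_map n F" and "jump n F t = 0"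
  obtains e where "e > 0" "\<And>u. \<bar>u - t\<bar> < e \<Longrightarrow> (F has_real_derivative deriv F t) (at u)"
proof -
  obtain a e where ae: "e > 0" "\<And>s. \<bar>s - t\<bar> < e \<Longrightarrow> F s = a * s + (F t - a * t)"
    using pl_map_locally_affine[OF n F assms(3)] by metis
  have "(F has_real_derivative a) (at u)" if "\<bar>u - t\<bar> < e" for u
    using derivative_if_locally_affine[OF ae that] .
  moreover from this have "deriv F t = a"
    using ae(1) by (simp add: DERIV_imp_deriv)
  ultimately show thesis
    using that ae(1) by blast
qed

lemma breaks_subset_jumps:
  assumes n: "n \<ge> 2" and F: "pl_map n F"
  shows "breaks F \<subseteq> {t. jump n F t \<noteq> 0}"
proof
  fix t assume t: "t \<in> breaks F"
  show "t \<in> {t. jump n F t \<noteq> 0}"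
  proof (rule ccontr)
    assume "t \<notin> {t. jump n F t \<noteq> 0}"
    then obtain e where e: "e > 0" "\<And>u. \<bar>u - t\<bar> < e \<Longrightarrow> (F has_real_derivative deriv F t) (at u)"
      using pl_map_deriv_locally_constant[OF n F, of t] by auto
    have "F field_differentiable (at t)"
      using e(2)[of t] e(1) field_differentiable_def by auto
    moreover have "isCont (deriv F) t"
      by (rule DERIV_isCont[of _ 0], rule derivative_if_locally_affine[of e t _ 0 "deriv F t"])
        (use e DERIV_imp_deriv in auto)
    ultimately show False
      using t by (simp add: breaks_def)
  qed
qed

text \<open>The derivative is locally constant between jumps, hence constant on the interval.\<close>

lemma pl_map_affine_between_jumps:
  assumes n: "n \<ge> 2" and F: "pl_map n F" and no: "\<And>t. a < t \<Longrightarrow> t < b \<Longrightarrow> jump n F t = 0"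
  shows "\<exists>m c. \<forall>x\<in>{a<..<b}. F x = m * x + c"
proof -
  have deriv: "(F has_real_derivative deriv F t) (at t)"
    and deriv2: "(deriv F has_real_derivative 0) (at t)" if t: "a < t" "t < b" for t
  proof -
    obtain e where e: "e > 0" "\<And>u. \<bar>u - t\<bar> < e \<Longrightarrow> (F has_real_derivative deriv F t) (at u)"
      using pl_map_deriv_locally_constant[OF n F no[OF t]] by blast
    show "(F has_real_derivative deriv F t) (at t)"
      using e by simp
    have const: "deriv F u = 0 * u + deriv F t" if "\<bar>u - t\<bar> < e" for u
      using DERIV_imp_deriv[OF e(2)[OF that]] by simp
    show "(deriv F has_real_derivative 0) (at t)"
      by (rule derivative_if_locally_affine[OF e(1) const]) (use e(1) in auto)
  qed
  have "(deriv F has_real_derivative 0) (at x within {a<..<b})" if "x \<in> {a<..<b}" for x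
    using deriv2[of x] that by (simp add: has_field_derivative_at_within)
  then obtain m where m: "\<And>x. x \<in> {a<..<b} \<Longrightarrow> deriv F x = m"
    using has_field_derivative_zero_constant[OF convex_real_interval(8), of a b "deriv F"] by blast
  have "((\<lambda>x. F x - m * x) has_real_derivative 0) (at x within {a<..<b})" if "x \<in> {a<..<b}" for x
  proof -
    have "(F has_real_derivative deriv F x) (at x within {a<..<b})"
      using deriv[of x] that by (simp add: has_field_derivative_at_within)
    then have "(F has_real_derivative m) (at x within {a<..<b})"
      by (simp only: m[OF that])
    then show ?thesis
      by (auto intro!: derivative_eq_intros)
  qed
  then obtain c where "\<And>x. x \<in> {a<..<b} \<Longrightarrow> F x - m * x = c"
    using has_field_derivative_zero_constant[OF convex_real_interval(8), of a b "\<lambda>x. F x - m * x"] by blast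
  then have "\<forall>x\<in>{a<..<b}. F x = m * x + c"
    by (simp add: algebra_simps)
  then show ?thesis
    by blast
qed

lemma pl_map_piecewise_linear:
  assumes n: "n \<ge> 2" and F: "pl_map n F"
  shows "piecewise_linear F"
  unfolding piecewise_linear_def
proof (intro conjI exI[of _ "{t. jump n F t \<noteq> 0}"] allI impI)
  show "continuous_on UNIV F"
    using pl_map_continuous[OF F] .
  show "finite ({t. jump n F t \<noteq> 0} \<inter> {a..b})" for a b
    using pl_map_finite_jumps[OF n F, of a b] by (simp add: Int_def conj_commute)
  show "\<exists>m c. \<forall>x\<in>{a<..<b}. F x = m * x + c" if "{a<..<b} \<inter> {t. jump n F t \<noteq> 0} = {}" for a b
    using that by (intro pl_map_affine_between_jumps[OF n F]) auto
qed

lemma pl_map_deriv_in_slope_group: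
  assumes n: "n \<ge> 2" and F: "pl_map n F" and "F field_differentiable (at t)"
  shows "deriv F t \<in> slope_group n"
proof -
  obtain b where "b \<in> slope_group n" "right_slope F t b"
    using pl_map_slopes[OF F] by metis
  then show ?thesis
    using right_slope_eq_derivative assms(3) field_differentiable_derivI by metis
qed

lemma affine_closure:
  fixes H :: "real \<Rightarrow> real"
  assumes cont: "continuous_on UNIV H" and "u < v" and eq: "\<And>x. u < x \<Longrightarrow> x < v \<Longrightarrow> H x = m * x + c"
  shows "H u = m * u + c" "H v = m * v + c"
proof -
  have closed: "closed {x. H x = m * x + c}"
    using cont by (intro closed_Collect_eq continuous_intros) auto
  have "closure {u<..<v} \<subseteq> {x. H x = m * x + c}"
    using eq by (intro closure_minimal closed) auto
  then show "H u = m * u + c" "H v = m * v + c"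
    using \<open>u < v\<close> by (auto simp: subset_iff)
qed

text \<open>The two affine pieces next to \<open>t\<close> extend to \<open>t\<close> by continuity, and their slopes are derivatives at
neighbouring points.\<close>

lemma piecewise_linear_slopes:
  assumes pl: "piecewise_linear H"
    and slopes: "\<And>t. H field_differentiable (at t) \<Longrightarrow> deriv H t \<in> slope_group n"
  obtains a b where "a \<in> slope_group n" "b \<in> slope_group n" "left_slope H t a" "right_slope H t b"
proof -
  have cont: "continuous_on UNIV H"
    using pl by (simp add: piecewise_linear_def)
  obtain D where D: "\<And>a b. finite (D \<inter> {a..b})"
      "\<And>a b. {a<..<b} \<inter> D = {} \<Longrightarrow> \<exists>m c. \<forall>x\<in>{a<..<b}. H x = m * x + c"
    using pl by (auto simp: piecewise_linear_def)
  obtain d where d: "d > 0" "\<And>x. x \<in> D \<inter> {t - 1..t + 1} \<Longrightarrow> x \<noteq> t \<Longrightarrow> d \<le> dist t x"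
    using finite_set_avoid[OF D(1), of "t - 1" "t + 1" t] by auto
  define e where "e = min d 1"
  have e: "e > 0" "e \<le> d" "e \<le> 1"
    using d by (auto simp: e_def)
  have "{t - e<..<t} \<inter> D = {}" "{t<..<t + e} \<inter> D = {}"
    using d(2) e by (fastforce simp: dist_real_def)+
  then obtain m c m' c' where left: "\<And>x. t - e < x \<Longrightarrow> x < t \<Longrightarrow> H x = m * x + c"
      and right: "\<And>x. t < x \<Longrightarrow> x < t + e \<Longrightarrow> H x = m' * x + c'"
    using D(2) by (metis greaterThanLessThan_iff)
  have slope: "k \<in> slope_group n" if "u < v" "\<And>x. u < x \<Longrightarrow> x < v \<Longrightarrow> H x = k * x + l" for u v k l
  proof -
    have "(H has_real_derivative k) (at ((u + v) / 2))"
      by (rule derivative_if_locally_affine[of "(v - u) / 2" "(u + v) / 2" H k l])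
        (use that in \<open>auto simp: abs_if field_simps split: if_splits\<close>)
    then show ?thesis
      using slopes[of "(u + v) / 2"] DERIV_imp_deriv field_differentiable_def by metis
  qed
  have "H t = m * t + c" "H t = m' * t + c'"
    using affine_closure(2)[OF cont, of "t - e" t m c] affine_closure(1)[OF cont, of t "t + e" m' c']
      left right e by auto
  then have left': "\<And>x. t - e < x \<Longrightarrow> x \<le> t \<Longrightarrow> H x = m * x + c"
    and right': "\<And>x. t \<le> x \<Longrightarrow> x < t + e \<Longrightarrow> H x = m' * x + c'"
    using left right by (metis le_less)+
  have "left_slope H t m"
    using left' e by (intro left_slope_cong[OF left_slope_affine[of m c], of e]) auto
  moreover have "right_slope H t m'"
    using right' e by (intro right_slope_cong[OF right_slope_affine[of m' c'], of e]) auto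
  moreover have "m \<in> slope_group n" "m' \<in> slope_group n"
    using slope[of "t - e" t m c] slope[of t "t + e" m' c'] left right e by auto
  ultimately show thesis
    using that by blast
qed

section \<open>From lifts to homeomorphisms\<close>

text \<open>What the line and the circle have in common.  The period \<open>p\<close> of the covering map is \<open>0\<close> for the line
and \<open>n - 1\<close> for the circle.\<close>

locale n_adic_covering =
  fixes n :: nat and p :: real and X :: "'a covered_space"
  assumes n: "n \<ge> 2"
    and period: "p \<ge> 0" "p \<in> phi_kernel n"
    and quotient: "quotient_map euclideanreal (topo X) (proj X)"
    and proj_eq_iff: "proj X s = proj X t \<longleftrightarrow> (\<exists>k::int. t = s + of_int k * p)"
    and phi_on_proj: "x \<in> n_adic n \<Longrightarrow> phi_on n X (proj X x) = phi n x"
begin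

text \<open>The map of \<open>X\<close> with lift \<open>F\<close>.  The choice of the preimage does not matter if \<open>F\<close> commutes with the
translation by \<open>p\<close> (see \<open>descend_proj\<close>).\<close>

definition descend :: "(real \<Rightarrow> real) \<Rightarrow> 'a \<Rightarrow> 'a" where
  "descend F = (\<lambda>y\<in>topspace (topo X). proj X (F (SOME t. proj X t = y)))"

lemma topspace_eq: "topspace (topo X) = range (proj X)"
  using quotient_imp_surjective_map[OF quotient] by simp

lemma period_n_adic: "of_int k * p \<in> n_adic n"
  using n_adic_mult[OF n n_adic_of_int] phi_kernel_n_adic[OF n period(2)] by blast

lemma proj_shift: "proj X t = proj X (t + p)"
  unfolding proj_eq_iff by (intro exI[of _ 1]) simp

lemma proj_n_adic_iff: "proj X t \<in> proj X ` n_adic n \<longleftrightarrow> t \<in> n_adic n"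
proof
  assume "proj X t \<in> proj X ` n_adic n"
  then obtain z k where "z \<in> n_adic n" "t = z + of_int k * p"
    using proj_eq_iff by fastforce
  then show "t \<in> n_adic n"
    using n_adic_add[OF n _ period_n_adic] by simp
qed simp

lemma descend_proj:
  assumes "F \<in> carrier (pl_group n p)"
  shows "descend F (proj X t) = proj X (F t)"
proof -
  define s where "s = (SOME s. proj X s = proj X t)"
  have "proj X s = proj X t"
    unfolding s_def by (rule someI) simp
  then obtain k :: int where "t = s + of_int k * p"
    using proj_eq_iff by blast
  then have "F t = F s + of_int k * p"
    using pl_group_shift_int[OF assms] by simp
  then have "proj X (F s) = proj X (F t)"
    using proj_eq_iff by blast
  then show ?thesis
    by (simp add: descend_def s_def topspace_eq)
qed

lemma extensional_eqI:
  assumes "f \<in> extensional (topspace (topo X))" "g \<in> extensional (topspace (topo X))"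
    "\<And>t. f (proj X t) = g (proj X t)"
  shows "f = g"
  using assms(1,2) by (rule extensionalityI) (use assms(3) in \<open>auto simp: topspace_eq\<close>)

lemma descend_extensional: "descend F \<in> extensional (topspace (topo X))"
  by (simp add: descend_def)

lemma continuous_descend:
  assumes F: "F \<in> carrier (pl_group n p)"
  shows "continuous_map (topo X) (topo X) (descend F)"
proof -
  have "continuous_map euclideanreal euclideanreal F"
    using pl_map_continuous[OF pl_group_pl_map[OF F]] by simp
  then have "continuous_map euclideanreal (topo X) (proj X \<circ> F)"
    using quotient_imp_continuous_map[OF quotient] by (rule continuous_map_compose)
  also have "proj X \<circ> F = descend F \<circ> proj X"
    using descend_proj[OF F] by auto
  finally show ?thesis
    using continuous_compose_quotient_map_eq[OF quotient] by blast
qed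

lemma descend_homeomorphism:
  assumes F: "F \<in> carrier (pl_group n p)"
  shows "descend F \<in> carrier (Homeo X)"
proof -
  note pl = pl_group_pl_map[OF F]
  have inv: "inverse_map F \<in> carrier (pl_group n p)"
    using inverse_map_pl_group[OF n F] .
  have "homeomorphic_maps (topo X) (topo X) (descend F) (descend (inverse_map F))"
    unfolding homeomorphic_maps_def
    using continuous_descend[OF F] continuous_descend[OF inv] descend_proj[OF F] descend_proj[OF inv]
      pl_map_f_inv[OF pl] pl_map_inv_f[OF pl] by (auto simp: topspace_eq)
  then show ?thesis
    using descend_extensional by (auto simp: Homeo_def homeomorphic_map_maps)
qed

lemma group_hom_descend: "group_hom (pl_group n p) (Homeo X) descend"
proof -
  interpret group "pl_group n p"
    using group_pl_group[OF n] .
  have "descend (G \<circ> F) = compose (topspace (topo X)) (descend G) (descend F)"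
    if F: "F \<in> carrier (pl_group n p)" and G: "G \<in> carrier (pl_group n p)" for F G
  proof (rule extensional_eqI)
    have "G \<circ> F \<in> carrier (pl_group n p)"
      using m_closed[OF F G] by simp
    then show "descend (G \<circ> F) (proj X t) = compose (topspace (topo X)) (descend G) (descend F) (proj X t)"
      for t
      using descend_proj F G by (simp add: compose_def topspace_eq)
  qed (auto simp: descend_extensional compose_def)
  then have "descend \<in> hom (pl_group n p) (Homeo X)"
    using descend_homeomorphism by (intro homI) (simp_all add: Homeo_def)
  then show ?thesis
    using group_pl_group[OF n] group_Homeo by (simp add: group_hom_def group_hom_axioms_def)
qed

text \<open>Jumps are isolated and recur with the period, so a small interval about a jump \<open>t\<close> projects to an
open set that contains the image of no jump other than \<open>t\<close>.\<close>

lemma discrete_proj_jumps: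
  assumes F: "F \<in> carrier (pl_group n p)"
  shows "subtopology (topo X) (proj X ` {t. jump n F t \<noteq> 0})
    = discrete_topology (proj X ` {t. jump n F t \<noteq> 0})"
proof -
  let ?D = "proj X ` {t. jump n F t \<noteq> 0}"
  have "openin (subtopology (topo X) ?D) {proj X t}" if t: "jump n F t \<noteq> 0" for t
  proof -
    obtain e where e: "e > 0" "\<And>s. s \<noteq> t \<Longrightarrow> \<bar>s - t\<bar> < e \<Longrightarrow> jump n F s = 0"
      using pl_map_jumps_isolated[OF n pl_group_pl_map[OF F]] by metis
    define U where "U = proj X ` {s. \<bar>s - t\<bar> < e}"
    have "{x. proj X x \<in> U} = (\<Union>k::int. {x. \<bar>x + of_int k * p - t\<bar> < e})"
    proof (intro equalityI subsetI)
      fix x assume "x \<in> {x. proj X x \<in> U}"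
      then obtain s where "proj X x = proj X s" "\<bar>s - t\<bar> < e"
        by (auto simp: U_def)
      then show "x \<in> (\<Union>k::int. {x. \<bar>x + of_int k * p - t\<bar> < e})"
        using proj_eq_iff[of x s] by auto
    next
      fix x assume "x \<in> (\<Union>k::int. {x. \<bar>x + of_int k * p - t\<bar> < e})"
      then obtain k :: int where "\<bar>x + of_int k * p - t\<bar> < e"
        by auto
      moreover have "proj X x = proj X (x + of_int k * p)"
        using proj_eq_iff by blast
      ultimately show "x \<in> {x. proj X x \<in> U}"
        by (auto simp: U_def)
    qed
    also have "open \<dots>"
      by (intro open_UN ballI open_Collect_less continuous_intros)
    finally have "open {x. proj X x \<in> U}" .
    moreover have "U \<subseteq> topspace (topo X)"
      by (auto simp: U_def topspace_eq)
    ultimately have "openin (topo X) U"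
      using quotient unfolding quotient_map_def by simp
    moreover have "U \<inter> ?D = {proj X t}"
    proof
      show "{proj X t} \<subseteq> U \<inter> ?D"
        using t e(1) by (auto simp: U_def)
      show "U \<inter> ?D \<subseteq> {proj X t}"
      proof
        fix y assume "y \<in> U \<inter> ?D"
        then obtain s r where sr: "y = proj X s" "\<bar>s - t\<bar> < e" "y = proj X r" "jump n F r \<noteq> 0"
          unfolding U_def by blast
        then obtain k :: int where "s = r + of_int k * p"
          using proj_eq_iff[of r s] by metis
        then have "jump n F s \<noteq> 0"
          using jump_shift_int[OF F] sr(4) by simp
        then have "s = t"
          using e(2) sr(2) by blast
        then show "y \<in> {proj X t}"
          using sr(1) by simp
      qed
    qed
    ultimately show ?thesis
      using openin_subtopology_Int by metis
  qed
  then show ?thesis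
    using discrete_topology_unique[of ?D "subtopology (topo X) ?D"]
    by (auto simp: topspace_eq)
qed

lemma descend_in_A_set:
  assumes F: "F \<in> carrier (pl_group n p)"
  shows "descend F \<in> A_set n X"
proof -
  note pl = pl_group_pl_map[OF F]
  have "is_lift X (descend F) F"
    using pl_map_continuous[OF pl] descend_proj[OF F] by (simp add: is_lift_def)
  moreover have "proj X ` {t. jump n F t \<noteq> 0} \<subseteq> proj X ` n_adic n"
    using pl_map_jump_n_adic[OF n pl] by blast
  moreover have "proj X ` breaks F \<subseteq> proj X ` {t. jump n F t \<noteq> 0}"
    using breaks_subset_jumps[OF n pl] by blast
  moreover have "descend F ` (proj X ` n_adic n) = proj X ` n_adic n"
  proof -
    have "F ` n_adic n = n_adic n"
    proof (intro equalityI subsetI)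
      fix x assume "x \<in> n_adic n"
      then have "inverse_map F x \<in> n_adic n"
        using pl_map_n_adic_iff[OF pl_map_inv[OF n pl]] by simp
      then show "x \<in> F ` n_adic n"
        using pl_map_f_inv[OF pl, of x] by (metis image_eqI)
    qed (use pl_map_n_adic_iff[OF pl] in auto)
    then have "proj X ` (F ` n_adic n) = proj X ` n_adic n"
      by simp
    then show ?thesis
      by (simp add: image_image descend_proj[OF F])
  qed
  ultimately show ?thesis
    unfolding A_set_def
    using descend_homeomorphism[OF F] pl_map_strict_mono[OF pl] pl_map_piecewise_linear[OF n pl]
      pl_map_deriv_in_slope_group[OF n pl] discrete_proj_jumps[OF F] by blast
qed

text \<open>A lift of a homeomorphism commutes with the translation by \<open>p\<close>: it satisfies \<open>H (t + p) = H t + k p\<close> with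
\<open>k \<ge> 1\<close> by monotonicity, and \<open>k \<ge> 2\<close> would contradict injectivity, by the intermediate value theorem.
Surjectivity and the condition on \<open>n\<close>-adic points are inherited from \<open>h\<close>.\<close>

lemma lift_of_A_set:
  assumes "h \<in> A_set n X"
  obtains H where "H \<in> carrier (pl_group n p)" "h = descend H"
proof -
  have h: "h \<in> carrier (Homeo X)" "h ` (proj X ` n_adic n) = proj X ` n_adic n"
    using assms unfolding A_set_def mem_Collect_eq by iprover+
  obtain H where H: "is_lift X h H" "strict_mono H" "piecewise_linear H"
      "\<And>t. H field_differentiable (at t) \<Longrightarrow> deriv H t \<in> slope_group n"
    and ex_D: "\<exists>D\<subseteq>proj X ` n_adic n. subtopology (topo X) D = discrete_topology D \<and> proj X ` breaks H \<subseteq> D"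
    using assms unfolding A_set_def mem_Collect_eq by iprover
  obtain D where D: "D \<subseteq> proj X ` n_adic n" "proj X ` breaks H \<subseteq> D"
    using ex_D by blast
  have cont: "continuous_on UNIV H" and lift: "\<And>t. proj X (H t) = h (proj X t)"
    using H(1) by (auto simp: is_lift_def)
  have h_inj: "h (proj X s) = h (proj X t) \<longleftrightarrow> proj X s = proj X t" for s t
  proof -
    have "inj_on h (range (proj X))"
      using h(1) homeomorphic_imp_injective_map[of "topo X" "topo X" h]
      by (simp add: Homeo_def topspace_eq)
    then show ?thesis
      by (simp add: inj_on_eq_iff)
  qed
  have shift: "H (t + p) = H t + p" for t
  proof (cases "p = 0")
    case False
    then have p: "p > 0"
      using period by simp
    have "proj X t = proj X (t + p)"
      using proj_shift .
    then have "proj X (H t) = proj X (H (t + p))"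
      using lift by simp
    then obtain k :: int where k: "H (t + p) = H t + of_int k * p"
      using proj_eq_iff by blast
    have "H t < H (t + p)"
      using H(2) p by (simp add: strict_mono_less)
    then have "k \<ge> 1"
      using k p by (simp add: zero_less_mult_iff)
    have "\<not> k \<ge> 2"
    proof
      assume "k \<ge> 2"
      then have "2 * p \<le> of_int k * p"
        using p by simp
      then have "H t \<le> H t + p" "H t + p \<le> H (t + p)"
        using k p by simp_all
      then obtain u where u: "t \<le> u" "u \<le> t + p" "H u = H t + p"
        using IVT'[of H t "H t + p" "t + p"] p continuous_on_subset[OF cont] by auto
      then have "H t < H u" "H u < H (t + p)"
        using k p \<open>2 * p \<le> of_int k * p\<close> by simp_all
      then have "t < u" "u < t + p"
        using H(2) strict_mono_less by blast+
      have "proj X (H t) = proj X (H u)"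
        using proj_shift u(3) by simp
      then obtain j :: int where "u = t + of_int j * p"
        using lift h_inj proj_eq_iff by metis
      then have "0 < of_int j * p" "of_int j * p < 1 * p"
        using \<open>t < u\<close> \<open>u < t + p\<close> by simp_all
      then have "0 < (of_int j :: real)" "(of_int j :: real) < 1"
        using p mult_right_less_imp_less[of "of_int j" p 1] by (simp_all add: zero_less_mult_iff)
      then show False
        by simp
    qed
    then show ?thesis
      using k \<open>k \<ge> 1\<close> by simp
  qed simp
  have shift_int: "H (t + of_int k * p) = H t + of_int k * p" for t and k :: int
  proof (induction k rule: int_induct[of _ 0])
    case (step1 i)
    then show ?case
      using shift[of "t + of_int i * p"] by (simp add: algebra_simps)
  next
    case (step2 i)
    then show ?case
      using shift[of "t + of_int (i - 1) * p"] by (simp add: algebra_simps)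
  qed simp
  have "pl_map n H"
  proof (rule pl_mapI[OF H(2)])
    have "\<exists>t. H t = y" for y
    proof -
      have "proj X y \<in> h ` topspace (topo X)"
        using h(1) homeomorphic_imp_surjective_map[of "topo X" "topo X" h]
        by (simp add: Homeo_def topspace_eq)
      then obtain t where "proj X (H t) = proj X y"
        using lift by (auto simp: topspace_eq)
      then obtain k :: int where "y = H t + of_int k * p"
        using proj_eq_iff by blast
      then show ?thesis
        using shift_int by metis
    qed
    then show "surj H"
      by (metis surjI)
    show "H t \<in> n_adic n \<longleftrightarrow> t \<in> n_adic n" for t
    proof -
      have "h (proj X t) \<in> h ` (proj X ` n_adic n) \<longleftrightarrow> proj X t \<in> proj X ` n_adic n"
        using h_inj by auto
      then show ?thesis
        using lift[of t] h(2) proj_n_adic_iff by metis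
    qed
    fix t
    obtain a b where ab: "a \<in> slope_group n" "b \<in> slope_group n" "left_slope H t a" "right_slope H t b"
      using piecewise_linear_slopes[OF H(3,4)] .
    have "a = b" if "t \<notin> n_adic n"
    proof -
      have "t \<notin> breaks H"
        using that D proj_n_adic_iff by blast
      then have "(H has_real_derivative deriv H t) (at t)"
        by (simp add: breaks_def field_differentiable_derivI)
      then show ?thesis
        using left_slope_eq_derivative ab(3) right_slope_eq_derivative ab(4) by metis
    qed
    then show "\<exists>a\<in>slope_group n. \<exists>b\<in>slope_group n.
        left_slope H t a \<and> right_slope H t b \<and> (a = b \<or> t \<in> n_adic n)"
      using ab by blast
  qed
  then have carr: "H \<in> carrier (pl_group n p)"
    using shift by (simp add: pl_group_carrier)
  have "h = descend H"
  proof (rule extensional_eqI)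
    show "h (proj X t) = descend H (proj X t)" for t
      using lift descend_proj[OF carr] by simp
  qed (use h(1) descend_extensional in \<open>auto simp: Homeo_def\<close>)
  then show thesis
    using that carr by blast
qed

lemma A_set_eq: "A_set n X = descend ` carrier (pl_group n p)"
  using descend_in_A_set lift_of_A_set by blast

lemma subgroup_A_set: "subgroup (A_set n X) (Homeo X)"
  using group_hom.img_is_subgroup[OF group_hom_descend] by (simp add: A_set_eq)

lemma group_A_group: "group (A_group n X)"
  unfolding A_group_def by (rule group.subgroup_imp_group[OF group_Homeo subgroup_A_set])

lemma group_hom_descend_A_group: "group_hom (pl_group n p) (A_group n X) descend"
proof -
  have "descend \<in> hom (pl_group n p) (A_group n X)"
    using group_hom.homh[OF group_hom_descend] descend_in_A_set by (auto simp: A_group_def hom_def)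
  then show ?thesis
    using group_pl_group[OF n] group_A_group by (simp add: group_hom_def group_hom_axioms_def)
qed

lemma rho_descend:
  assumes F: "F \<in> carrier (pl_group n p)"
  shows "rho n X (descend F) = phi n (F 0)"
  unfolding rho_def
proof (rule the_equality)
  note pl = pl_group_pl_map[OF F]
  have *: "(phi_on n X (descend F (proj X x)) - phi_on n X (proj X x)) mod int (n - 1) = phi n (F 0)"
    if x: "x \<in> n_adic n" for x
  proof -
    have adic: "F x \<in> n_adic n" "F 0 \<in> n_adic n"
      using x n_adic_0 pl_map_n_adic_iff[OF pl] by blast+
    have "(F x - x) - F 0 \<in> phi_kernel n"
      using pl_map_displacement[OF n pl n_adic_0 x] by (simp add: algebra_simps)
    then have "phi n (F x - x) = phi n (F 0)"
      using phi_cong[OF n n_adic_diff[OF n adic(1) x] adic(2)] by blast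
    then show ?thesis
      using phi_diff[OF n adic(1) x] x adic descend_proj[OF F] phi_on_proj by simp
  qed
  then show "\<forall>y\<in>proj X ` n_adic n. phi n (F 0) = (phi_on n X (descend F y) - phi_on n X y) mod int (n - 1)"
    by auto
  fix r
  assume "\<forall>y\<in>proj X ` n_adic n. r = (phi_on n X (descend F y) - phi_on n X y) mod int (n - 1)"
  then show "r = phi n (F 0)"
    using *[OF n_adic_0] n_adic_0 by (metis image_eqI)
qed

lemma B_set_eq: "B_set n X = descend ` rho_kernel n p"
proof -
  have "rho n X (descend F) = 0 \<longleftrightarrow> F \<in> rho_kernel n p" if F: "F \<in> carrier (pl_group n p)" for F
    using phi_kernel_iff[OF n] pl_map_n_adic_iff[OF pl_group_pl_map[OF F]] n_adic_0 F
    by (simp add: rho_descend rho_kernel_def)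
  then show ?thesis
    using rho_kernel_carrier by (auto simp: B_set_def kernel_def A_group_def A_set_eq)
qed

lemma subgroup_B_set: "subgroup (B_set n X) (A_group n X)"
  using group_hom.subgroup_img_is_subgroup[OF group_hom_descend_A_group subgroup_rho_kernel[OF n]]
  by (simp add: B_set_eq)

lemma derived_A_group:
  "derived (A_group n X) (carrier (A_group n X)) = descend ` derived (pl_group n p) (carrier (pl_group n p))"
  "second_derived (A_group n X) = descend ` second_derived (pl_group n p)"
proof -
  interpret group_hom "pl_group n p" "A_group n X" descend
    using group_hom_descend_A_group .
  have "carrier (A_group n X) = descend ` carrier (pl_group n p)"
    by (simp add: A_group_def A_set_eq)
  then show "derived (A_group n X) (carrier (A_group n X)) = descend ` derived (pl_group n p) (carrier (pl_group n p))"
    using derived_img[OF order_refl] by simp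
  then show "second_derived (A_group n X) = descend ` second_derived (pl_group n p)"
    using derived_img[OF G.derived_in_carrier[OF order_refl]] by simp
qed

end

section \<open>The two spaces\<close>

lemma (in n_adic_covering) normalizer_subset:
  assumes "characteristic (B_set n X) (A_group n X)"
  shows "normalizer (Homeo X) (A_set n X) \<subseteq> normalizer (Homeo X) (B_set n X)"
  using normalizer_subset_if_characteristic[OF group_Homeo subgroup_A_set] assms
  by (simp add: A_group_def)

text \<open>The difference of the lifts is continuous with values in \<open>p\<int>\<close>.\<close>

lemma (in n_adic_covering) lifts_differ_by_constant:
  assumes F: "F \<in> carrier (pl_group n p)" and G: "G \<in> carrier (pl_group n p)"
    and eq: "descend F = descend G"
  obtains c where "\<And>t. F t = G t + c"
proof -
  have "\<exists>k::int. F t = G t + of_int k * p" for t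
    using eq descend_proj[OF F, of t] descend_proj[OF G, of t] proj_eq_iff[of "G t" "F t"] by simp
  then obtain k :: "real \<Rightarrow> int" where k: "\<And>t. F t = G t + of_int (k t) * p"
    by metis
  show thesis
  proof (cases "p = 0")
    case True
    then show thesis
      using that[of 0] k by simp
  next
    case False
    have "(\<lambda>t. F t - G t) constant_on UNIV"
    proof (rule continuous_discrete_range_constant[OF connected_UNIV])
      show "continuous_on UNIV (\<lambda>t. F t - G t)"
        using pl_map_continuous pl_group_pl_map F G by (intro continuous_on_diff) blast+
      show "\<exists>e>0. \<forall>s. s \<in> UNIV \<and> F s - G s \<noteq> F t - G t \<longrightarrow> e \<le> norm (F s - G s - (F t - G t))" for t
      proof (intro exI[of _ p] conjI allI impI)
        fix s assume "s \<in> UNIV \<and> F s - G s \<noteq> F t - G t"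
        then have "k s \<noteq> k t"
          using k[of s] k[of t] by auto
        then have "1 \<le> \<bar>of_int (k s - k t) :: real\<bar>"
          by linarith
        then have "1 * p \<le> \<bar>of_int (k s - k t)\<bar> * p"
          using period(1) by (intro mult_right_mono)
        then show "p \<le> norm (F s - G s - (F t - G t))"
          using k[of s] k[of t] period(1) by (simp add: abs_mult flip: left_diff_distrib)
      qed (use False period(1) in simp)
    qed
    then obtain c where "\<And>t. F t - G t = c"
      by (auto simp: constant_on_def)
    then have "F t = G t + c" for t
      by (metis diff_add_cancel add.commute)
    then show thesis
      using that by blast
  qed
qed

lemma jump_add_constant:
  assumes "\<And>t. F t = G t + c"
  shows "jump n F t = jump n G t"
proof -
  have "right_slope F t b \<longleftrightarrow> right_slope G t b" "left_slope F t b \<longleftrightarrow> left_slope G t b" for b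
    by (simp_all add: right_slope_def left_slope_def assms)
  then show ?thesis
    by (simp add: jump_def)
qed

lemma n_adic_covering_real_line:
  assumes "n \<ge> 2"
  shows "n_adic_covering n 0 real_line"
proof
  show "quotient_map euclideanreal (topo real_line) (proj real_line)"
    by (simp add: quotient_map_def real_line_def)
  show "phi_on n real_line (proj real_line x) = phi n x" if "x \<in> n_adic n" for x
    using phi_on_real_line[OF that] by (simp add: real_line_def)
qed (use assms phi_kernel_0 in \<open>auto simp: real_line_def\<close>)

lemma n_adic_covering_circle:
  assumes "n \<ge> 2"
  shows "n_adic_covering n (real n - 1) (circle n)"
proof
  show "quotient_map euclideanreal (topo (circle n)) (proj (circle n))"
    using quotient_map_circle_proj by (simp add: circle_def)
  show "phi_on n (circle n) (proj (circle n) x) = phi n x" if "x \<in> n_adic n" for x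
    using phi_on_circle[OF assms that] by (simp add: circle_def)
  show "proj (circle n) s = proj (circle n) t \<longleftrightarrow> (\<exists>k::int. t = s + of_int k * (real n - 1))" for s t
  proof
    assume "proj (circle n) s = proj (circle n) t"
    moreover have "t \<in> circle_proj n t"
      unfolding circle_proj_def by (rule range_eqI[of _ _ 0]) simp
    ultimately show "\<exists>k::int. t = s + of_int k * (real n - 1)"
      by (auto simp: circle_def circle_proj_def)
  next
    assume "\<exists>k::int. t = s + of_int k * (real n - 1)"
    then obtain k :: int where k: "t = s + of_int k * (real n - 1)" ..
    have shift: "t + of_int j * (real n - 1) = s + of_int (k + j) * (real n - 1)" for j
      by (simp add: k algebra_simps)
    have "circle_proj n t = (\<lambda>j. s + of_int j * (real n - 1)) ` range (\<lambda>j::int. k + j)"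
      by (simp only: circle_proj_def image_image shift)
    also have "range (\<lambda>j. k + j) = UNIV"
      by (rule surjI[of _ "\<lambda>j. j - k"]) simp
    finally show "proj (circle n) s = proj (circle n) t"
      by (simp add: circle_def circle_proj_def)
  qed
qed (use assms phi_kernel_period in auto)

lemma characteristic_real_line:
  assumes n: "n \<ge> 2"
  shows "characteristic (B_set n real_line) (A_group n real_line)"
proof -
  interpret n_adic_covering n 0 real_line
    using n_adic_covering_real_line[OF n] .
  have "B_set n real_line = derived (A_group n real_line) (carrier (A_group n real_line))"
    using B_set_eq derived_A_group(1) rho_kernel_line_eq_derived[OF n] by simp
  then show ?thesis
    using characteristic_derived[OF group_A_group] by simp
qed

text \<open>Membership is tested on lifts.  Passing to lifts changes an element of the second derived subgroup by
a translation at most, and jump sums do not see translations.\<close>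

lemma B_set_circle_eq:
  assumes n: "n \<ge> 2"
  shows "B_set n (circle n) = derived_quotient_centralizer (A_group n (circle n))"
proof -
  let ?p = "real n - 1" and ?A = "A_group n (circle n)"
  interpret n_adic_covering n ?p "circle n"
    using n_adic_covering_circle[OF n] .
  interpret group_hom "circle_lifts n" ?A descend
    using group_hom_descend_A_group .
  have carr: "carrier ?A = descend ` carrier (circle_lifts n)"
    by (simp add: A_group_def A_set_eq)
  have D: "derived (circle_lifts n) (carrier (circle_lifts n)) \<subseteq> rho_kernel n ?p"
    using derived_subset_rho_kernel[OF n] .
  have commutator: "commutator ?A (descend f) (descend a)
      = descend (commutator (circle_lifts n) f a)"
    if "f \<in> carrier (circle_lifts n)" "a \<in> carrier (circle_lifts n)" for f a
    using that by (simp del: pl_group_simps)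
  have "descend f \<in> derived_quotient_centralizer ?A \<longleftrightarrow> f \<in> rho_kernel n ?p"
    if f: "f \<in> carrier (circle_lifts n)" for f
  proof
    assume f': "f \<in> rho_kernel n ?p"
    have "commutator ?A (descend f) (descend a) \<in> second_derived ?A"
      if "a \<in> derived (circle_lifts n) (carrier (circle_lifts n))" for a
      using rho_kernel_commutator_in_second_derived[OF n f', of a] that D commutator[OF f]
        rho_kernel_carrier derived_A_group(2) by auto
    then have "\<forall>y\<in>derived ?A (carrier ?A).
        commutator ?A (descend f) y \<in> second_derived ?A"
      unfolding derived_A_group(1) by blast
    then show "descend f \<in> derived_quotient_centralizer ?A"
      using f by (simp add: derived_quotient_centralizer_def)
  next
    assume *: "descend f \<in> derived_quotient_centralizer ?A"
    show "f \<in> rho_kernel n ?p"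
    proof (rule ccontr)
      assume "f \<notin> rho_kernel n ?p"
      then obtain a c where a: "a \<in> derived (circle_lifts n) (carrier (circle_lifts n))" "c \<in> n_adic n"
        "jump_sum n c (commutator (circle_lifts n) f a) \<noteq> 0"
        using rho_kernel_detected_by_jump_sum[OF n f] by blast
      define w where "w = commutator (circle_lifts n) f a"
      have a': "a \<in> carrier (circle_lifts n)"
        using a(1) D rho_kernel_carrier by blast
      have w: "w \<in> carrier (circle_lifts n)"
        unfolding w_def using f a' by blast
      have "descend a \<in> derived ?A (carrier ?A)"
        using a(1) derived_A_group(1) by blast
      then have "commutator ?A (descend f) (descend a)
          \<in> second_derived ?A"
        using * unfolding derived_quotient_centralizer_def by blast
      then have "descend w \<in> descend ` second_derived (circle_lifts n)"
        by (simp only: commutator[OF f a'] derived_A_group(2) w_def)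
      then obtain y where y: "y \<in> second_derived (circle_lifts n)" "descend w = descend y"
        by blast
      have y_ker: "y \<in> jump_sum_kernel n"
        using y(1) second_derived_subset_jump_sum_kernel[OF n] by blast
      then have y_carr: "y \<in> carrier (circle_lifts n)"
        by (auto simp: jump_sum_kernel_def rho_kernel_def)
      obtain k where "\<And>t. w t = y t + k"
        using lifts_differ_by_constant[OF w y_carr y(2)] by blast
      then have "jump_sum n c w = jump_sum n c y"
        using jump_add_constant[of w y k] by (simp add: jump_sum_def)
      then show False
        using y_ker a(2,3) by (simp add: jump_sum_kernel_def w_def)
    qed
  qed
  then show ?thesis
    using rho_kernel_carrier carr by (auto simp: B_set_eq derived_quotient_centralizer_def)
qed

lemma characteristic_circle:
  assumes n: "n \<ge> 2"
  shows "characteristic (B_set n (circle n)) (A_group n (circle n))"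
proof -
  interpret n_adic_covering n "real n - 1" "circle n"
    using n_adic_covering_circle[OF n] .
  show ?thesis
    using subgroup_B_set auto_image_derived_quotient_centralizer[OF group_A_group]
    by (simp add: characteristic_def B_set_circle_eq[OF n])
qed

theorem proposition1p4p2:
  fixes n :: nat
  assumes "n \<ge> 2"
  shows "(normalizer (Homeo real_line) (A_set n real_line)
            \<subseteq> normalizer (Homeo real_line) (B_set n real_line) \<and>
          characteristic (B_set n real_line) (A_group n real_line)) \<and>
         (normalizer (Homeo (circle n)) (A_set n (circle n))
            \<subseteq> normalizer (Homeo (circle n)) (B_set n (circle n)) \<and>
          characteristic (B_set n (circle n)) (A_group n (circle n)))"
  using characteristic_real_line[OF assms] characteristic_circle[OF assms]
    n_adic_covering.normalizer_subset[OF n_adic_covering_real_line[OF assms]]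
    n_adic_covering.normalizer_subset[OF n_adic_covering_circle[OF assms]]
  by blast

end
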